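(* Let $(X,d,\mu)$ be a vertex weighted graph satisfying $\mathrm{V}(d_f)$ with volume growth exponent $d_f>0$. Let $K$ be a $\mu$-symmetric Markov operator on $(X,d,\mu)$ whose kernel $k$ with respect to $\mu$ satisfies $\mathrm{J}(\beta)$ for some $\beta\ge 2$. Then $K$ satisfies $\mathrm{UHKP}(d_f,\beta)$ if and only if $K$ satisfies $\mathrm{CSJ}(\beta)$.
   Context: Vertex weighted graph: $(X,E)$ is an infinite, simple, connected, locally finite graph with vertex set $X$, $d$ is the graph distance (minimal number of edges in an edge path), and $\mu$ is a measure on $X$; write $\mu(x)=\mu(\{x\})$. Balls: $B(x,r)=\{y\in X: d(x,y)\le r\}$, and $V(x,r)=\mu(B(x,r))$. $\mathbb{N}^*=\{1,2,3,\dots\}$. $\mathrm{V}(d_f)$: there exists $C_V>0$ such that $C_V^{-1}r^{d_f}\le V(x,r)\le C_V r^{d_f}$ for all $r\ge 1$, $x\in X$. A $\mu$-symmetric sub-Markov operator $K:\ell^\infty(X)\to\ell^\infty(X)$ is one given by a kernel $k:X\times X\to[0,\infty)$ with $k(x,y)=k(y,x)$, $\sum_{y\in X}k(x,y)\mu(y)\le 1$ for all $x$, and $Kf(x)=\sum_{y\in X}k(x,y)f(y)\mu(y)$. It is a $\mu$-symmetric Markov operator if $\sum_{y}k(x,y)\mu(y)=1$ for all $x$. For $n\in\mathbb{N}^*$, $k_n(x,y)$ denotes the kernel of $K^n$ with respect to $\mu$ (so $k_1=k$). For $U\subset X$, $K_U$ is the $\mu$-symmetric sub-Markov operator with kernel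 $k_U(x,y)=k(x,y)\mathbf{1}_U(x)\mathbf{1}_U(y)$. $\mathrm{J}(\beta)$: there exists $C>0$ such that $C^{-1}(1+d(x,y))^{-(d_f+\beta)}\le k(x,y)=k(y,x)\le C(1+d(x,y))^{-(d_f+\beta)}$ for all $x,y\in X$. $\mathrm{UHKP}(d_f,\beta)$: there exists $C>0$ such that $k_n(x,y)\le C\min\left(\frac{1}{n^{d_f/\beta}},\frac{n}{d(x,y)^{d_f+\beta}}\right)$ for all $x,y\in X$, $n\in\mathbb{N}^*$ (for $x=y$ the second entry of the minimum is $+\infty$). Cutoff function: for finite sets $U\subset V$ in $X$, $\phi:X\to\mathbb{R}$ is a cutoff function for $U\subset V$ if $\phi\equiv1$ on $U$ and $\phi\equiv 0$ on $X\setminus V$. Energy measure of a $\mu$-symmetric (sub-)Markov operator with kernel $k$: $\Gamma(f,g)(x)=\frac12\sum_{y\in X}(f(x)-f(y))(g(x)-g(y))k(x,y)\mu(y)\mu(x)$. $\Gamma_U$ denotes the energy measure of $K_U$ (i.e. with $k_U$ in place of $k$). $\mathrm{CSJ}(\beta)$ (for $\beta\ge 2$): there exist constants $C_1,C_2>0$ such that for any $x\in X$ and any $R,r>0$ there exists a cutoff function $\phi$ for $B(x,R)\subset B(x,R+r)$ with $\phi\equiv 1$ in $B(x,R+r/2)$, $\phi\equiv0$ in $X\setminus B(x,R+9r/10)$, and for every $f\in L^2(X,\mu)$, $$\sum_{y\in U}f^2(y)\Gamma_U(\phi,\phi)(y)\le C_1\sum_{y\in U}\Gamma_U(f,f)(y)+\frac{C_2}{r^\beta}\sum_{y\in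 U}f^2(y)\mu(y),$$ where $U=B(x,R+r)\setminus B(x,R)$. *)

theory Defs
  imports "HOL-Analysis.Analysis"
begin

text \<open>The vertex set is the whole type, and a simple graph is an irreflexive symmetric edge
  relation on it.  The measure is an arbitrary measure on all subsets of the vertex set; points
  of mass zero are allowed.\<close>

locale vertex_weighted_graph =
  fixes E :: "('a \<times> 'a) set" and M :: "'a measure"
  assumes infinite_vertices: "infinite (UNIV :: 'a set)"
    and irrefl_edges: "irrefl E"
    and sym_edges: "sym E"
    and connected_graph: "\<And>x y. (x, y) \<in> E\<^sup>*"
    and locally_finite: "\<And>x. finite (E `` {x})"
    and sets_eq: "sets M = UNIV"

definition graph_dist :: "('a \<times> 'a) set \<Rightarrow> 'a \<Rightarrow> 'a \<Rightarrow> nat" where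
  "graph_dist E x y = (LEAST n. (x, y) \<in> E ^^ n)"

definition graph_ball :: "('a \<times> 'a) set \<Rightarrow> 'a \<Rightarrow> real \<Rightarrow> 'a set" where
  "graph_ball E x r = {y. real (graph_dist E x y) \<le> r}"

definition mass :: "'a measure \<Rightarrow> 'a \<Rightarrow> real" where
  "mass M x = measure M {x}"

text \<open>The volume of a ball is taken in \<^typ>\<open>ennreal\<close>, so that the upper bound forces all balls,
  and hence all points, to have finite mass.\<close>

definition volume_growth :: "('a \<times> 'a) set \<Rightarrow> 'a measure \<Rightarrow> real \<Rightarrow> bool" where
  "volume_growth E M d\<^sub>f \<longleftrightarrow>
     (\<exists>C>0. \<forall>x. \<forall>r\<ge>1. ennreal (inverse C * r powr d\<^sub>f) \<le> emeasure M (graph_ball E x r) \<and>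
                     emeasure M (graph_ball E x r) \<le> ennreal (C * r powr d\<^sub>f))"

definition square_integrable :: "'a measure \<Rightarrow> ('a \<Rightarrow> real) \<Rightarrow> bool" where
  "square_integrable M f \<longleftrightarrow> f \<in> borel_measurable M \<and> integrable M (\<lambda>x. (f x)\<^sup>2)"

text \<open>A symmetric Markov operator is given by its kernel with respect to the measure, and is
  represented by that kernel.\<close>

definition symmetric_markov_kernel :: "'a measure \<Rightarrow> ('a \<Rightarrow> 'a \<Rightarrow> real) \<Rightarrow> bool" where
  "symmetric_markov_kernel M k \<longleftrightarrow>
     (\<forall>x y. 0 \<le> k x y) \<and> (\<forall>x y. k x y = k y x) \<and>
     (\<forall>x. ((\<lambda>y. k x y * mass M y) has_sum 1) UNIV)"

definition kernel_op :: "'a measure \<Rightarrow> ('a \<Rightarrow> 'a \<Rightarrow> real) \<Rightarrow> ('a \<Rightarrow> real) \<Rightarrow> 'a \<Rightarrow> real" where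
  "kernel_op M k f x = (\<Sum>\<^sub>\<infinity>y. k x y * f y * mass M y)"

definition kernel_comp ::
  "'a measure \<Rightarrow> ('a \<Rightarrow> 'a \<Rightarrow> real) \<Rightarrow> ('a \<Rightarrow> 'a \<Rightarrow> real) \<Rightarrow> 'a \<Rightarrow> 'a \<Rightarrow> real" where
  "kernel_comp M k h x y = (\<Sum>\<^sub>\<infinity>z. k x z * h z y * mass M z)"

text \<open>Only used for \<open>n \<ge> 1\<close>; it is the kernel of the \<open>n\<close>-th power of the operator with kernel
  \<open>k\<close>, see \<open>kernel_op_iter_kernel\<close> and \<open>iter_kernel_unique\<close> below.\<close>

definition iter_kernel :: "'a measure \<Rightarrow> ('a \<Rightarrow> 'a \<Rightarrow> real) \<Rightarrow> nat \<Rightarrow> 'a \<Rightarrow> 'a \<Rightarrow> real" where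
  "iter_kernel M k n = (kernel_comp M k ^^ (n - 1)) k"

definition restrict_kernel :: "'a set \<Rightarrow> ('a \<Rightarrow> 'a \<Rightarrow> real) \<Rightarrow> 'a \<Rightarrow> 'a \<Rightarrow> real" where
  "restrict_kernel U k x y = k x y * indicator U x * indicator U y"

definition energy_measure ::
  "'a measure \<Rightarrow> ('a \<Rightarrow> 'a \<Rightarrow> real) \<Rightarrow> ('a \<Rightarrow> real) \<Rightarrow> ('a \<Rightarrow> real) \<Rightarrow> 'a \<Rightarrow> real" where
  "energy_measure M k f g x =
     1 / 2 * (\<Sum>\<^sub>\<infinity>y. (f x - f y) * (g x - g y) * k x y * mass M y * mass M x)"

definition jump_bounds ::
  "('a \<times> 'a) set \<Rightarrow> real \<Rightarrow> real \<Rightarrow> ('a \<Rightarrow> 'a \<Rightarrow> real) \<Rightarrow> bool" where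
  "jump_bounds E d\<^sub>f \<beta> k \<longleftrightarrow>
     (\<exists>C>0. \<forall>x y. inverse C * (1 + real (graph_dist E x y)) powr (- (d\<^sub>f + \<beta>)) \<le> k x y \<and>
                  k x y = k y x \<and>
                  k x y \<le> C * (1 + real (graph_dist E x y)) powr (- (d\<^sub>f + \<beta>)))"

text \<open>On the diagonal the second entry of the minimum is infinite, whereas division by zero
  would make it zero here; hence the case distinction.\<close>

definition UHKP ::
  "('a \<times> 'a) set \<Rightarrow> 'a measure \<Rightarrow> real \<Rightarrow> real \<Rightarrow> ('a \<Rightarrow> 'a \<Rightarrow> real) \<Rightarrow> bool" where
  "UHKP E M d\<^sub>f \<beta> k \<longleftrightarrow>
     (\<exists>C>0. \<forall>x y. \<forall>n\<ge>1. iter_kernel M k n x y \<le>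
        C * (if x = y then 1 / real n powr (d\<^sub>f / \<beta>)
             else min (1 / real n powr (d\<^sub>f / \<beta>))
                      (real n / real (graph_dist E x y) powr (d\<^sub>f + \<beta>))))"

definition cutoff_function :: "'a set \<Rightarrow> 'a set \<Rightarrow> ('a \<Rightarrow> real) \<Rightarrow> bool" where
  "cutoff_function U V \<phi> \<longleftrightarrow>
     finite U \<and> finite V \<and> U \<subseteq> V \<and> (\<forall>x\<in>U. \<phi> x = 1) \<and> (\<forall>x\<in>- V. \<phi> x = 0)"

definition CSJ ::
  "('a \<times> 'a) set \<Rightarrow> 'a measure \<Rightarrow> real \<Rightarrow> ('a \<Rightarrow> 'a \<Rightarrow> real) \<Rightarrow> bool" where
  "CSJ E M \<beta> k \<longleftrightarrow>
     (\<exists>C\<^sub>1>0. \<exists>C\<^sub>2>0. \<forall>x. \<forall>R>0. \<forall>r>0. \<exists>\<phi>.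
        cutoff_function (graph_ball E x R) (graph_ball E x (R + r)) \<phi> \<and>
        (\<forall>y\<in>graph_ball E x (R + r / 2). \<phi> y = 1) \<and>
        (\<forall>y\<in>- graph_ball E x (R + 9 * r / 10). \<phi> y = 0) \<and>
        (\<forall>f. square_integrable M f \<longrightarrow>
          (let U = graph_ball E x (R + r) - graph_ball E x R;
               \<Gamma>\<^sub>U = energy_measure M (restrict_kernel U k)
           in (\<Sum>y\<in>U. (f y)\<^sup>2 * \<Gamma>\<^sub>U \<phi> \<phi> y)
                \<le> C\<^sub>1 * (\<Sum>y\<in>U. \<Gamma>\<^sub>U f f y) + C\<^sub>2 / r powr \<beta> * (\<Sum>y\<in>U. (f y)\<^sup>2 * mass M y))))"

lemma mass_nonneg: "0 \<le> mass M x"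
  by (simp add: mass_def)

lemma summable_kernel_pair:
  fixes k h :: "'a \<Rightarrow> 'a \<Rightarrow> real"
  assumes k: "\<And>x y. 0 \<le> k x y" "\<And>x. ((\<lambda>y. k x y * mass M y) has_sum 1) UNIV"
    and h: "\<And>x y. 0 \<le> h x y" "\<And>x. ((\<lambda>y. h x y * mass M y) has_sum 1) UNIV"
  shows "((\<lambda>(z, y). k x z * mass M z * (h z y * mass M y)) has_sum 1) (UNIV \<times> UNIV)"
proof (rule has_sum_SigmaI)
  have *: "((\<lambda>y. k x z * mass M z * (h z y * mass M y)) has_sum k x z * mass M z) UNIV" for z
    using has_sum_cmult_right[OF h(2)[of z], of "k x z * mass M z"] by simp
  then show "((\<lambda>y. case (z, y) of (z, y) \<Rightarrow> k x z * mass M z * (h z y * mass M y))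
      has_sum k x z * mass M z) UNIV" for z
    by simp
  show "((\<lambda>z. k x z * mass M z) has_sum 1) UNIV"
    by (rule k(2))
  show "(\<lambda>(z, y). k x z * mass M z * (h z y * mass M y)) summable_on UNIV \<times> UNIV"
    by (rule summable_on_SigmaI[where g = "\<lambda>z. k x z * mass M z"])
       (use * k h mass_nonneg[of M] in \<open>auto intro!: mult_nonneg_nonneg has_sum_imp_summable\<close>)
qed

lemma kernel_op_comp:
  fixes k h :: "'a \<Rightarrow> 'a \<Rightarrow> real"
  assumes k: "\<And>x y. 0 \<le> k x y" "\<And>x. ((\<lambda>y. k x y * mass M y) has_sum 1) UNIV"
    and h: "\<And>x y. 0 \<le> h x y" "\<And>x. ((\<lambda>y. h x y * mass M y) has_sum 1) UNIV"
    and f: "bounded (range f)"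
  shows "kernel_op M k (kernel_op M h f) x = kernel_op M (kernel_comp M k h) f x"
proof -
  define F where "F = (\<lambda>z y. k x z * mass M z * (h z y * mass M y))"
  obtain B where B: "\<And>y. \<bar>f y\<bar> \<le> B"
    using f unfolding bounded_iff by auto
  have F0: "0 \<le> F z y" for z y
    using k(1) h(1) mass_nonneg[of M] by (simp add: F_def)
  have sB: "(\<lambda>p. B * (\<lambda>(z, y). F z y) p) summable_on UNIV \<times> UNIV"
    using summable_kernel_pair[OF k h, where x = x]
    unfolding F_def by (intro summable_on_cmult_right has_sum_imp_summable)
  have bound: "norm ((\<lambda>(z, y). F z y * f y) p) \<le> B * (\<lambda>(z, y). F z y) p" for p
  proof (cases p)
    case (Pair z y)
    have "\<bar>F z y * f y\<bar> \<le> F z y * B"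
      unfolding abs_mult using F0[of z y] B[of y] by (simp add: mult_left_mono)
    then show ?thesis
      by (simp add: Pair mult.commute)
  qed
  have "(\<lambda>p. norm ((\<lambda>(z, y). F z y * f y) p)) summable_on UNIV \<times> UNIV"
    using sB bound by (rule Infinite_Sum.abs_summable_on_comparison_test')
  then have S: "(\<lambda>(z, y). F z y * f y) summable_on UNIV \<times> UNIV"
    by (rule Infinite_Sum.abs_summable_summable)
  have "kernel_op M k (kernel_op M h f) x = (\<Sum>\<^sub>\<infinity>z. \<Sum>\<^sub>\<infinity>y. F z y * f y)"
    unfolding kernel_op_def F_def
    by (simp flip: infsum_cmult_right' infsum_cmult_left' add: mult_ac)
  also have "\<dots> = (\<Sum>\<^sub>\<infinity>y. \<Sum>\<^sub>\<infinity>z. F z y * f y)"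
    using S by (rule infsum_swap_banach)
  also have "\<dots> = kernel_op M (kernel_comp M k h) f x"
    unfolding kernel_op_def kernel_comp_def F_def
    by (simp flip: infsum_cmult_right' infsum_cmult_left' add: mult_ac)
  finally show ?thesis .
qed

lemma kernel_comp_markov:
  fixes k h :: "'a \<Rightarrow> 'a \<Rightarrow> real"
  assumes k: "\<And>x y. 0 \<le> k x y" "\<And>x. ((\<lambda>y. k x y * mass M y) has_sum 1) UNIV"
    and h: "\<And>x y. 0 \<le> h x y" "\<And>x. ((\<lambda>y. h x y * mass M y) has_sum 1) UNIV"
  shows "0 \<le> kernel_comp M k h x y"
    and "((\<lambda>y. kernel_comp M k h x y * mass M y) has_sum 1) UNIV"
proof -
  show "0 \<le> kernel_comp M k h x y"
    unfolding kernel_comp_def using k(1) h(1) mass_nonneg[of M] by (intro infsum_nonneg) simp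
  define G where "G = (\<lambda>(y, z). k x z * mass M z * (h z y * mass M y))"
  have "((\<lambda>(z, y). k x z * mass M z * (h z y * mass M y)) has_sum 1) (UNIV \<times> UNIV)"
    using summable_kernel_pair[OF k h] .
  then have G: "(G has_sum 1) (UNIV \<times> UNIV)"
    unfolding G_def by (subst (asm) has_sum_swap) (simp add: case_prod_unfold)
  have S: "(\<lambda>z. G (y, z)) summable_on UNIV" for y
    using summable_on_SigmaD1[of "\<lambda>y z. G (y, z)" UNIV "\<lambda>_. UNIV"] has_sum_imp_summable[OF G]
    by (simp add: case_prod_unfold)
  have "((\<lambda>y. \<Sum>\<^sub>\<infinity>z. G (y, z)) has_sum 1) UNIV"
    using has_sum_SigmaD[OF G has_sum_infsum[OF S]] .
  moreover have "(\<Sum>\<^sub>\<infinity>z. G (y, z)) = kernel_comp M k h x y * mass M y" for y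
    unfolding kernel_comp_def G_def
    by (simp flip: infsum_cmult_right' infsum_cmult_left' add: mult_ac)
  ultimately show "((\<lambda>y. kernel_comp M k h x y * mass M y) has_sum 1) UNIV"
    by simp
qed

lemma kernel_op_iter_kernel:
  assumes k: "symmetric_markov_kernel M k" and n: "n \<ge> 1" and f: "bounded (range f)"
  shows "(kernel_op M k ^^ n) f = kernel_op M (iter_kernel M k n) f"
proof -
  note kM = k[unfolded symmetric_markov_kernel_def]
  have "(\<forall>x y. 0 \<le> (kernel_comp M k ^^ m) k x y) \<and>
        (\<forall>x. ((\<lambda>y. (kernel_comp M k ^^ m) k x y * mass M y) has_sum 1) UNIV) \<and>
        (kernel_op M k ^^ Suc m) f = kernel_op M ((kernel_comp M k ^^ m) k) f" for m
  proof (induction m)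
    case 0
    then show ?case using kM by simp
  next
    case (Suc m)
    have "(kernel_op M k ^^ Suc (Suc m)) f
        = kernel_op M k (kernel_op M ((kernel_comp M k ^^ m) k) f)"
      using Suc by simp
    also have "\<dots> = kernel_op M ((kernel_comp M k ^^ Suc m) k) f"
      using Suc kM f by (auto intro!: ext kernel_op_comp)
    finally show ?case
      using Suc kM kernel_comp_markov[of k M "(kernel_comp M k ^^ m) k"] by simp
  qed
  from this[of "n - 1"] n show ?thesis
    by (simp add: iter_kernel_def del: funpow.simps)
qed

lemma iter_kernel_unique:
  assumes k: "symmetric_markov_kernel M k" and n: "n \<ge> 1" and y: "mass M y > 0"
    and h: "\<And>f. bounded (range f) \<Longrightarrow> (kernel_op M k ^^ n) f = kernel_op M h f"
  shows "h x y = iter_kernel M k n x y"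
proof -
  let ?f = "indicator {y} :: 'a \<Rightarrow> real"
  have f: "bounded (range ?f)"
    unfolding bounded_iff by (auto simp: indicator_def intro!: exI[of _ 1])
  have *: "kernel_op M g ?f x = g x y * mass M y" for g
  proof -
    have "kernel_op M g ?f x = (\<Sum>\<^sub>\<infinity>z\<in>{y}. g x z * ?f z * mass M z)"
      unfolding kernel_op_def by (rule infsum_cong_neutral) (auto simp: indicator_def)
    then show ?thesis by simp
  qed
  have "kernel_op M h ?f x = kernel_op M (iter_kernel M k n) ?f x"
    using h[OF f] kernel_op_iter_kernel[OF k n f] by metis
  then show ?thesis using y by (simp add: *)
qed

end

theory Submission
  imports Defs
begin

text \<open>Both conditions are equivalent to the exit estimate: the walk leaves the ball \<open>B(x, r)\<close> within \<open>n\<close>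
  steps with probability at most \<open>C n r\<^sup>-\<^sup>\<beta>\<close>.

  UHKP bounds the tails of \<open>k\<^sub>n\<close> by \<open>C n r\<^sup>-\<^sup>\<beta>\<close>, and a maximal inequality turns this into the exit
  estimate.  Conversely, the lower bound on the jumps gives the on-diagonal bound by a contraction argument
  in the supremum norm, and splitting a path from \<open>x\<close> to \<open>y\<close> at its first exit from a ball around
  \<open>x\<close>, or, backwards, around \<open>y\<close>, improves a bound on \<open>k\<^sub>n(x, y)\<close> by a factor \<open>n d(x, y)\<^sup>-\<^sup>\<beta>\<close>
  as long as the term coming from one big jump does not dominate.

  Given the exit estimate, one minus the average over \<open>n < N\<close> of the probabilities of leaving an annulus
  within \<open>n\<close> steps is a function \<open>g\<close> with \<open>g - K g \<le> 1/N\<close> which is at least \<open>1/2\<close> in the middle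
  of the annulus, where \<open>N\<close> is comparable to \<open>r\<^sup>\<beta>\<close>; testing with \<open>f\<^sup>2 g\<close> shows that the cutoff
  function made from \<open>g\<close> satisfies CSJ.  Given CSJ, the same average \<open>v\<close> for the walk without
  jumps longer than \<open>\<rho>\<close> and a ball of radius \<open>r\<close> satisfies \<open>v - K v \<le> -v/N\<close> in the ball, so the
  Caccioppoli inequality and hole filling yield
  \<open>\<parallel>v\<parallel>\<^sup>2 \<le> C N \<rho>\<^sup>-\<^sup>\<beta> \<parallel>v\<parallel>\<^sup>2\<close> with the norm on the left over a ball whose radius is smaller by \<open>3\<rho>\<close>.
  Iterating with \<open>\<rho>\<close> a small multiple of \<open>r\<close> gives decay in mean square, which the on-diagonal
  bound turns into pointwise decay, by induction on the number of steps.\<close>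

text \<open>One long jump leaves the ball, so for the full walk no higher power of n r^(-\<beta>) is
  available. Truncation removes these jumps at a price of at most C n \<rho>^(-\<beta>) in the exit
  probability, and what remains decays like any power of n r^(-\<beta>). Such a power is needed: the
  passage from mean square to a point, through the on-diagonal bound at a time comparable to n,
  loses a factor (n r^(-\<beta>))^(-\<alpha>/\<beta>), where \<alpha> is the volume exponent.
  Averaging exit probabilities over time leaves only stationary inequalities to be tested; no
  parabolic estimate and no mean value inequality enters. The constant in front of the energy in CSJ
  may be large, so that energy cannot be absorbed into the left side of the Caccioppoli inequality;
  but it lives on an annulus only, which is what hole filling exploits. Splitting at the exit must
  be done from both ends because a path from x to y may well stay near x for the first half of the
  time.\<close>

lemma bounded_rangeI:
  fixes f :: "'a \<Rightarrow> real"
  assumes "\<And>x. \<bar>f x\<bar> \<le> C"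
  shows "bounded (range f)"
  using assms unfolding bounded_iff by auto

lemma bounded_rangeE:
  fixes f :: "'a \<Rightarrow> real"
  assumes "bounded (range f)"
  obtains C where "\<And>x. \<bar>f x\<bar> \<le> C"
  using assms unfolding bounded_iff by auto

lemma bounded_range_plus:
  fixes f g :: "'a \<Rightarrow> real"
  assumes "bounded (range f)" "bounded (range g)"
  shows "bounded (range (\<lambda>x. f x + g x))"
  using bounded_plus_comp[of f UNIV g] assms by simp

section \<open>Substochastic kernels acting on bounded functions\<close>

text \<open>Truncating a Markov kernel loses mass, hence the bound 1 in place of equality.
  Summability is a separate demand because \<open>infsum\<close> is 0 on a family without a sum,
  which would make the bound void.\<close>

definition substochastic :: "'a measure \<Rightarrow> ('a \<Rightarrow> 'a \<Rightarrow> real) \<Rightarrow> bool" where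
  "substochastic M q \<longleftrightarrow> (\<forall>x y. 0 \<le> q x y) \<and>
     (\<forall>x. (\<lambda>y. q x y * mass M y) summable_on UNIV \<and> (\<Sum>\<^sub>\<infinity>y. q x y * mass M y) \<le> 1)"

lemma substochasticD:
  assumes "substochastic M q"
  shows "0 \<le> q x y" "(\<lambda>y. q x y * mass M y) summable_on UNIV"
    "(\<Sum>\<^sub>\<infinity>y. q x y * mass M y) \<le> 1"
  using assms by (auto simp: substochastic_def)

lemma substochastic_mono:
  assumes "substochastic M q" "\<And>x y. 0 \<le> h x y" "\<And>x y. h x y \<le> q x y"
  shows "substochastic M h"
proof -
  have S: "(\<lambda>y. h x y * mass M y) summable_on UNIV" for x
    by (rule summable_on_comparison_test[OF substochasticD(2)[OF assms(1), of x]])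
       (use assms mass_nonneg[of M] in \<open>auto intro: mult_right_mono\<close>)
  moreover have "(\<Sum>\<^sub>\<infinity>y. h x y * mass M y) \<le> (\<Sum>\<^sub>\<infinity>y. q x y * mass M y)" for x
    by (rule infsum_mono[OF S substochasticD(2)[OF assms(1)]])
       (use assms mass_nonneg[of M] in \<open>auto intro: mult_right_mono\<close>)
  ultimately show ?thesis
    using assms(2) substochasticD(3)[OF assms(1)] order_trans
    unfolding substochastic_def by blast
qed

lemma symmetric_markov_kernelD:
  assumes "symmetric_markov_kernel M k"
  shows "0 \<le> k x y" "k x y = k y x" "((\<lambda>y. k x y * mass M y) has_sum 1) UNIV"
  using assms by (auto simp: symmetric_markov_kernel_def)

lemma symmetric_markov_kernel_substochastic:
  assumes "symmetric_markov_kernel M k"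
  shows "substochastic M k"
  using symmetric_markov_kernelD(1)[OF assms] infsumI[OF symmetric_markov_kernelD(3)[OF assms]]
    has_sum_imp_summable[OF symmetric_markov_kernelD(3)[OF assms]]
  by (simp add: substochastic_def)

context
  fixes M :: "'a measure" and q :: "'a \<Rightarrow> 'a \<Rightarrow> real"
  assumes q: "substochastic M q"
begin

lemma kernel_op_summable:
  assumes "bounded (range f)"
  shows "(\<lambda>y. q x y * f y * mass M y) summable_on UNIV"
proof -
  obtain C where C: "\<And>y. \<bar>f y\<bar> \<le> C" using assms by (rule bounded_rangeE) blast
  have "(\<lambda>y. C * (q x y * mass M y)) summable_on UNIV"
    by (intro summable_on_cmult_right substochasticD[OF q])
  then have "(\<lambda>y. norm (q x y * f y * mass M y)) summable_on UNIV"
  proof (rule Infinite_Sum.abs_summable_on_comparison_test')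
    fix y
    have "\<bar>f y\<bar> * (q x y * mass M y) \<le> C * (q x y * mass M y)"
      using C[of y] substochasticD(1)[OF q, of x y] mass_nonneg[of M y]
      by (intro mult_right_mono) auto
    then show "norm (q x y * f y * mass M y) \<le> C * (q x y * mass M y)"
      using substochasticD(1)[OF q, of x y] mass_nonneg[of M y]
      by (simp add: abs_mult mult_ac)
  qed
  then show ?thesis by (rule Infinite_Sum.abs_summable_summable)
qed

lemma kernel_op_mono:
  assumes "bounded (range f)" "bounded (range g)" "\<And>y. f y \<le> g y"
  shows "kernel_op M q f x \<le> kernel_op M q g x"
  unfolding kernel_op_def
  by (intro infsum_mono kernel_op_summable assms mult_left_mono mult_right_mono
      substochasticD(1)[OF q] mass_nonneg)

lemma kernel_op_add:
  assumes "bounded (range f)" "bounded (range g)"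
  shows "kernel_op M q (\<lambda>y. f y + g y) x = kernel_op M q f x + kernel_op M q g x"
  unfolding kernel_op_def
  using infsum_add[OF kernel_op_summable[OF assms(1)] kernel_op_summable[OF assms(2)]]
  by (simp add: algebra_simps)

lemma kernel_op_nonneg:
  assumes "\<And>y. 0 \<le> f y"
  shows "0 \<le> kernel_op M q f x"
  unfolding kernel_op_def
  by (intro infsum_nonneg mult_nonneg_nonneg assms substochasticD(1)[OF q] mass_nonneg)

end

lemma kernel_op_cmult: "kernel_op M q (\<lambda>y. c * f y) x = c * kernel_op M q f x" for c :: real
  unfolding kernel_op_def by (simp flip: infsum_cmult_right' add: mult_ac)

text \<open>Since mass may be lost, a constant upper bound survives only when it is
  nonnegative.\<close>

lemma kernel_op_le:
  assumes q: "substochastic M q" and f: "bounded (range f)" "\<And>y. f y \<le> c" and c: "0 \<le> c"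
  shows "kernel_op M q f x \<le> c"
proof -
  have "kernel_op M q f x \<le> kernel_op M q (\<lambda>y. c * 1) x"
    by (intro kernel_op_mono q f) (use f in \<open>auto\<close>)
  also have "\<dots> = c * (\<Sum>\<^sub>\<infinity>y. q x y * mass M y)"
    unfolding kernel_op_cmult by (simp add: kernel_op_def)
  also have "\<dots> \<le> c * 1"
    by (intro mult_left_mono substochasticD[OF q] c)
  finally show ?thesis by simp
qed

lemma kernel_op_bounded:
  assumes q: "substochastic M q" and f: "bounded (range f)"
  shows "bounded (range (kernel_op M q f))"
proof -
  obtain C where C: "\<And>y. \<bar>f y\<bar> \<le> C" using f by (rule bounded_rangeE) blast
  then have C0: "0 \<le> C" by (meson abs_ge_zero order_trans)
  have le: "- C \<le> f y" "f y \<le> C" for y using C[of y] by auto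
  have f': "bounded (range (\<lambda>y. -1 * f y))" using C by (intro bounded_rangeI[of _ C]) simp
  have "\<bar>kernel_op M q f x\<bar> \<le> C" for x
  proof -
    have "kernel_op M q (\<lambda>y. -1 * f y) x \<le> C"
      by (intro kernel_op_le[OF q f'] C0) (use le in \<open>simp add: minus_le_iff\<close>)
    moreover have "kernel_op M q f x \<le> C"
      by (intro kernel_op_le[OF q f] C0 le)
    ultimately show ?thesis unfolding kernel_op_cmult by simp
  qed
  then show ?thesis by (rule bounded_rangeI)
qed

lemma kernel_op_const:
  assumes "symmetric_markov_kernel M k"
  shows "kernel_op M k (\<lambda>_. c) x = c"
  using kernel_op_cmult[of M k c "\<lambda>_. 1" x] infsumI[OF symmetric_markov_kernelD(3)[OF assms, of x]]
  by (simp add: kernel_op_def)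

lemma kernel_op_finite:
  assumes "finite S" "\<And>y. y \<notin> S \<Longrightarrow> q x y * f y = 0"
  shows "kernel_op M q f x = (\<Sum>y\<in>S. q x y * f y * mass M y)"
proof -
  have "kernel_op M q f x = infsum (\<lambda>y. q x y * f y * mass M y) S"
    unfolding kernel_op_def by (rule infsum_cong_neutral) (use assms in auto)
  then show ?thesis using assms by simp
qed

lemma substochastic_sum_le:
  assumes "substochastic M q" "finite S"
  shows "(\<Sum>y\<in>S. q x y * mass M y) \<le> 1"
proof -
  have "(\<Sum>y\<in>S. q x y * mass M y) \<le> (\<Sum>\<^sub>\<infinity>y. q x y * mass M y)"
    by (rule finite_sum_le_infsum[OF substochasticD(2)[OF assms(1)] assms(2)])
       (use substochasticD(1)[OF assms(1)] mass_nonneg[of M] in auto)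
  also have "\<dots> \<le> 1" by (rule substochasticD(3)[OF assms(1)])
  finally show ?thesis .
qed

lemma sum_le_kernel_op:
  assumes "substochastic M q" "finite S" "bounded (range f)" "\<And>y. 0 \<le> f y"
  shows "(\<Sum>y\<in>S. q x y * f y * mass M y) \<le> kernel_op M q f x"
  unfolding kernel_op_def
  by (rule finite_sum_le_infsum[OF kernel_op_summable[OF assms(1,3)] assms(2)])
     (use assms substochasticD(1)[OF assms(1)] mass_nonneg[of M] in auto)

subsection \<open>Iterated kernels\<close>

context
  fixes M :: "'a measure" and k :: "'a \<Rightarrow> 'a \<Rightarrow> real"
  assumes k: "symmetric_markov_kernel M k"
begin

lemma iter_kernel_1: "iter_kernel M k (Suc 0) = k"
  by (simp add: iter_kernel_def)

lemma iter_kernel_Suc: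
  assumes "n \<ge> 1"
  shows "iter_kernel M k (Suc n) x y = kernel_op M k (\<lambda>z. iter_kernel M k n z y) x"
proof -
  obtain l where "n = Suc l" using assms by (cases n) auto
  then show ?thesis by (simp add: iter_kernel_def kernel_comp_def kernel_op_def)
qed

lemma iter_kernel_markov:
  assumes "n \<ge> 1"
  shows "0 \<le> iter_kernel M k n x y" "((\<lambda>y. iter_kernel M k n x y * mass M y) has_sum 1) UNIV"
proof -
  have "(\<forall>x y. 0 \<le> iter_kernel M k (Suc l) x y) \<and>
        (\<forall>x. ((\<lambda>y. iter_kernel M k (Suc l) x y * mass M y) has_sum 1) UNIV)" for l
  proof (induction l)
    case 0
    then show ?case using symmetric_markov_kernelD[OF k] by (simp add: iter_kernel_1)
  next
    case (Suc l)
    then show ?case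
      using kernel_comp_markov[of k M "iter_kernel M k (Suc l)"] symmetric_markov_kernelD[OF k]
      by (simp add: iter_kernel_def)
  qed
  from this[of "n - 1"] assms
  show "0 \<le> iter_kernel M k n x y" "((\<lambda>y. iter_kernel M k n x y * mass M y) has_sum 1) UNIV"
    by auto
qed

lemma iter_kernel_substochastic: "n \<ge> 1 \<Longrightarrow> substochastic M (iter_kernel M k n)"
  using iter_kernel_markov(1) infsumI[OF iter_kernel_markov(2)]
    has_sum_imp_summable[OF iter_kernel_markov(2)]
  by (simp add: substochastic_def)

lemma iter_kernel_le:
  assumes C: "\<And>x y. k x y \<le> C" and n: "n \<ge> 1"
  shows "iter_kernel M k n x y \<le> C"
proof -
  have C0: "0 \<le> C" using symmetric_markov_kernelD(1)[OF k] C order_trans by blast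
  show ?thesis using n
  proof (induction n arbitrary: x rule: dec_induct)
    case base
    then show ?case using C by (simp add: iter_kernel_1)
  next
    case (step n)
    have "bounded (range (\<lambda>z. iter_kernel M k n z y))"
      by (rule bounded_rangeI[of _ C]) (use step iter_kernel_markov(1)[OF step(1)] in auto)
    then show ?case
      unfolding iter_kernel_Suc[OF step(1)]
      by (intro kernel_op_le symmetric_markov_kernel_substochastic k C0 step)
  qed
qed

lemma iter_kernel_bounded:
  assumes C: "\<And>x y. k x y \<le> C" and n: "n \<ge> 1"
  shows "bounded (range (\<lambda>z. iter_kernel M k n z y))"
  by (rule bounded_rangeI[of _ C]) (use iter_kernel_le[OF C n] iter_kernel_markov(1)[OF n] in auto)

lemma kernel_op_pow_iter_kernel:
  assumes n: "n \<ge> 1"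
  shows "(kernel_op M k ^^ a) (\<lambda>z. iter_kernel M k n z y) = (\<lambda>x. iter_kernel M k (a + n) x y)"
proof (induction a)
  case (Suc a)
  then show ?case using n by (simp add: iter_kernel_Suc)
qed simp

lemma kernel_op_pow:
  assumes "n \<ge> 1" "bounded (range f)"
  shows "(kernel_op M k ^^ n) f x = kernel_op M (iter_kernel M k n) f x"
  using kernel_op_iter_kernel[OF k assms] by simp

text \<open>Chapman-Kolmogorov, obtained by applying a power of the operator to the bounded column z
  \<mapsto> \<open>iter_kernel M k n z y\<close>. It therefore holds at every point, whereas
  uniqueness of kernels is available only at points of positive mass.\<close>

lemma iter_kernel_add:
  assumes C: "\<And>x y. k x y \<le> C" and n: "n \<ge> 1" and a: "a \<ge> 1"
  shows "iter_kernel M k (a + n) x y = kernel_op M (iter_kernel M k a) (\<lambda>z. iter_kernel M k n z y) x"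
  using kernel_op_pow[OF a iter_kernel_bounded[OF C n]] kernel_op_pow_iter_kernel[OF n, of a y]
  by (simp add: fun_eq_iff)

text \<open>The recursion adds a step on the left and Chapman-Kolmogorov adds it on the right; the
  induction hypothesis and the symmetry of \<open>k\<close> exchange the two.\<close>

lemma iter_kernel_sym:
  assumes C: "\<And>x y. k x y \<le> C" and n: "n \<ge> 1"
  shows "iter_kernel M k n x y = iter_kernel M k n y x"
  using n
proof (induction n arbitrary: x y rule: dec_induct)
  case base
  then show ?case using symmetric_markov_kernelD(2)[OF k] by (simp add: iter_kernel_1)
next
  case (step n)
  have "iter_kernel M k (Suc n) x y = kernel_op M (iter_kernel M k n) (\<lambda>z. k z x) y"
    unfolding iter_kernel_Suc[OF step(1)] kernel_op_def
    by (rule infsum_cong) (simp add: step(3)[of _ y] symmetric_markov_kernelD(2)[OF k, of x])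
  then show ?case
    using iter_kernel_add[OF C, of 1 n y x] step(1) by (simp add: iter_kernel_1)
qed

end

subsection \<open>Exit probabilities\<close>

text \<open>The probability that the walk started at \<open>x\<close> is outside \<open>B\<close> at
  some time up to \<open>n\<close>, by conditioning on the first step. Mass missing from a
  substochastic \<open>q\<close> is a death of the walk and does not count as an exit.\<close>

primrec exit_prob :: "'a measure \<Rightarrow> ('a \<Rightarrow> 'a \<Rightarrow> real) \<Rightarrow> 'a set \<Rightarrow> nat \<Rightarrow> 'a \<Rightarrow> real" where
  "exit_prob M q B 0 = indicator (- B)"
| "exit_prob M q B (Suc n) = (\<lambda>x. if x \<in> B then kernel_op M q (exit_prob M q B n) x else 1)"

lemma exit_prob_outside [simp]: "x \<notin> B \<Longrightarrow> exit_prob M q B n x = 1"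
  by (cases n) auto

context
  fixes M :: "'a measure" and q :: "'a \<Rightarrow> 'a \<Rightarrow> real"
  assumes q: "substochastic M q"
begin

lemma exit_prob_range: "0 \<le> exit_prob M q B n x \<and> exit_prob M q B n x \<le> 1"
proof (induction n arbitrary: x)
  case (Suc n)
  have "bounded (range (exit_prob M q B n))"
    by (rule bounded_rangeI[of _ 1]) (use Suc in auto)
  then show ?case
    using Suc by (auto intro!: kernel_op_nonneg kernel_op_le q)
qed (auto simp: indicator_def)

lemma exit_prob_nonneg: "0 \<le> exit_prob M q B n x"
  and exit_prob_le_1: "exit_prob M q B n x \<le> 1"
  using exit_prob_range by auto

lemma exit_prob_bounded: "bounded (range (exit_prob M q B n))"
  by (rule bounded_rangeI[of _ 1]) (use exit_prob_range in auto)

lemma exit_prob_Suc_mono: "exit_prob M q B n x \<le> exit_prob M q B (Suc n) x"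
proof (induction n arbitrary: x)
  case 0
  then show ?case using kernel_op_nonneg[OF q, of "indicator (- B)" x] by (auto simp: indicator_def)
next
  case (Suc n)
  have "kernel_op M q (exit_prob M q B n) x \<le> kernel_op M q (exit_prob M q B (Suc n)) x"
    by (intro kernel_op_mono q exit_prob_bounded Suc)
  then show ?case by simp
qed

lemma exit_prob_mono: "l \<le> n \<Longrightarrow> exit_prob M q B l x \<le> exit_prob M q B n x"
  by (rule lift_Suc_mono_le[of "\<lambda>n. exit_prob M q B n x"]) (use exit_prob_Suc_mono in auto)

lemma exit_prob_antimono: "B' \<subseteq> B \<Longrightarrow> exit_prob M q B n x \<le> exit_prob M q B' n x"
proof (induction n arbitrary: x)
  case (Suc n)
  then have "kernel_op M q (exit_prob M q B n) x \<le> kernel_op M q (exit_prob M q B' n) x"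
    by (intro kernel_op_mono q exit_prob_bounded)
  then show ?case using exit_prob_le_1[of B "Suc n" x] Suc.prems by auto
qed (auto simp: indicator_def)

lemma kernel_op_pow_bounded: "bounded (range f) \<Longrightarrow> bounded (range ((kernel_op M q ^^ n) f))"
  by (induction n) (auto intro: kernel_op_bounded q)

lemma kernel_op_pow_nonneg: "(\<And>y. 0 \<le> f y) \<Longrightarrow> 0 \<le> (kernel_op M q ^^ n) f x" for f :: "'a \<Rightarrow> real"
  by (induction n arbitrary: x) (auto intro: kernel_op_nonneg q)

text \<open>A path that leaves \<open>B\<close> by time \<open>s + n\<close> either leaves the
  smaller set \<open>B'\<close> by time \<open>s\<close>, or sits in \<open>B'\<close> at time
  \<open>s\<close> and leaves \<open>B\<close> in the remaining \<open>n\<close> steps. Forgetting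
  in the second case where the path was before time \<open>s\<close> only enlarges the bound, and
  makes it a plain power of the operator.\<close>

lemma exit_prob_split:
  assumes "B' \<subseteq> B"
  shows "exit_prob M q B (s + n) x \<le> exit_prob M q B' s x
           + (kernel_op M q ^^ s) (\<lambda>y. indicator B' y * exit_prob M q B n y) x"
proof (induction s arbitrary: x)
  case 0
  then show ?case using exit_prob_le_1[of B n x] by (auto simp: indicator_def)
next
  case (Suc s)
  define h where "h = (\<lambda>y. indicator B' y * exit_prob M q B n y)"
  have h0: "0 \<le> h y" for y using exit_prob_nonneg[of B n y] by (simp add: h_def indicator_def)
  have hb: "bounded (range h)"
    by (rule bounded_rangeI[of _ 1]) (use exit_prob_range[of B n] in \<open>auto simp: h_def indicator_def\<close>)
  show ?case
  proof (cases "x \<in> B'")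
    case True
    then have "exit_prob M q B (Suc s + n) x = kernel_op M q (exit_prob M q B (s + n)) x"
      using assms by auto
    also have "\<dots> \<le> kernel_op M q (\<lambda>x. exit_prob M q B' s x + (kernel_op M q ^^ s) h x) x"
      using Suc by (intro kernel_op_mono q exit_prob_bounded kernel_op_pow_bounded hb bounded_range_plus)
          (auto simp: h_def)
    also have "\<dots> = exit_prob M q B' (Suc s) x + (kernel_op M q ^^ Suc s) h x"
      using True by (simp add: kernel_op_add q exit_prob_bounded kernel_op_pow_bounded hb)
    finally show ?thesis unfolding h_def .
  next
    case False
    then show ?thesis
      using exit_prob_le_1[of B "Suc s + n" x] kernel_op_pow_nonneg[of h "Suc s" x, OF h0]
      unfolding h_def by simp
  qed
qed

text \<open>Inside \<open>B\<close> one application of the operator turns the exit probability for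
  time l into the one for time l + 1, so the sum telescopes, and the term at time 0 vanishes on
  \<open>B\<close>. The average thus satisfies a stationary equation that can be tested in the
  Dirichlet form.\<close>

lemma exit_prob_average:
  assumes "n \<ge> 1" "x \<in> B"
  defines "v \<equiv> \<lambda>x. (\<Sum>l<n. exit_prob M q B l x) / real n"
  shows "v x - kernel_op M q v x = - exit_prob M q B n x / real n"
proof -
  have b: "bounded (range (\<lambda>y. \<Sum>l<j. exit_prob M q B l y))" for j
  proof (rule bounded_rangeI[of _ "real j"])
    fix y
    show "\<bar>\<Sum>l<j. exit_prob M q B l y\<bar> \<le> real j"
      using exit_prob_range[of B] sum_bounded_above[of "{..<j}" "\<lambda>l. exit_prob M q B l y" 1]
      by (simp add: sum_nonneg abs_of_nonneg)
  qed
  have "kernel_op M q (\<lambda>y. \<Sum>l<j. exit_prob M q B l y) x = (\<Sum>l<j. exit_prob M q B (Suc l) x)" for j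
  proof (induction j)
    case 0
    show ?case by (simp add: kernel_op_def)
  next
    case (Suc j)
    then show ?case using assms(2) by (simp add: kernel_op_add q b exit_prob_bounded)
  qed
  moreover have "kernel_op M q v x = kernel_op M q (\<lambda>y. \<Sum>l<n. exit_prob M q B l y) x / real n"
    using kernel_op_cmult[of M q "1 / real n" "\<lambda>y. \<Sum>l<n. exit_prob M q B l y" x] by (simp add: v_def)
  moreover have "(\<Sum>l<n. exit_prob M q B l x) - (\<Sum>l<n. exit_prob M q B (Suc l) x) = - exit_prob M q B n x"
    using sum_lessThan_telescope'[of "\<lambda>l. exit_prob M q B l x" n] assms(2)
    by (simp add: sum_subtractf[symmetric])
  ultimately show ?thesis by (simp add: v_def diff_divide_distrib[symmetric])
qed

end

subsection \<open>Balls and volume\<close>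

context vertex_weighted_graph
begin

lemma dist_le_iff: "graph_dist E x y \<le> n \<longleftrightarrow> (\<exists>l\<le>n. (x, y) \<in> E ^^ l)"
proof
  obtain l where "(x, y) \<in> E ^^ l"
    using connected_graph[of x y] by (auto simp: rtrancl_power)
  then have "(x, y) \<in> E ^^ graph_dist E x y"
    unfolding graph_dist_def by (rule LeastI)
  then show "graph_dist E x y \<le> n \<Longrightarrow> \<exists>l\<le>n. (x, y) \<in> E ^^ l" by blast
next
  assume "\<exists>l\<le>n. (x, y) \<in> E ^^ l"
  then show "graph_dist E x y \<le> n"
    unfolding graph_dist_def using Least_le[of "\<lambda>n. (x, y) \<in> E ^^ n"] order_trans by blast
qed

lemma dist_self [simp]: "graph_dist E x x = 0"
  using dist_le_iff[of x x 0] by simp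

lemma dist_eq_0_iff: "graph_dist E x y = 0 \<longleftrightarrow> x = y"
  using dist_le_iff[of x y 0] by auto

lemma dist_commute: "graph_dist E x y = graph_dist E y x"
proof -
  have "E ^^ n = converse (E ^^ n)" for n
  proof (induction n)
    case (Suc n)
    have "converse (E ^^ Suc n) = E O E ^^ n"
      using Suc sym_edges by (simp add: converse_relcomp sym_conv_converse_eq)
    then show ?case by (simp add: relpow_commute)
  qed simp
  then have "(x, y) \<in> E ^^ n \<longleftrightarrow> (y, x) \<in> E ^^ n" for n by (metis converse_iff)
  then show ?thesis unfolding graph_dist_def by simp
qed

lemma dist_triangle_nat: "graph_dist E x z \<le> graph_dist E x y + graph_dist E y z"
proof -
  obtain i where "i \<le> graph_dist E x y" "(x, y) \<in> E ^^ i"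
    using dist_le_iff[of x y "graph_dist E x y"] by auto
  moreover obtain j where "j \<le> graph_dist E y z" "(y, z) \<in> E ^^ j"
    using dist_le_iff[of y z "graph_dist E y z"] by auto
  ultimately have "i + j \<le> graph_dist E x y + graph_dist E y z" "(x, z) \<in> E ^^ (i + j)"
    by (auto simp: relpow_add)
  then show ?thesis using dist_le_iff by blast
qed

lemma dist_triangle_real:
  "real (graph_dist E x z) \<le> real (graph_dist E x y) + real (graph_dist E y z)"
  using dist_triangle_nat[of x z y] by linarith

lemma mem_ball: "y \<in> graph_ball E x r \<longleftrightarrow> real (graph_dist E x y) \<le> r"
  by (simp add: graph_ball_def)

lemma ball_mono: "r \<le> r' \<Longrightarrow> graph_ball E x r \<subseteq> graph_ball E x r'"
  by (auto simp: mem_ball)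

lemma finite_ball: "finite (graph_ball E x r)"
proof -
  have fin: "finite {y. (x, y) \<in> E ^^ n}" for n
  proof (induction n)
    case (Suc n)
    have "{y. (x, y) \<in> E ^^ Suc n} = (\<Union>z\<in>{y. (x, y) \<in> E ^^ n}. E `` {z})" by auto
    then show ?case using Suc locally_finite by simp
  qed simp
  have "graph_ball E x r \<subseteq> (\<Union>n\<le>nat \<lfloor>r\<rfloor>. {y. (x, y) \<in> E ^^ n})"
  proof
    fix y assume "y \<in> graph_ball E x r"
    then have "graph_dist E x y \<le> nat \<lfloor>r\<rfloor>" by (auto simp: mem_ball le_nat_floor)
    then show "y \<in> (\<Union>n\<le>nat \<lfloor>r\<rfloor>. {y. (x, y) \<in> E ^^ n})" by (auto simp: dist_le_iff)
  qed
  then show ?thesis by (rule finite_subset) (use fin in auto)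
qed

lemma space_eq: "space M = UNIV"
  using sets_eq sets.sets_into_space[of UNIV M] by auto

end

section \<open>The walk with explicit constants; tails of the jump kernel\<close>

locale jump_walk = vertex_weighted_graph E M
  for E :: "('a \<times> 'a) set" and M :: "'a measure" +
  fixes k :: "'a \<Rightarrow> 'a \<Rightarrow> real" and \<alpha> \<beta> C\<^sub>V C\<^sub>J :: real
  assumes \<alpha>: "0 < \<alpha>" and \<beta>: "0 < \<beta>"
    and k: "symmetric_markov_kernel M k"
    and C\<^sub>V: "0 < C\<^sub>V"
    and volume: "\<And>x r. 1 \<le> r \<Longrightarrow> ennreal (inverse C\<^sub>V * r powr \<alpha>) \<le> emeasure M (graph_ball E x r) \<and>
      emeasure M (graph_ball E x r) \<le> ennreal (C\<^sub>V * r powr \<alpha>)"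
    and C\<^sub>J: "0 < C\<^sub>J"
    and jump: "\<And>x y. inverse C\<^sub>J * (1 + real (graph_dist E x y)) powr (- (\<alpha> + \<beta>)) \<le> k x y \<and>
      k x y \<le> C\<^sub>J * (1 + real (graph_dist E x y)) powr (- (\<alpha> + \<beta>))"
begin

abbreviation dist\<^sub>E :: "'a \<Rightarrow> 'a \<Rightarrow> real" where "dist\<^sub>E x y \<equiv> real (graph_dist E x y)"
abbreviation ball\<^sub>E :: "'a \<Rightarrow> real \<Rightarrow> 'a set" where "ball\<^sub>E \<equiv> graph_ball E"
abbreviation m :: "'a \<Rightarrow> real" where "m \<equiv> mass M"
abbreviation K :: "('a \<Rightarrow> real) \<Rightarrow> 'a \<Rightarrow> real" where "K \<equiv> kernel_op M k"
abbreviation k\<^sub>n :: "nat \<Rightarrow> 'a \<Rightarrow> 'a \<Rightarrow> real" where "k\<^sub>n \<equiv> iter_kernel M k"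

lemma m_nonneg: "0 \<le> m x" by (rule mass_nonneg)

lemma k_nonneg: "0 \<le> k x y" and k_sym: "k x y = k y x"
  using symmetric_markov_kernelD[OF k] by auto

lemma k_substochastic: "substochastic M k"
  by (rule symmetric_markov_kernel_substochastic[OF k])

text \<open>\<open>measure\<close> sends infinite mass to 0, so the real number \<open>m x\<close>
  is faithful only because the volume bound makes the unit ball finite.\<close>

lemma emeasure_singleton: "emeasure M {x} = ennreal (m x)"
proof -
  have "emeasure M {x} \<le> emeasure M (ball\<^sub>E x 1)"
    by (rule emeasure_mono) (auto simp: mem_ball sets_eq)
  also have "\<dots> < \<infinity>" using volume[of 1 x] by (auto simp: less_top[symmetric] top_unique)
  finally show ?thesis by (simp add: mass_def measure_def)
qed

lemma volume_sum:
  assumes "1 \<le> r"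
  shows "inverse C\<^sub>V * r powr \<alpha> \<le> sum m (ball\<^sub>E x r)" "sum m (ball\<^sub>E x r) \<le> C\<^sub>V * r powr \<alpha>"
proof -
  have "emeasure M (ball\<^sub>E x r) = (\<Sum>y\<in>ball\<^sub>E x r. emeasure M {y})"
    by (rule emeasure_eq_sum_singleton) (auto simp: finite_ball sets_eq)
  also have "\<dots> = ennreal (sum m (ball\<^sub>E x r))"
    by (simp add: emeasure_singleton m_nonneg)
  finally show "inverse C\<^sub>V * r powr \<alpha> \<le> sum m (ball\<^sub>E x r)" "sum m (ball\<^sub>E x r) \<le> C\<^sub>V * r powr \<alpha>"
    using volume[OF assms, of x] C\<^sub>V by (auto simp: sum_nonneg m_nonneg ennreal_le_iff)
qed

lemma k_le_powr:
  assumes "0 < r" "r \<le> dist\<^sub>E x y"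
  shows "k x y \<le> C\<^sub>J * r powr (- (\<alpha> + \<beta>))"
proof -
  have "(1 + dist\<^sub>E x y) powr (- (\<alpha> + \<beta>)) \<le> r powr (- (\<alpha> + \<beta>))"
    using assms \<alpha> \<beta> by (intro powr_mono2') auto
  then have "C\<^sub>J * (1 + dist\<^sub>E x y) powr (- (\<alpha> + \<beta>)) \<le> C\<^sub>J * r powr (- (\<alpha> + \<beta>))"
    using C\<^sub>J by simp
  then show ?thesis using jump[of x y] by linarith
qed

lemma k_le: "k x y \<le> C\<^sub>J"
proof -
  have "(1 + dist\<^sub>E x y) powr (- (\<alpha> + \<beta>)) \<le> 1 powr (- (\<alpha> + \<beta>))"
    using \<alpha> \<beta> by (intro powr_mono2') auto
  then have "C\<^sub>J * (1 + dist\<^sub>E x y) powr (- (\<alpha> + \<beta>)) \<le> C\<^sub>J"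
    using C\<^sub>J by simp
  then show ?thesis using jump[of x y] by linarith
qed

text \<open>Dyadic shells: between radii R and 2R, with R = 2^j r, the kernel is at most C
  R^(-\<alpha>-\<beta>) and the volume at most C (2R)^\<alpha>, so each shell contributes a multiple
  of R^(-\<beta>), a geometric sequence in j.\<close>

lemma shell_sum_le:
  assumes r: "1 \<le> r"
  shows "(\<Sum>y\<in>ball\<^sub>E x (2 ^ N * r). k x y * indicator (- ball\<^sub>E x r) y * m y)
    \<le> C\<^sub>J * C\<^sub>V * 2 powr \<alpha> * r powr (- \<beta>) * (\<Sum>j<N. (2 powr (- \<beta>)) ^ j)"
proof (induction N)
  case 0
  have "(\<Sum>y\<in>ball\<^sub>E x r. k x y * indicator (- ball\<^sub>E x r) y * m y) = 0"
    by (intro sum.neutral) auto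
  then show ?case by simp
next
  case (Suc N)
  define f where "f = (\<lambda>y. k x y * indicator (- ball\<^sub>E x r) y * m y)"
  define R where "R = 2 ^ N * r"
  have R: "1 \<le> R" using mult_mono[of 1 "2 ^ N" 1 r] r by (simp add: R_def)
  have eq: "ball\<^sub>E x (2 * R) = ball\<^sub>E x R \<union> (ball\<^sub>E x (2 * R) - ball\<^sub>E x R)"
    using ball_mono[of R "2 * R" x] R by auto
  have "sum f (ball\<^sub>E x (2 * R) - ball\<^sub>E x R) \<le> (\<Sum>y\<in>ball\<^sub>E x (2 * R) - ball\<^sub>E x R. C\<^sub>J * R powr (- (\<alpha> + \<beta>)) * m y)"
  proof (rule sum_mono)
    fix y assume y: "y \<in> ball\<^sub>E x (2 * R) - ball\<^sub>E x R"
    then have "k x y \<le> C\<^sub>J * R powr (- (\<alpha> + \<beta>))" using R by (intro k_le_powr) (auto simp: mem_ball)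
    then have "k x y * m y \<le> C\<^sub>J * R powr (- (\<alpha> + \<beta>)) * m y" using m_nonneg by (rule mult_right_mono)
    moreover have "f y \<le> k x y * m y"
      using k_nonneg[of x y] m_nonneg[of y] by (simp add: f_def indicator_def)
    ultimately show "f y \<le> C\<^sub>J * R powr (- (\<alpha> + \<beta>)) * m y" by linarith
  qed
  also have "\<dots> \<le> C\<^sub>J * R powr (- (\<alpha> + \<beta>)) * sum m (ball\<^sub>E x (2 * R))"
    unfolding sum_distrib_left[symmetric]
    using C\<^sub>J by (intro mult_left_mono sum_mono2) (auto simp: finite_ball m_nonneg)
  also have "\<dots> \<le> C\<^sub>J * R powr (- (\<alpha> + \<beta>)) * (C\<^sub>V * (2 * R) powr \<alpha>)"
    using C\<^sub>J R by (intro mult_left_mono volume_sum) auto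
  also have "\<dots> = C\<^sub>J * C\<^sub>V * 2 powr \<alpha> * R powr (- \<beta>)"
    using R by (simp add: powr_mult powr_add[symmetric])
  also have "R powr (- \<beta>) = r powr (- \<beta>) * (2 powr (- \<beta>)) ^ N"
    using r by (simp add: R_def powr_mult powr_realpow[symmetric] powr_powr mult.commute)
  finally have "sum f (ball\<^sub>E x (2 * R) - ball\<^sub>E x R)
      \<le> C\<^sub>J * C\<^sub>V * 2 powr \<alpha> * r powr (- \<beta>) * (2 powr (- \<beta>)) ^ N" by (simp add: mult_ac)
  moreover have "sum f (ball\<^sub>E x (2 * R)) = sum f (ball\<^sub>E x R) + sum f (ball\<^sub>E x (2 * R) - ball\<^sub>E x R)"
    by (subst eq, subst sum.union_disjoint) (auto simp: finite_ball)
  moreover have "sum f (ball\<^sub>E x R)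
      \<le> C\<^sub>J * C\<^sub>V * 2 powr \<alpha> * r powr (- \<beta>) * (\<Sum>j<N. (2 powr (- \<beta>)) ^ j)"
    using Suc by (simp add: f_def R_def)
  moreover have "(\<Sum>y\<in>ball\<^sub>E x (2 ^ Suc N * r). k x y * indicator (- ball\<^sub>E x r) y * m y)
      = sum f (ball\<^sub>E x (2 * R))"
    by (simp add: f_def R_def mult.assoc)
  ultimately show ?case by (simp only: sum.lessThan_Suc distrib_left)
qed

text \<open>Every finite set lies in some dyadic ball, and the geometric series bounds all of these
  sums at once. For r < 1 the total mass 1 is already below r^(-\<beta>), which is why
  \<open>C\<close> is taken to be at least 1.\<close>

lemma tail_bound:
  obtains C where "C \<ge> 1" "\<And>x r. 0 < r \<Longrightarrow> K (indicator (- ball\<^sub>E x r)) x \<le> C * r powr (- \<beta>)"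
proof -
  define q where "q = 2 powr (- \<beta>)"
  have q: "0 < q" "q < 1" using \<beta> powr_less_one[of 2 "- \<beta>"] by (auto simp: q_def)
  define A where "A = C\<^sub>J * C\<^sub>V * 2 powr \<alpha> / (1 - q)"
  have bi: "bounded (range (indicator S :: 'a \<Rightarrow> real))" for S :: "'a set"
    by (rule bounded_rangeI[of _ 1]) (simp add: indicator_def)
  have large: "K (indicator (- ball\<^sub>E x r)) x \<le> A * r powr (- \<beta>)" if r: "1 \<le> r" for x r
    unfolding kernel_op_def
  proof (rule infsum_le_finite_sums)
    show "(\<lambda>y. k x y * indicator (- ball\<^sub>E x r) y * m y) summable_on UNIV"
      by (rule kernel_op_summable[OF k_substochastic bi])
    fix F :: "'a set" assume F: "finite F"
    obtain N where N: "real (Max (insert 0 (graph_dist E x ` F))) < 2 ^ N"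
      using of_nat_less_two_power by blast
    have "F \<subseteq> ball\<^sub>E x (2 ^ N * r)"
    proof
      fix y assume "y \<in> F"
      then have "dist\<^sub>E x y \<le> 2 ^ N" using N F
        by (intro order_trans[OF _ less_imp_le[OF N]] of_nat_mono Max_ge) auto
      also have "\<dots> \<le> 2 ^ N * r" using r by simp
      finally show "y \<in> ball\<^sub>E x (2 ^ N * r)" by (simp add: mem_ball)
    qed
    then have "(\<Sum>y\<in>F. k x y * indicator (- ball\<^sub>E x r) y * m y)
        \<le> (\<Sum>y\<in>ball\<^sub>E x (2 ^ N * r). k x y * indicator (- ball\<^sub>E x r) y * m y)"
      by (intro sum_mono2 finite_ball) (auto simp: k_nonneg m_nonneg)
    also have "\<dots> \<le> C\<^sub>J * C\<^sub>V * 2 powr \<alpha> * r powr (- \<beta>) * (\<Sum>j<N. q ^ j)"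
      using shell_sum_le[OF r] by (simp add: q_def)
    also have "\<dots> \<le> C\<^sub>J * C\<^sub>V * 2 powr \<alpha> * r powr (- \<beta>) * (1 / (1 - q))"
    proof (rule mult_left_mono)
      have "(\<Sum>j<N. q ^ j) = (1 - q ^ N) / (1 - q)" using q by (simp add: sum_gp_strict)
      also have "\<dots> \<le> 1 / (1 - q)" using q by (intro divide_right_mono) auto
      finally show "(\<Sum>j<N. q ^ j) \<le> 1 / (1 - q)" .
    qed (use C\<^sub>J C\<^sub>V in auto)
    finally show "(\<Sum>y\<in>F. k x y * indicator (- ball\<^sub>E x r) y * m y) \<le> A * r powr (- \<beta>)"
      by (simp add: A_def)
  qed
  show ?thesis
  proof (rule that[of "max 1 A"])
    fix x and r :: real assume r: "0 < r"
    show "K (indicator (- ball\<^sub>E x r)) x \<le> max 1 A * r powr (- \<beta>)"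
    proof (cases "1 \<le> r")
      case True
      then show ?thesis
        by (intro order_trans[OF large[OF True]] mult_right_mono) auto
    next
      case False
      have "K (indicator (- ball\<^sub>E x r)) x \<le> 1"
        by (intro kernel_op_le k_substochastic bi) (auto simp: indicator_def)
      also have "1 \<le> r powr (- \<beta>)" using False r \<beta> powr_mono2'[of "- \<beta>" r 1] by simp
      also have "\<dots> \<le> max 1 A * r powr (- \<beta>)"
        using mult_right_mono[of 1 "max 1 A" "r powr (- \<beta>)"] by simp
      finally show ?thesis .
    qed
  qed simp
qed

subsection \<open>The on-diagonal bound\<close>

text \<open>A function of total mass at most 1 cannot be close to its bound \<open>A\<close> on a
  whole ball of volume much larger than 1/A. The operator sees the deficit \<open>A - f\<close> on
  that ball with weight at least the lower jump bound, where 1 + d \<le> 2r accounts for the power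
  of 2.\<close>

lemma kernel_op_contraction:
  assumes r: "1 \<le> r" and A: "\<And>y. f y \<le> A" and f: "\<And>y. 0 \<le> f y"
    and mass1: "\<And>S. finite S \<Longrightarrow> (\<Sum>y\<in>S. f y * m y) \<le> 1"
  shows "K f x \<le> A + inverse C\<^sub>J * 2 powr (- (\<alpha> + \<beta>)) * (r powr (- (\<alpha> + \<beta>)) - A * inverse C\<^sub>V * r powr (- \<beta>))"
proof -
  define w where "w = inverse C\<^sub>J * (2 * r) powr (- (\<alpha> + \<beta>))"
  have A0: "0 \<le> A" using f[of x] A[of x] by linarith
  have fb: "bounded (range f)" by (rule bounded_rangeI[of _ A]) (use A f in auto)
  have gb: "bounded (range (\<lambda>y. A + -1 * f y))"
    by (rule bounded_rangeI[of _ A]) (use A f in \<open>auto simp: abs_le_iff\<close>)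
  have w0: "0 \<le> w" using C\<^sub>J by (simp add: w_def)
  have "w * (\<Sum>y\<in>ball\<^sub>E x r. (A + -1 * f y) * m y) = (\<Sum>y\<in>ball\<^sub>E x r. w * ((A + -1 * f y) * m y))"
    by (rule sum_distrib_left)
  also have "\<dots> \<le> (\<Sum>y\<in>ball\<^sub>E x r. k x y * (A + -1 * f y) * m y)"
  proof (rule sum_mono)
    fix y assume "y \<in> ball\<^sub>E x r"
    then have "(2 * r) powr (- (\<alpha> + \<beta>)) \<le> (1 + dist\<^sub>E x y) powr (- (\<alpha> + \<beta>))"
      using r \<alpha> \<beta> by (intro powr_mono2') (auto simp: mem_ball)
    then have "w \<le> inverse C\<^sub>J * (1 + dist\<^sub>E x y) powr (- (\<alpha> + \<beta>))"
      using C\<^sub>J by (simp add: w_def)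
    then have "w \<le> k x y" using jump[of x y] by linarith
    then show "w * ((A + -1 * f y) * m y) \<le> k x y * (A + -1 * f y) * m y"
      using A[of y] m_nonneg[of y] by (simp add: mult.assoc mult_right_mono)
  qed
  also have "\<dots> \<le> K (\<lambda>y. A + -1 * f y) x"
    by (rule sum_le_kernel_op[OF k_substochastic finite_ball gb]) (use A in simp)
  also have "\<dots> = A - K f x"
    using kernel_op_add[OF k_substochastic, of "\<lambda>_. A" "\<lambda>y. -1 * f y" x]
      kernel_op_cmult[of M k "-1" f x] fb bounded_rangeI[of "\<lambda>y. -1 * f y" A] A f
    by (simp add: kernel_op_const[OF k])
  finally have 1: "K f x \<le> A - w * (\<Sum>y\<in>ball\<^sub>E x r. (A + -1 * f y) * m y)" by simp
  have "(\<Sum>y\<in>ball\<^sub>E x r. (A + -1 * f y) * m y)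
      = A * sum m (ball\<^sub>E x r) - (\<Sum>y\<in>ball\<^sub>E x r. f y * m y)"
    by (simp add: algebra_simps sum_subtractf sum_distrib_left)
  moreover have "A * (inverse C\<^sub>V * r powr \<alpha>) \<le> A * sum m (ball\<^sub>E x r)"
    by (intro mult_left_mono volume_sum r A0)
  ultimately have "A * (inverse C\<^sub>V * r powr \<alpha>) - 1 \<le> (\<Sum>y\<in>ball\<^sub>E x r. (A + -1 * f y) * m y)"
    using mass1[OF finite_ball, of x r] by linarith
  then have "w * (A * (inverse C\<^sub>V * r powr \<alpha>) - 1) \<le> w * (\<Sum>y\<in>ball\<^sub>E x r. (A + -1 * f y) * m y)"
    using w0 by (rule mult_left_mono)
  with 1 have "K f x \<le> A + w * (1 - A * (inverse C\<^sub>V * r powr \<alpha>))"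
    by (simp add: algebra_simps)
  also have "w * (1 - A * (inverse C\<^sub>V * r powr \<alpha>))
      = inverse C\<^sub>J * 2 powr (- (\<alpha> + \<beta>)) * (r powr (- (\<alpha> + \<beta>)) - A * inverse C\<^sub>V * (r powr (- (\<alpha> + \<beta>)) * r powr \<alpha>))"
    using r by (simp add: w_def powr_mult algebra_simps)
  also have "r powr (- (\<alpha> + \<beta>)) * r powr \<alpha> = r powr (- \<beta>)"
    by (simp add: powr_add[symmetric])
  finally show ?thesis .
qed

text \<open>From exp u \<ge> 1 + u and ln (1 + t) \<le> t with t = 1/n. A relative decrease by e/n
  per step is therefore enough to follow the decay of n^(-e).\<close>

lemma powr_Suc_ge:
  fixes e :: real
  assumes "0 < e" "n \<ge> 1"
  shows "real n powr (- e) * (1 - e / real n) \<le> real (Suc n) powr (- e)"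
proof -
  define t where "t = 1 / real n"
  have t: "0 < t" using assms by (simp add: t_def)
  have "1 - e * t \<le> 1 + (- e * ln (1 + t))"
    using ln_add_one_self_le_self[of t] t assms by (simp add: mult_left_mono)
  also have "\<dots> \<le> (1 + t) powr (- e)"
    using t exp_ge_add_one_self[of "- e * ln (1 + t)"] by (simp add: powr_def)
  finally have "real n powr (- e) * (1 - e * t) \<le> real n powr (- e) * (1 + t) powr (- e)"
    by (intro mult_left_mono) auto
  also have "\<dots> = (real n * (1 + t)) powr (- e)"
    using t by (simp add: powr_mult)
  also have "real n * (1 + t) = real (Suc n)"
    using assms by (simp add: t_def field_simps)
  finally show ?thesis by (simp add: t_def)
qed

text \<open>Induction on n with the contraction at the radius given by r^(-\<beta>) = \<kappa>/n,
  whose gain is a relative decrease by c\<kappa>/n. Since c\<kappa> \<ge> 2e, one half of it pays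
  for the decay of n^(-e) in one step, and the other half absorbs the error term once A e \<ge>
  \<open>c\<^sub>1\<close> \<kappa>^(1+e).\<close>

lemma on_diagonal_bound:
  obtains C where "C > 0" "\<And>n x y. n \<ge> 1 \<Longrightarrow> k\<^sub>n n x y \<le> C * real n powr (- (\<alpha> / \<beta>))"
proof -
  define e where "e = \<alpha> / \<beta>"
  define c\<^sub>1 where "c\<^sub>1 = inverse C\<^sub>J * 2 powr (- (\<alpha> + \<beta>))"
  define c where "c = c\<^sub>1 * inverse C\<^sub>V"
  define \<kappa> where "\<kappa> = max 1 (2 * e / c)"
  define A where "A = max (C\<^sub>J * (2 * \<kappa>) powr e) (c\<^sub>1 * \<kappa> powr (1 + e) / e)"
  have e: "0 < e" using \<alpha> \<beta> by (simp add: e_def)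
  have c1: "0 < c\<^sub>1" using C\<^sub>J by (simp add: c\<^sub>1_def)
  have c: "0 < c" using c1 C\<^sub>V by (simp add: c_def)
  have \<kappa>: "1 \<le> \<kappa>" "2 * e \<le> c * \<kappa>"
  proof -
    show "1 \<le> \<kappa>" by (simp add: \<kappa>_def)
    have "2 * e = c * (2 * e / c)" using c by simp
    also have "\<dots> \<le> c * \<kappa>" using c by (intro mult_left_mono) (auto simp: \<kappa>_def)
    finally show "2 * e \<le> c * \<kappa>" .
  qed
  have A0: "0 < A" using C\<^sub>J \<kappa> by (simp add: A_def less_max_iff_disj)
  \<comment> \<open>The range extends to 2\<kappa> because the step from n \<le> \<kappa> lands at n
    + 1 \<le> 2\<kappa>.\<close>
  have small: "k\<^sub>n n x y \<le> A * real n powr (- e)" if n: "n \<ge> 1" "real n \<le> 2 * \<kappa>" for n x y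
  proof -
    have "C\<^sub>J * (2 * \<kappa>) powr e \<le> A" by (simp add: A_def)
    then have "C\<^sub>J * (2 * \<kappa>) powr e * (2 * \<kappa>) powr (- e) \<le> A * (2 * \<kappa>) powr (- e)"
      by (rule mult_right_mono) simp
    then have "C\<^sub>J \<le> A * (2 * \<kappa>) powr (- e)" using \<kappa> by (simp add: mult.assoc powr_add[symmetric])
    also have "\<dots> \<le> A * real n powr (- e)"
      using n e A0 by (intro mult_left_mono powr_mono2') auto
    finally show ?thesis using iter_kernel_le[OF k k_le n(1), of x y] by linarith
  qed
  have "k\<^sub>n n x y \<le> A * real n powr (- e)" if "n \<ge> 1" for n x y
    using that
  proof (induction n arbitrary: x rule: dec_induct)
    case base
    then show ?case using small[of 1] \<kappa> by simp
  next
    case (step n)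
    have n0: "0 < real n" using step by simp
    show ?case
    proof (cases "real n \<le> \<kappa>")
      case True
      then show ?thesis using small[of "Suc n"] \<kappa>(1) by simp
    next
      case False
      define r where "r = (real n / \<kappa>) powr (1 / \<beta>)"
      have r: "1 \<le> r" unfolding r_def using False \<kappa> \<beta> by (intro ge_one_powr_ge_zero) auto
      have r1: "r powr (- \<beta>) = \<kappa> / real n"
        using \<beta> \<kappa> n0 by (simp add: r_def powr_powr powr_minus)
      have exp_eq: "1 / \<beta> * - (\<alpha> + \<beta>) = - (1 + e)"
        using \<beta> by (simp add: e_def divide_simps)
      have "r powr (- (\<alpha> + \<beta>)) = (real n / \<kappa>) powr (- (1 + e))"
        unfolding r_def powr_powr exp_eq ..
      also have "\<dots> = \<kappa> powr (1 + e) * real n powr (- e) / real n"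
      proof -
        have "real n powr (- (1 + e)) = real n powr (- e) / real n"
        proof -
          have "- (1 + e) = - e - 1" by simp
          then show ?thesis using n0 by (simp only: powr_diff) simp
        qed
        then show ?thesis
          by (simp only: powr_divide powr_minus_divide[of \<kappa> "1 + e"]) simp
      qed
      finally have r2: "r powr (- (\<alpha> + \<beta>)) = \<kappa> powr (1 + e) * real n powr (- e) / real n" .
      have "k\<^sub>n (Suc n) x y \<le> A * real n powr (- e)
          + c\<^sub>1 * (r powr (- (\<alpha> + \<beta>)) - (A * real n powr (- e)) * inverse C\<^sub>V * r powr (- \<beta>))"
        unfolding iter_kernel_Suc[OF k step(1)] c\<^sub>1_def
      proof (rule kernel_op_contraction[OF r])
        show "k\<^sub>n n z y \<le> A * real n powr (- e)" for z by (rule step.IH)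
        show "0 \<le> k\<^sub>n n z y" for z by (rule iter_kernel_markov(1)[OF k step(1)])
        fix S :: "'a set" assume "finite S"
        then show "(\<Sum>z\<in>S. k\<^sub>n n z y * m z) \<le> 1"
          using substochastic_sum_le[OF iter_kernel_substochastic[OF k step(1)], of S y]
          by (simp add: iter_kernel_sym[OF k k_le step(1), of y])
      qed
      also have "\<dots> = real n powr (- e) * (A + (c\<^sub>1 * \<kappa> powr (1 + e) - A * (c * \<kappa>)) / real n)"
        unfolding r1 r2 c_def using n0 by (simp add: field_simps)
      also have "\<dots> \<le> real n powr (- e) * (A + (A * e - A * (2 * e)) / real n)"
      proof -
        have "c\<^sub>1 * \<kappa> powr (1 + e) / e \<le> A" by (simp add: A_def)
        then have "c\<^sub>1 * \<kappa> powr (1 + e) \<le> A * e" using e by (simp add: field_simps)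
        moreover have "A * (2 * e) \<le> A * (c * \<kappa>)" using \<kappa> A0 by (intro mult_left_mono) auto
        ultimately have "(c\<^sub>1 * \<kappa> powr (1 + e) - A * (c * \<kappa>)) / real n \<le> (A * e - A * (2 * e)) / real n"
          by (intro divide_right_mono) auto
        then show ?thesis by (intro mult_left_mono add_left_mono) auto
      qed
      also have "\<dots> = A * (real n powr (- e) * (1 - e / real n))"
        by (simp add: algebra_simps diff_divide_distrib)
      also have "\<dots> \<le> A * real (Suc n) powr (- e)"
        using powr_Suc_ge[OF e step(1)] A0 by (intro mult_left_mono) auto
      finally show ?thesis .
    qed
  qed
  then show ?thesis using that[of A] A0 by (simp add: e_def)
qed

end

lemma bounded_range_indicator: "bounded (range (indicator S :: 'a \<Rightarrow> real))"
  by (rule bounded_rangeI[of _ 1]) (simp add: indicator_def)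

lemma bounded_range_cmult: "bounded (range f) \<Longrightarrow> bounded (range (\<lambda>x. c * f x))"
  for f :: "'a \<Rightarrow> real"
proof -
  assume "bounded (range f)"
  then obtain C where "\<And>x. \<bar>f x\<bar> \<le> C" by (rule bounded_rangeE) blast
  then show ?thesis
    by (intro bounded_rangeI[of _ "\<bar>c\<bar> * C"]) (simp add: abs_mult mult_left_mono)
qed

lemma bounded_range_indicator_mult: "bounded (range f) \<Longrightarrow> bounded (range (\<lambda>x. indicator S x * f x))"
  for f :: "'a \<Rightarrow> real"
proof -
  assume "bounded (range f)"
  then obtain C where "\<And>x. \<bar>f x\<bar> \<le> C" by (rule bounded_rangeE) blast
  then have "\<bar>indicator S x * f x\<bar> \<le> C" for x
    by (cases "x \<in> S") (auto intro: order_trans[OF abs_ge_zero])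
  then show ?thesis by (rule bounded_rangeI)
qed

context jump_walk
begin

text \<open>The walk starts at the centre of the ball; \<open>exit_prob_antimono\<close> carries the
  bound over to any set that contains a ball around the starting point.\<close>

definition exit_bounded :: "real \<Rightarrow> bool" where
  "exit_bounded C \<longleftrightarrow> 0 < C \<and>
     (\<forall>x r n. 0 < r \<longrightarrow> exit_prob M k (ball\<^sub>E x r) n x \<le> C * real n * r powr (- \<beta>))"

subsection \<open>Heat kernel bounds imply exit estimates\<close>

text \<open>Ottaviani's maximal inequality. From a point outside the double ball the walk ends
  within distance r of that point, hence outside \<open>ball\<^sub>E x r\<close>, with probability
  at least 1/2, whatever the remaining time. Induction on the remaining time, with the starting
  point arbitrary, replaces the decomposition at the exit time.\<close>

lemma half_exit_prob_le:
  assumes tail: "\<And>j z. 1 \<le> j \<Longrightarrow> j \<le> n \<Longrightarrow> kernel_op M (k\<^sub>n j) (indicator (- ball\<^sub>E z r)) z \<le> 1 / 2"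
    and r: "0 < r" and j: "j \<le> n"
  shows "1 / 2 * exit_prob M k (ball\<^sub>E x (2 * r)) j z \<le> (K ^^ j) (indicator (- ball\<^sub>E x r)) z"
  using j
proof (induction j arbitrary: z)
  case 0
  show ?case using ball_mono[of r "2 * r" x] r by (auto simp: indicator_def)
next
  case (Suc j)
  show ?case
  proof (cases "z \<in> ball\<^sub>E x (2 * r)")
    case True
    have "1 / 2 * K (exit_prob M k (ball\<^sub>E x (2 * r)) j) z
        = K (\<lambda>z. 1 / 2 * exit_prob M k (ball\<^sub>E x (2 * r)) j z) z"
      by (rule kernel_op_cmult[symmetric])
    also have "\<dots> \<le> K ((K ^^ j) (indicator (- ball\<^sub>E x r))) z"
      using Suc by (intro kernel_op_mono k_substochastic bounded_range_cmult exit_prob_bounded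
          kernel_op_pow_bounded bounded_range_indicator) auto
    finally show ?thesis using True by simp
  next
    case False
    let ?q = "k\<^sub>n (Suc j)"
    have q: "substochastic M ?q" by (rule iter_kernel_substochastic[OF k]) simp
    have one: "kernel_op M ?q (\<lambda>_. 1) z = 1"
      using infsumI[OF iter_kernel_markov(2)[OF k, of "Suc j" z]] by (simp add: kernel_op_def)
    have "1 / 2 \<le> kernel_op M ?q (\<lambda>_. 1) z - kernel_op M ?q (indicator (- ball\<^sub>E z r)) z"
      using tail[of "Suc j" z] Suc.prems one by simp
    also have "kernel_op M ?q (\<lambda>_. 1) z - kernel_op M ?q (indicator (- ball\<^sub>E z r)) z
        = kernel_op M ?q (\<lambda>y. 1 + -1 * indicator (- ball\<^sub>E z r) y) z"
      using kernel_op_add[OF q, of "\<lambda>_. 1" "\<lambda>y. -1 * indicator (- ball\<^sub>E z r) y" z]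
        kernel_op_cmult[of M ?q "-1" "indicator (- ball\<^sub>E z r)" z]
        bounded_range_cmult[OF bounded_range_indicator[of "- ball\<^sub>E z r"], of "-1"]
      by simp
    also have "\<dots> \<le> kernel_op M ?q (indicator (- ball\<^sub>E x r)) z"
    proof (intro kernel_op_mono q bounded_range_indicator)
      show "bounded (range (\<lambda>y. 1 + -1 * indicator (- ball\<^sub>E z r) y :: real))"
        by (rule bounded_rangeI[of _ 1]) (simp add: indicator_def)
      fix y
      have "y \<notin> ball\<^sub>E z r" if "y \<in> ball\<^sub>E x r"
        using that False dist_triangle_real[of x z y] dist_commute[of y z] by (auto simp: mem_ball)
      then show "1 + -1 * indicator (- ball\<^sub>E z r) y \<le> (indicator (- ball\<^sub>E x r) y :: real)"
        by (auto simp: indicator_def)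
    qed
    also have "\<dots> = (K ^^ Suc j) (indicator (- ball\<^sub>E x r)) z"
      by (rule kernel_op_pow[OF k, symmetric]) (auto simp: bounded_range_indicator)
    finally show ?thesis using False by (simp del: funpow.simps)
  qed
qed

lemma UHKP_imp_exit_bounded:
  assumes "UHKP E M \<alpha> \<beta> k"
  obtains C where "exit_bounded C"
proof -
  obtain C\<^sub>0 where C0: "C\<^sub>0 > 0" and uhk: "\<And>n x y. n \<ge> 1 \<Longrightarrow> k\<^sub>n n x y \<le>
      C\<^sub>0 * (if x = y then 1 / real n powr (\<alpha> / \<beta>)
             else min (1 / real n powr (\<alpha> / \<beta>)) (real n / dist\<^sub>E x y powr (\<alpha> + \<beta>)))"
    using assms unfolding UHKP_def by blast
  define A where "A = C\<^sub>0 * C\<^sub>J * 2 powr (\<alpha> + \<beta>)"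
  have A: "0 < A" using C0 C\<^sub>J by (simp add: A_def)
  obtain C\<^sub>T where CT: "C\<^sub>T \<ge> 1" and tail: "\<And>x r. 0 < r \<Longrightarrow> K (indicator (- ball\<^sub>E x r)) x \<le> C\<^sub>T * r powr (- \<beta>)"
    using tail_bound by blast
  \<comment> \<open>The lower jump bound turns the second entry of the minimum into a multiple of n
    k(x, y), so the tail estimate for \<open>k\<close> also serves \<open>k\<^sub>n\<close>. The
    power of 2 in \<open>A\<close> comes from 1 + d \<le> 2d off the diagonal.\<close>
  have off: "k\<^sub>n n x y \<le> A * real n * k x y" if n: "n \<ge> 1" and "x \<noteq> y" for n x y
  proof -
    have d: "1 \<le> dist\<^sub>E x y" using \<open>x \<noteq> y\<close> dist_eq_0_iff[of x y] by simp
    have "C\<^sub>J * 2 powr (\<alpha> + \<beta>) * (inverse C\<^sub>J * (2 * dist\<^sub>E x y) powr (- (\<alpha> + \<beta>)))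
        \<le> C\<^sub>J * 2 powr (\<alpha> + \<beta>) * k x y"
    proof (rule mult_left_mono)
      have "(2 * dist\<^sub>E x y) powr (- (\<alpha> + \<beta>)) \<le> (1 + dist\<^sub>E x y) powr (- (\<alpha> + \<beta>))"
        using d \<alpha> \<beta> by (intro powr_mono2') auto
      then have "inverse C\<^sub>J * (2 * dist\<^sub>E x y) powr (- (\<alpha> + \<beta>))
          \<le> inverse C\<^sub>J * (1 + dist\<^sub>E x y) powr (- (\<alpha> + \<beta>))" using C\<^sub>J by simp
      then show "inverse C\<^sub>J * (2 * dist\<^sub>E x y) powr (- (\<alpha> + \<beta>)) \<le> k x y"
        using jump[of x y] by linarith
    qed (use C\<^sub>J in auto)
    also have "C\<^sub>J * 2 powr (\<alpha> + \<beta>) * (inverse C\<^sub>J * (2 * dist\<^sub>E x y) powr (- (\<alpha> + \<beta>)))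
        = (C\<^sub>J * inverse C\<^sub>J) * (2 powr (\<alpha> + \<beta>) * 2 powr (- (\<alpha> + \<beta>))) * dist\<^sub>E x y powr (- (\<alpha> + \<beta>))"
      by (simp add: powr_mult mult_ac)
    also have "\<dots> = dist\<^sub>E x y powr (- (\<alpha> + \<beta>))"
      unfolding powr_add[symmetric] using C\<^sub>J by simp
    also have "\<dots> = 1 / dist\<^sub>E x y powr (\<alpha> + \<beta>)" by (rule powr_minus_divide)
    finally have "(C\<^sub>0 * real n) * (1 / dist\<^sub>E x y powr (\<alpha> + \<beta>)) \<le> (C\<^sub>0 * real n) * (C\<^sub>J * 2 powr (\<alpha> + \<beta>) * k x y)"
      using C0 by (intro mult_left_mono) auto
    moreover have "k\<^sub>n n x y \<le> C\<^sub>0 * (real n / dist\<^sub>E x y powr (\<alpha> + \<beta>))"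
    proof -
      have "k\<^sub>n n x y \<le> C\<^sub>0 * min (1 / real n powr (\<alpha> / \<beta>)) (real n / dist\<^sub>E x y powr (\<alpha> + \<beta>))"
        using uhk[OF n, of x y] \<open>x \<noteq> y\<close> by simp
      also have "\<dots> \<le> C\<^sub>0 * (real n / dist\<^sub>E x y powr (\<alpha> + \<beta>))"
        using C0 by (intro mult_left_mono) auto
      finally show ?thesis .
    qed
    ultimately show ?thesis by (simp add: A_def mult_ac)
  qed
  have tail_n: "kernel_op M (k\<^sub>n n) (indicator (- ball\<^sub>E x r)) x \<le> A * C\<^sub>T * real n * r powr (- \<beta>)"
    if n: "n \<ge> 1" and r: "0 < r" for n x r
  proof -
    have "kernel_op M (k\<^sub>n n) (indicator (- ball\<^sub>E x r)) x \<le> K (\<lambda>y. A * real n * indicator (- ball\<^sub>E x r) y) x"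
      unfolding kernel_op_def
    proof (rule infsum_mono)
      show "(\<lambda>y. k\<^sub>n n x y * indicator (- ball\<^sub>E x r) y * m y) summable_on UNIV"
        by (intro kernel_op_summable iter_kernel_substochastic[OF k n] bounded_range_indicator)
      show "(\<lambda>y. k x y * (A * real n * indicator (- ball\<^sub>E x r) y) * m y) summable_on UNIV"
        by (intro kernel_op_summable k_substochastic bounded_range_cmult bounded_range_indicator)
      fix y
      show "k\<^sub>n n x y * indicator (- ball\<^sub>E x r) y * m y \<le> k x y * (A * real n * indicator (- ball\<^sub>E x r) y) * m y"
      proof (cases "y \<in> ball\<^sub>E x r")
        case False
        then have "x \<noteq> y" using r by (auto simp: mem_ball)
        then show ?thesis using False mult_right_mono[OF off[OF n] m_nonneg] by (simp add: mult_ac)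
      qed simp
    qed
    also have "\<dots> = A * real n * K (indicator (- ball\<^sub>E x r)) x" by (rule kernel_op_cmult)
    also have "\<dots> \<le> A * real n * (C\<^sub>T * r powr (- \<beta>))"
      using A by (intro mult_left_mono tail r) auto
    finally show ?thesis by (simp add: mult_ac)
  qed
  \<comment> \<open>Either all tails up to time n are at most 1/2, as the maximal inequality
    requires, or the right-hand side is at least 1.\<close>
  have half: "exit_prob M k (ball\<^sub>E x (2 * r)) n x \<le> 2 * (A * C\<^sub>T * real n * r powr (- \<beta>))"
    if r: "0 < r" for x r n
  proof (cases "n \<ge> 1 \<and> A * C\<^sub>T * real n * r powr (- \<beta>) \<le> 1 / 2")
    case True
    have "1 / 2 * exit_prob M k (ball\<^sub>E x (2 * r)) n x \<le> (K ^^ n) (indicator (- ball\<^sub>E x r)) x"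
    proof (rule half_exit_prob_le[OF _ r order_refl])
      fix j z assume j: "1 \<le> j" "j \<le> n"
      have "A * C\<^sub>T * real j * r powr (- \<beta>) \<le> A * C\<^sub>T * real n * r powr (- \<beta>)"
        using A CT j by (intro mult_right_mono mult_left_mono) auto
      then show "kernel_op M (k\<^sub>n j) (indicator (- ball\<^sub>E z r)) z \<le> 1 / 2"
        using tail_n[OF j(1) r, of z] True by linarith
    qed
    also have "\<dots> = kernel_op M (k\<^sub>n n) (indicator (- ball\<^sub>E x r)) x"
      using True by (intro kernel_op_pow[OF k] bounded_range_indicator) auto
    finally show ?thesis using tail_n[OF _ r, of n x] True by linarith
  next
    case False
    show ?thesis
    proof (cases "n = 0")
      case True
      then show ?thesis using r by (auto simp: mem_ball indicator_def)
    next
      case False': False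
      with False have "1 / 2 \<le> A * C\<^sub>T * real n * r powr (- \<beta>)" by simp
      then show ?thesis using exit_prob_le_1[OF k_substochastic, of "ball\<^sub>E x (2 * r)" n x] by linarith
    qed
  qed
  show ?thesis
  proof (rule that[of "2 * A * C\<^sub>T * 2 powr \<beta>"], unfold exit_bounded_def, intro conjI allI impI)
    show "0 < 2 * A * C\<^sub>T * 2 powr \<beta>" using A CT by simp
    fix x n and r :: real assume r: "0 < r"
    have "(r / 2) powr (- \<beta>) = 2 powr \<beta> * r powr (- \<beta>)"
      using r by (simp add: powr_divide powr_minus_divide)
    then show "exit_prob M k (ball\<^sub>E x r) n x \<le> 2 * A * C\<^sub>T * 2 powr \<beta> * real n * r powr (- \<beta>)"
      using half[of "r / 2" x n] r by (simp add: mult_ac)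
  qed
qed

subsection \<open>Exit estimates imply heat kernel bounds\<close>

text \<open>The walk killed outside \<open>B\<close>. The indicator stands in front of
  \<open>K\<close>, so a power does not test the endpoint of the path; where the endpoint has to lie
  in \<open>B\<close> too, the function below carries its own indicator.\<close>

abbreviation killed :: "'a set \<Rightarrow> ('a \<Rightarrow> real) \<Rightarrow> 'a \<Rightarrow> real" where
  "killed B \<equiv> \<lambda>f x. indicator B x * K f x"

lemma killed_pow_bounded: "bounded (range f) \<Longrightarrow> bounded (range ((killed B ^^ j) f))"
  by (induction j) (auto intro: bounded_range_indicator_mult kernel_op_bounded k_substochastic)

lemma killed_pow_nonneg: "(\<And>y. 0 \<le> f y) \<Longrightarrow> 0 \<le> (killed B ^^ j) f x" for f :: "'a \<Rightarrow> real"
  by (induction j arbitrary: x) (auto intro!: mult_nonneg_nonneg kernel_op_nonneg k_substochastic)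

lemma killed_pow_le:
  assumes "bounded (range f)" "\<And>y. 0 \<le> f y"
  shows "(killed B ^^ j) f x \<le> (K ^^ j) f x"
proof (induction j arbitrary: x)
  case (Suc j)
  have "K ((killed B ^^ j) f) x \<le> K ((K ^^ j) f) x"
    by (intro kernel_op_mono k_substochastic killed_pow_bounded kernel_op_pow_bounded assms Suc)
  moreover have "0 \<le> K ((K ^^ j) f) x"
    by (intro kernel_op_nonneg kernel_op_pow_nonneg k_substochastic assms)
  ultimately show ?case by (simp add: indicator_def)
qed simp

text \<open>The left side is the part of \<open>u j z\<close> carried by paths that leave
  \<open>B\<close>. The jump out of \<open>B\<close> either lands in \<open>B'\<close>, the
  neighbourhood of the target, where the jump density is at most \<open>A\<close> and the remaining
  solution has mass at most 1, which costs \<open>A\<close> per step; or it lands elsewhere, where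
  the remaining solution is at most \<open>S\<close>, which costs \<open>S\<close> times the exit
  probability.\<close>

lemma first_exit_le:
  assumes u: "\<And>j z. 0 \<le> u j z" "\<And>j. bounded (range (u j))" "\<And>j. u (Suc j) = K (u j)"
    and mass1: "\<And>j S. finite S \<Longrightarrow> (\<Sum>z\<in>S. u j z * m z) \<le> 1"
    and A: "0 \<le> A" "\<And>z w. z \<in> B \<Longrightarrow> w \<notin> B \<Longrightarrow> w \<in> B' \<Longrightarrow> k z w \<le> A"
    and S: "0 \<le> S" "\<And>j w. j \<le> n \<Longrightarrow> w \<notin> B \<Longrightarrow> w \<notin> B' \<Longrightarrow> u j w \<le> S"
    and "j \<le> n" "z \<in> B"
  shows "u j z - (killed B ^^ j) (\<lambda>z. indicator B z * u 0 z) z \<le> real j * A + exit_prob M k B j z * S"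
  using \<open>j \<le> n\<close> \<open>z \<in> B\<close>
proof (induction j arbitrary: z)
  case (Suc j)
  define h where "h = (killed B ^^ j) (\<lambda>z. indicator B z * u 0 z)"
  have hb: "bounded (range h)"
    unfolding h_def by (intro killed_pow_bounded bounded_range_indicator_mult u)
  have h0: "0 \<le> h w" for w
    unfolding h_def by (intro killed_pow_nonneg) (simp add: u)
  define H where "H = (\<lambda>w. indicator (B' - B) w * u j w)"
  have Hb: "bounded (range H)" unfolding H_def by (intro bounded_range_indicator_mult u)
  have "K (\<lambda>w. u j w + -1 * h w) z \<le> K (\<lambda>w. (real j * A + S * exit_prob M k B j w) + H w) z"
  proof (intro kernel_op_mono k_substochastic)
    show "bounded (range (\<lambda>w. u j w + -1 * h w))"
      by (intro bounded_range_plus bounded_range_cmult u hb)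
    show "bounded (range (\<lambda>w. (real j * A + S * exit_prob M k B j w) + H w))"
      by (intro bounded_range_plus bounded_range_cmult exit_prob_bounded k_substochastic Hb) auto
    fix w
    show "u j w + -1 * h w \<le> (real j * A + S * exit_prob M k B j w) + H w"
    proof (cases "w \<in> B")
      case True
      then show ?thesis using Suc.IH[of w] Suc.prems unfolding h_def H_def
        by (simp add: mult.commute)
    next
      case False
      have "u j w \<le> S + H w"
        using False S(1) S(2)[of j w] Suc.prems u(1)[of j w] by (cases "w \<in> B'") (auto simp: H_def)
      moreover have "0 \<le> real j * A" using A(1) by simp
      ultimately show ?thesis using False h0[of w] by simp
    qed
  qed
  moreover have "K (\<lambda>w. u j w + -1 * h w) z = K (u j) z - K h z"
    using kernel_op_add[OF k_substochastic u(2) bounded_range_cmult[OF hb], of j "-1" z]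
      kernel_op_cmult[of M k "-1" h z] by simp
  moreover have "K (\<lambda>w. (real j * A + S * exit_prob M k B j w) + H w) z
      = real j * A + S * K (exit_prob M k B j) z + K H z"
  proof -
    have b1: "bounded (range (\<lambda>w. S * exit_prob M k B j w))"
      by (intro bounded_range_cmult exit_prob_bounded k_substochastic)
    have b0: "bounded (range (\<lambda>w::'a. real j * A))" by simp
    have "K (\<lambda>w. (real j * A + S * exit_prob M k B j w) + H w) z
        = K (\<lambda>w. real j * A) z + K (\<lambda>w. S * exit_prob M k B j w) z + K H z"
      using kernel_op_add[OF k_substochastic bounded_range_plus[OF b0 b1] Hb, of z]
        kernel_op_add[OF k_substochastic b0 b1, of z] by simp
    then show ?thesis by (simp add: kernel_op_cmult kernel_op_const[OF k])
  qed
  moreover have "K H z \<le> A"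
    unfolding kernel_op_def
  proof (rule infsum_le_finite_sums)
    show "(\<lambda>w. k z w * H w * m w) summable_on UNIV"
      by (rule kernel_op_summable[OF k_substochastic Hb])
    fix F :: "'a set" assume F: "finite F"
    have "(\<Sum>w\<in>F. k z w * H w * m w) \<le> (\<Sum>w\<in>F. A * (u j w * m w))"
    proof (rule sum_mono)
      fix w
      have "k z w * (u j w * m w) \<le> A * (u j w * m w)" if "w \<in> B' - B"
        using that A(2)[of z w] Suc.prems u(1)[of j w] m_nonneg[of w] by (intro mult_right_mono) auto
      moreover have "0 \<le> A * (u j w * m w)" using A u(1)[of j w] m_nonneg[of w] by simp
      ultimately show "k z w * H w * m w \<le> A * (u j w * m w)"
        by (auto simp: H_def indicator_def mult.assoc)
    qed
    also have "\<dots> \<le> A * 1"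
      unfolding sum_distrib_left[symmetric] by (intro mult_left_mono mass1 F A)
    finally show "(\<Sum>w\<in>F. k z w * H w * m w) \<le> A" by simp
  qed
  ultimately have "K (u j) z - K h z \<le> real (Suc j) * A + K (exit_prob M k B j) z * S"
    by (simp add: algebra_simps)
  then show ?case using Suc.prems by (simp add: u(3) h_def)
qed (use A S in \<open>auto simp: indicator_def\<close>)

text \<open>Let h be the part of \<open>k\<^sub>n\<close> from paths that stay near x for the first
  a steps, and h' the part from reversed paths that stay near y for b steps. The point at time a
  would be in both balls, which are disjoint for radius d/3, so h + h' \<le>
  \<open>k\<^sub>n\<close>, and \<open>k\<^sub>n\<close> is at most the sum of the two exit parts
  \<open>k\<^sub>n\<close> - h and \<open>k\<^sub>n\<close> - h'. Direct jumps between the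
  neighbourhoods of x and y have length at least d/3. Bounds with \<open>S\<close> are needed only
  for times from min a b on, which keeps them comparable to the total time.\<close>

lemma two_sided_exit_le:
  assumes "x \<noteq> y" and a: "1 \<le> a" and b: "1 \<le> b" and S0: "0 \<le> S"
    and S: "\<And>l w w'. min a b \<le> l \<Longrightarrow> l \<le> a + b \<Longrightarrow> dist\<^sub>E x y / 3 \<le> dist\<^sub>E w w' \<Longrightarrow> k\<^sub>n l w w' \<le> S"
  defines "\<rho> \<equiv> dist\<^sub>E x y / 3"
  shows "k\<^sub>n (a + b) x y \<le> real (a + b) * (C\<^sub>J * \<rho> powr (- (\<alpha> + \<beta>)))
    + (exit_prob M k (ball\<^sub>E x \<rho>) a x + exit_prob M k (ball\<^sub>E y \<rho>) b y) * S"
proof -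
  have \<rho>: "0 < \<rho>" using \<open>x \<noteq> y\<close> dist_eq_0_iff[of x y] by (simp add: \<rho>_def)
  define A where "A = C\<^sub>J * \<rho> powr (- (\<alpha> + \<beta>))"
  have A0: "0 \<le> A" using C\<^sub>J by (simp add: A_def)
  have one: "k\<^sub>n (i + j) x' y' - (killed (ball\<^sub>E x' \<rho>) ^^ j) (\<lambda>z. indicator (ball\<^sub>E x' \<rho>) z * k\<^sub>n i z y') x'
      \<le> real j * A + exit_prob M k (ball\<^sub>E x' \<rho>) j x' * S"
    if i: "1 \<le> i" "min a b \<le> i" and ij: "i + j = a + b" and d: "dist\<^sub>E x' y' = dist\<^sub>E x y" for i j x' y'
  proof -
    have "k\<^sub>n (i + j) x' y' - (killed (ball\<^sub>E x' \<rho>) ^^ j)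
        (\<lambda>z. indicator (ball\<^sub>E x' \<rho>) z * k\<^sub>n (i + 0) z y') x' \<le> real j * A + exit_prob M k (ball\<^sub>E x' \<rho>) j x' * S"
    proof (rule first_exit_le[where u = "\<lambda>j z. k\<^sub>n (i + j) z y'" and B' = "{w. dist\<^sub>E w y' < \<rho>}" and n = j])
      show "0 \<le> k\<^sub>n (i + j) z y'" for j z by (rule iter_kernel_markov(1)[OF k]) (use i in simp)
      show "bounded (range (\<lambda>z. k\<^sub>n (i + j) z y'))" for j
        by (rule iter_kernel_bounded[OF k k_le]) (use i in simp)
      show "(\<lambda>z. k\<^sub>n (i + Suc j) z y') = K (\<lambda>z. k\<^sub>n (i + j) z y')" for j
        using iter_kernel_Suc[OF k, of "i + j"] i by (auto simp: fun_eq_iff)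
      show "(\<Sum>z\<in>F. k\<^sub>n (i + j) z y' * m z) \<le> 1" if "finite F" for j F
        using substochastic_sum_le[OF iter_kernel_substochastic[OF k, of "i + j"] that, of y'] i
        by (simp add: iter_kernel_sym[OF k k_le, of "i + j" y'])
      show "k z w \<le> A" if "z \<in> ball\<^sub>E x' \<rho>" "w \<in> {w. dist\<^sub>E w y' < \<rho>}" for z w
        unfolding A_def using that d \<rho> dist_triangle_real[of x' y' z] dist_triangle_real[of z y' w]
        by (intro k_le_powr) (auto simp: mem_ball \<rho>_def)
      show "k\<^sub>n (i + l) w y' \<le> S" if "l \<le> j" "w \<notin> {w. dist\<^sub>E w y' < \<rho>}" for l w
        using that i ij by (intro S) (auto simp: \<rho>_def)
      show "x' \<in> ball\<^sub>E x' \<rho>" using \<rho> by (simp add: mem_ball)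
    qed (use A0 S0 in auto)
    then show ?thesis by simp
  qed
  have inner: "(killed B ^^ j) (\<lambda>z. indicator B z * k\<^sub>n i z y') x' \<le> (\<Sum>w\<in>B. k\<^sub>n j x' w * k\<^sub>n i w y' * m w)"
    if i: "1 \<le> i" and j: "1 \<le> j" and B: "finite B" for i j B x' y'
  proof -
    let ?h = "\<lambda>z. indicator B z * k\<^sub>n i z y'"
    have hb: "bounded (range ?h)"
      by (intro bounded_range_indicator_mult iter_kernel_bounded[OF k k_le i])
    have "(killed B ^^ j) ?h x' \<le> (K ^^ j) ?h x'"
      by (intro killed_pow_le hb) (simp add: iter_kernel_markov(1)[OF k i])
    also have "\<dots> = kernel_op M (k\<^sub>n j) ?h x'" by (rule kernel_op_pow[OF k j hb])
    also have "\<dots> = (\<Sum>w\<in>B. k\<^sub>n j x' w * ?h w * m w)" by (rule kernel_op_finite[OF B]) simp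
    finally show ?thesis by simp
  qed
  define h where "h = (killed (ball\<^sub>E x \<rho>) ^^ a) (\<lambda>z. indicator (ball\<^sub>E x \<rho>) z * k\<^sub>n b z y) x"
  define h' where "h' = (killed (ball\<^sub>E y \<rho>) ^^ b) (\<lambda>z. indicator (ball\<^sub>E y \<rho>) z * k\<^sub>n a z x) y"
  let ?f = "\<lambda>w. k\<^sub>n a x w * k\<^sub>n b w y * m w"
  have disj: "ball\<^sub>E x \<rho> \<inter> ball\<^sub>E y \<rho> = {}"
  proof -
    have False if "w \<in> ball\<^sub>E x \<rho>" "w \<in> ball\<^sub>E y \<rho>" for w
      using that dist_triangle_real[of x y w] dist_commute[of w y] \<rho> by (auto simp: mem_ball \<rho>_def)
    then show ?thesis by blast
  qed
  have "h \<le> sum ?f (ball\<^sub>E x \<rho>)"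
    unfolding h_def by (rule inner[OF b a finite_ball])
  moreover have "h' \<le> sum ?f (ball\<^sub>E y \<rho>)"
    using inner[OF a b finite_ball, of y \<rho> x y]
    by (simp add: h'_def iter_kernel_sym[OF k k_le a, of _ x] iter_kernel_sym[OF k k_le b, of y] mult_ac)
  moreover have "sum ?f (ball\<^sub>E x \<rho>) + sum ?f (ball\<^sub>E y \<rho>) = sum ?f (ball\<^sub>E x \<rho> \<union> ball\<^sub>E y \<rho>)"
    using disj by (simp add: sum.union_disjoint finite_ball)
  moreover have "\<dots> \<le> kernel_op M (k\<^sub>n a) (\<lambda>z. k\<^sub>n b z y) x"
    by (rule sum_le_kernel_op[OF iter_kernel_substochastic[OF k a] _ iter_kernel_bounded[OF k k_le b]])
       (auto simp: finite_ball iter_kernel_markov(1)[OF k b])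
  moreover have "\<dots> = k\<^sub>n (a + b) x y"
    by (rule iter_kernel_add[OF k k_le b a, symmetric])
  ultimately have "h + h' \<le> k\<^sub>n (a + b) x y" by linarith
  moreover have "k\<^sub>n (a + b) x y - h \<le> real a * A + exit_prob M k (ball\<^sub>E x \<rho>) a x * S"
    using one[of b a x y] b by (simp add: h_def add.commute)
  moreover have "k\<^sub>n (a + b) x y - h' \<le> real b * A + exit_prob M k (ball\<^sub>E y \<rho>) b y * S"
    using one[of a b y x] a iter_kernel_sym[OF k k_le, of "a + b" x y]
    by (simp add: h'_def dist_commute[of y x])
  ultimately show ?thesis
    by (simp add: A_def algebra_simps)
qed

text \<open>With t = n d^(-\<beta>), the bound for i is inserted as \<open>S\<close> and multiplied
  by the exit probability p. For the term of one big jump p \<le> 2 suffices; for the other term p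
  \<le> C t yields the next power of t. The constant grows with i, which is harmless because i will
  be fixed.\<close>

lemma off_diagonal_iterate:
  assumes C: "exit_bounded C"
  shows "\<exists>D>0. \<forall>n\<ge>1. \<forall>x y. x \<noteq> y \<longrightarrow>
    k\<^sub>n n x y \<le> D * (real n * dist\<^sub>E x y powr (- (\<alpha> + \<beta>))
      + (real n * dist\<^sub>E x y powr (- \<beta>)) ^ i * real n powr (- (\<alpha> / \<beta>)))"
proof (induction i)
  case 0
  obtain D where D: "D > 0" "\<And>n x y. n \<ge> 1 \<Longrightarrow> k\<^sub>n n x y \<le> D * real n powr (- (\<alpha> / \<beta>))"
    using on_diagonal_bound by blast
  have "D * real n powr (- (\<alpha> / \<beta>)) \<le> D * (real n * dist\<^sub>E x y powr (- (\<alpha> + \<beta>))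
      + (real n * dist\<^sub>E x y powr (- \<beta>)) ^ 0 * real n powr (- (\<alpha> / \<beta>)))" for n x y
    using D(1) by (intro mult_left_mono) auto
  then show ?case using D order_trans by blast
next
  case (Suc i)
  define s where "s = \<alpha> + \<beta>"
  define e where "e = \<alpha> / \<beta>"
  have s: "0 < s" and e: "0 < e" using \<alpha> \<beta> by (auto simp: s_def e_def)
  obtain D where D: "0 < D" and IH: "\<And>n x y. n \<ge> 1 \<Longrightarrow> x \<noteq> y \<Longrightarrow>
    k\<^sub>n n x y \<le> D * (real n * dist\<^sub>E x y powr (- s) + (real n * dist\<^sub>E x y powr (- \<beta>)) ^ i * real n powr (- e))"
    using Suc unfolding s_def e_def by blast
  have C0: "0 < C" and ex: "\<And>x r n. 0 < r \<Longrightarrow> exit_prob M k (ball\<^sub>E x r) n x \<le> C * real n * r powr (- \<beta>)"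
    using C by (auto simp: exit_bounded_def)
  define D' where "D' = C\<^sub>J * 3 powr s + 2 * D * 3 powr s + 2 * C * 3 powr \<beta> * D * (3 powr \<beta>) ^ i * 3 powr e"
  have D': "0 < D'" using C\<^sub>J D C0 by (simp add: D'_def add_pos_pos)
  have third: "(t / 3) powr (- c) = 3 powr c * t powr (- c)" for t c :: real
    by (simp add: powr_divide powr_minus_divide)
  have "k\<^sub>n n x y \<le> D' * (real n * dist\<^sub>E x y powr (- s)
      + (real n * dist\<^sub>E x y powr (- \<beta>)) ^ Suc i * real n powr (- e))" if n: "n \<ge> 1" and xy: "x \<noteq> y" for n x y
  proof -
    define d where "d = dist\<^sub>E x y"
    have d: "1 \<le> d" using xy dist_eq_0_iff[of x y] by (simp add: d_def)
    define P where "P = real n * d powr (- s)"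
    define Q where "Q = (real n * d powr (- \<beta>)) ^ i * real n powr (- e)"
    define t where "t = real n * d powr (- \<beta>)"
    have nn: "0 \<le> P" "0 \<le> Q" "0 \<le> t" using d by (auto simp: P_def Q_def t_def)
    have "k\<^sub>n n x y \<le> D' * (P + t * Q)"
    proof (cases "n = 1")
      case True
      have "k x y \<le> C\<^sub>J * d powr (- s)" unfolding s_def using d by (intro k_le_powr) (auto simp: d_def)
      also have "\<dots> \<le> D' * d powr (- s)"
      proof (rule mult_right_mono)
        have "C\<^sub>J * 1 \<le> C\<^sub>J * 3 powr s" using C\<^sub>J s by (intro mult_left_mono ge_one_powr_ge_zero) auto
        moreover have "0 \<le> 2 * D * 3 powr s + 2 * C * 3 powr \<beta> * D * (3 powr \<beta>) ^ i * 3 powr e"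
          using D C0 by simp
        ultimately show "C\<^sub>J \<le> D'" unfolding D'_def by linarith
      qed simp
      also have "\<dots> \<le> D' * (P + t * Q)" using D' nn True by (intro mult_left_mono) (auto simp: P_def)
      finally show ?thesis using True by (simp add: iter_kernel_1[OF k])
    next
      case False
      \<comment> \<open>Halving keeps both times between n/3 and n, but needs n \<ge> 2; for n = 1
        the jump bound is the claim.\<close>
      define a where "a = n div 2"
      define b where "b = n - a"
      have ab: "1 \<le> a" "1 \<le> b" "a + b = n" "n \<le> 3 * a" "n \<le> 3 * b" using n False by (auto simp: a_def b_def)
      define S where "S = D * (3 powr s * P + (3 powr \<beta>) ^ i * 3 powr e * Q)"
      have S0: "0 \<le> S" using D nn by (simp add: S_def)
      have S: "k\<^sub>n l w w' \<le> S" if l: "min a b \<le> l" "l \<le> a + b" and dw: "d / 3 \<le> dist\<^sub>E w w'" for l w w'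
      proof -
        have l1: "1 \<le> l" "real n / 3 \<le> real l" "l \<le> n" using l ab by auto
        have "w \<noteq> w'" using dw d by auto
        then have "k\<^sub>n l w w' \<le> D * (real l * dist\<^sub>E w w' powr (- s)
            + (real l * dist\<^sub>E w w' powr (- \<beta>)) ^ i * real l powr (- e))" by (rule IH[OF l1(1)])
        also have "\<dots> \<le> D * (real n * (d / 3) powr (- s)
            + (real n * (d / 3) powr (- \<beta>)) ^ i * (real n / 3) powr (- e))"
          using D l1 dw d s \<beta> e n
          by (intro mult_left_mono add_mono mult_mono power_mono powr_mono2') auto
        also have "\<dots> = S"
          unfolding third by (simp add: S_def P_def Q_def power_mult_distrib mult_ac)
        finally show ?thesis .
      qed
      define p where "p = exit_prob M k (ball\<^sub>E x (d / 3)) a x + exit_prob M k (ball\<^sub>E y (d / 3)) b y"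
      have "k\<^sub>n (a + b) x y \<le> real (a + b) * (C\<^sub>J * (d / 3) powr (- (\<alpha> + \<beta>))) + p * S"
        unfolding p_def d_def
        by (rule two_sided_exit_le[OF xy ab(1,2) S0]) (rule S, auto simp: d_def)
      moreover have "p \<le> 2"
        using exit_prob_le_1[OF k_substochastic, of "ball\<^sub>E x (d / 3)" a x]
          exit_prob_le_1[OF k_substochastic, of "ball\<^sub>E y (d / 3)" b y] by (simp add: p_def)
      moreover have "p \<le> 2 * C * 3 powr \<beta> * t"
      proof -
        have le: "C * real l * (d / 3) powr (- \<beta>) \<le> C * real n * (d / 3) powr (- \<beta>)" if "l \<le> n" for l
          using that C0 by (intro mult_right_mono mult_left_mono) auto
        have "p \<le> C * real n * (d / 3) powr (- \<beta>) + C * real n * (d / 3) powr (- \<beta>)"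
          unfolding p_def using d ab
          by (intro add_mono order_trans[OF ex le]) auto
        then show ?thesis unfolding third by (simp add: t_def mult_ac)
      qed
      moreover have "p * S = p * (D * 3 powr s * P) + p * (D * (3 powr \<beta>) ^ i * 3 powr e * Q)"
        by (simp add: S_def algebra_simps)
      moreover have "p * (D * 3 powr s * P) \<le> 2 * (D * 3 powr s * P)"
        using \<open>p \<le> 2\<close> D nn by (intro mult_right_mono) auto
      moreover have "p * (D * (3 powr \<beta>) ^ i * 3 powr e * Q)
          \<le> (2 * C * 3 powr \<beta> * t) * (D * (3 powr \<beta>) ^ i * 3 powr e * Q)"
        using \<open>p \<le> 2 * C * 3 powr \<beta> * t\<close> D nn by (intro mult_right_mono) auto
      ultimately have "k\<^sub>n n x y \<le> (C\<^sub>J * 3 powr s + 2 * D * 3 powr s) * P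
          + (2 * C * 3 powr \<beta> * D * (3 powr \<beta>) ^ i * 3 powr e) * (t * Q)"
        unfolding ab(3) s_def[symmetric] third by (simp add: P_def algebra_simps)
      also have "\<dots> \<le> D' * P + D' * (t * Q)"
      proof (intro add_mono mult_right_mono)
        show "C\<^sub>J * 3 powr s + 2 * D * 3 powr s \<le> D'" using C0 D by (simp add: D'_def)
        show "2 * C * 3 powr \<beta> * D * (3 powr \<beta>) ^ i * 3 powr e \<le> D'" using C\<^sub>J D by (simp add: D'_def)
      qed (use nn in auto)
      finally show ?thesis by (simp add: distrib_left)
    qed
    then show ?thesis by (simp add: P_def Q_def t_def d_def mult_ac)
  qed
  then show ?case using D' unfolding s_def e_def by blast
qed

text \<open>The exponent 1 + \<alpha>/\<beta> is the one for which t^(1+\<alpha>/\<beta>)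
  n^(-\<alpha>/\<beta>) = n d^(-\<alpha>-\<beta>), where t = n d^(-\<beta>). Iterating at least that
  often settles t \<le> 1; for t > 1 the on-diagonal bound is already the smaller one.\<close>

lemma exit_bounded_imp_UHKP:
  assumes "exit_bounded C"
  shows "UHKP E M \<alpha> \<beta> k"
proof -
  define s where "s = \<alpha> + \<beta>"
  define e where "e = \<alpha> / \<beta>"
  have e: "0 < e" using \<alpha> \<beta> by (auto simp: e_def)
  obtain i :: nat where i: "1 + e \<le> real i" using real_arch_simple by blast
  obtain D where D: "0 < D" and off: "\<And>n x y. n \<ge> 1 \<Longrightarrow> x \<noteq> y \<Longrightarrow>
    k\<^sub>n n x y \<le> D * (real n * dist\<^sub>E x y powr (- s) + (real n * dist\<^sub>E x y powr (- \<beta>)) ^ i * real n powr (- e))"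
    using off_diagonal_iterate[OF assms, of i] unfolding s_def e_def by blast
  obtain C\<^sub>0 where C0: "C\<^sub>0 > 0" "\<And>n x y. n \<ge> 1 \<Longrightarrow> k\<^sub>n n x y \<le> C\<^sub>0 * real n powr (- e)"
    using on_diagonal_bound unfolding e_def by blast
  define C' where "C' = C\<^sub>0 + 2 * D"
  have C': "0 < C'" "C\<^sub>0 \<le> C'" "2 * D \<le> C'" using C0 D by (auto simp: C'_def)
  have on: "k\<^sub>n n x y \<le> C' * (1 / real n powr e)" if "n \<ge> 1" for n x y
  proof -
    have "k\<^sub>n n x y \<le> C\<^sub>0 * real n powr (- e)" by (rule C0(2)[OF that])
    also have "\<dots> \<le> C' * real n powr (- e)" using C' by (intro mult_right_mono) auto
    finally show ?thesis by (simp add: powr_minus_divide)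
  qed
  have off': "k\<^sub>n n x y \<le> C' * (real n / dist\<^sub>E x y powr s)" if n: "n \<ge> 1" and xy: "x \<noteq> y" for n x y
  proof -
    define d where "d = dist\<^sub>E x y"
    define t where "t = real n * d powr (- \<beta>)"
    have d: "1 \<le> d" using xy dist_eq_0_iff[of x y] by (simp add: d_def)
    have t0: "0 < t" using d n by (simp add: t_def)
    have "t powr (1 + e) * real n powr (- e) = (real n powr (1 + e) * real n powr (- e)) * d powr (- \<beta> * (1 + e))"
      using d n by (simp only: t_def powr_mult powr_powr mult_ac)
    also have "real n powr (1 + e) * real n powr (- e) = real n"
      using n by (simp only: powr_add[symmetric]) simp
    also have "- \<beta> * (1 + e) = - s" using \<beta> by (simp add: e_def s_def field_simps)
    finally have eq: "t powr (1 + e) * real n powr (- e) = real n * d powr (- s)" .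
    have half: "k\<^sub>n n x y \<le> C' * (real n * d powr (- s))"
    proof (cases "t \<le> 1")
      case True
      have "t ^ i = t powr real i" using t0 by (simp add: powr_realpow)
      also have "\<dots> \<le> t powr (1 + e)" using True t0 i by (intro powr_mono') auto
      finally have "t ^ i * real n powr (- e) \<le> real n * d powr (- s)"
        unfolding eq[symmetric] by (intro mult_right_mono) auto
      then have "D * (real n * d powr (- s) + t ^ i * real n powr (- e)) \<le> D * (2 * (real n * d powr (- s)))"
        using D by (intro mult_left_mono) auto
      also have "\<dots> \<le> C' * (real n * d powr (- s))"
        using mult_right_mono[OF C'(3), of "real n * d powr (- s)"] by simp
      finally show ?thesis using off[OF n xy] unfolding t_def d_def by linarith
    next
      case False
      have "1 \<le> t powr (1 + e)" using False e by (intro ge_one_powr_ge_zero) auto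
      then have "1 * real n powr (- e) \<le> t powr (1 + e) * real n powr (- e)" by (intro mult_right_mono) auto
      then have "C' * real n powr (- e) \<le> C' * (real n * d powr (- s))"
        unfolding eq using C' by (intro mult_left_mono) auto
      then show ?thesis using on[OF n, of x y] by (simp add: powr_minus_divide)
    qed
    then show ?thesis by (simp add: powr_minus_divide d_def)
  qed
  show ?thesis
    unfolding UHKP_def
  proof (intro exI[of _ C'] conjI allI impI C')
    fix x y n assume n: "1 \<le> (n::nat)"
    show "k\<^sub>n n x y \<le> C' * (if x = y then 1 / real n powr (\<alpha> / \<beta>)
             else min (1 / real n powr (\<alpha> / \<beta>)) (real n / dist\<^sub>E x y powr (\<alpha> + \<beta>)))"
      using on[OF n, of x y] off'[OF n, of x y] by (auto simp: s_def e_def min_def)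
  qed
qed


subsection \<open>The cutoff inequality as a statement about finite sums\<close>

definition dirichlet :: "'a set \<Rightarrow> ('a \<Rightarrow> 'a \<Rightarrow> real) \<Rightarrow> ('a \<Rightarrow> real) \<Rightarrow> real" where
  "dirichlet U q f = 1 / 2 * (\<Sum>y\<in>U. \<Sum>z\<in>U. (f y - f z)\<^sup>2 * (q y z * m z * m y))"

definition weighted_energy :: "'a set \<Rightarrow> ('a \<Rightarrow> 'a \<Rightarrow> real) \<Rightarrow> ('a \<Rightarrow> real) \<Rightarrow> ('a \<Rightarrow> real) \<Rightarrow> real" where
  "weighted_energy U q f g = 1 / 2 * (\<Sum>y\<in>U. \<Sum>z\<in>U. (f y)\<^sup>2 * (g y - g z)\<^sup>2 * (q y z * m z * m y))"

definition annulus :: "'a \<Rightarrow> real \<Rightarrow> real \<Rightarrow> 'a set" where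
  "annulus x R r = ball\<^sub>E x (R + r) - ball\<^sub>E x R"

text \<open>\<open>CSJ\<close> with its constants exposed and in the form in which it is used:
  \<open>f\<close> is arbitrary, since only its values on the finite annulus matter and zero
  extension makes it square integrable; \<phi> lies between 0 and 1, since clamping is a contraction
  and so does not raise the weighted energy.\<close>

definition cutoff_inequality :: "real \<Rightarrow> real \<Rightarrow> bool" where
  "cutoff_inequality C\<^sub>1 C\<^sub>2 \<longleftrightarrow> 0 < C\<^sub>1 \<and> 0 < C\<^sub>2 \<and> (\<forall>x R r. 0 < R \<longrightarrow> 0 < r \<longrightarrow>
     (\<exists>\<phi>. (\<forall>y. 0 \<le> \<phi> y \<and> \<phi> y \<le> 1) \<and>
        (\<forall>y\<in>ball\<^sub>E x (R + r / 2). \<phi> y = 1) \<and> (\<forall>y\<in>- ball\<^sub>E x (R + 9 * r / 10). \<phi> y = 0) \<and>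
        (\<forall>f. weighted_energy (annulus x R r) k f \<phi> \<le> C\<^sub>1 * dirichlet (annulus x R r) k f
               + C\<^sub>2 * r powr (- \<beta>) * (\<Sum>y\<in>annulus x R r. (f y)\<^sup>2 * m y))))"

lemma finite_annulus: "finite (annulus x R r)"
  by (simp add: annulus_def finite_ball)

lemma energy_measure_restrict:
  assumes "finite U" "y \<in> U"
  shows "energy_measure M (restrict_kernel U k) f f y
    = 1 / 2 * (\<Sum>z\<in>U. (f y - f z)\<^sup>2 * (k y z * m z * m y))"
proof -
  have "(\<Sum>\<^sub>\<infinity>z. (f y - f z) * (f y - f z) * restrict_kernel U k y z * m z * m y)
      = infsum (\<lambda>z. (f y - f z)\<^sup>2 * (k y z * m z * m y)) U"
    by (rule infsum_cong_neutral) (use assms in \<open>auto simp: restrict_kernel_def power2_eq_square\<close>)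
  then show ?thesis using assms by (simp add: energy_measure_def)
qed

lemma sum_energy_measure:
  assumes "finite U"
  shows "(\<Sum>y\<in>U. energy_measure M (restrict_kernel U k) f f y) = dirichlet U k f"
    and "(\<Sum>y\<in>U. (f y)\<^sup>2 * energy_measure M (restrict_kernel U k) g g y) = weighted_energy U k f g"
  using assms by (simp_all add: energy_measure_restrict dirichlet_def weighted_energy_def
      sum_distrib_left mult_ac)

lemma square_integrable_finite_support:
  assumes "finite U" "\<And>y. y \<notin> U \<Longrightarrow> f y = 0"
  shows "square_integrable M f"
proof -
  have meas: "g \<in> borel_measurable M" for g :: "'a \<Rightarrow> real"
    by (simp add: measurable_def sets_eq space_eq)
  have "integrable M (\<lambda>x. \<Sum>y\<in>U. (f y)\<^sup>2 * indicator {y} x)"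
    by (intro Bochner_Integration.integrable_sum integrable_mult_right integrable_real_indicator)
       (auto simp: sets_eq emeasure_singleton)
  moreover have "(\<Sum>y\<in>U. (f y)\<^sup>2 * indicator {y} x) = (f x)\<^sup>2" for x
  proof -
    have "(\<Sum>y\<in>U. (f y)\<^sup>2 * indicator {y} x) = (\<Sum>y\<in>U. if x = y then (f x)\<^sup>2 else 0)"
      by (intro sum.cong) auto
    then show ?thesis using assms by auto
  qed
  ultimately show ?thesis using meas by (simp add: square_integrable_def)
qed

lemma clamp_diff_le: "(max 0 (min 1 a) - max 0 (min 1 b))\<^sup>2 \<le> (a - b)\<^sup>2" for a b :: real
  by (rule abs_le_square_iff[THEN iffD1]) (auto simp: max_def min_def)

lemma min_one_diff_le: "(min 1 a - min 1 b)\<^sup>2 \<le> (a - b)\<^sup>2" for a b :: real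
  by (rule abs_le_square_iff[THEN iffD1]) (auto simp: min_def)

lemma CSJ_imp_cutoff_inequality:
  assumes "CSJ E M \<beta> k"
  obtains C\<^sub>1 C\<^sub>2 where "cutoff_inequality C\<^sub>1 C\<^sub>2"
proof -
  obtain C\<^sub>1 C\<^sub>2 where C: "C\<^sub>1 > 0" "C\<^sub>2 > 0" and ex: "\<forall>x. \<forall>R>0. \<forall>r>0. \<exists>\<phi>.
        cutoff_function (ball\<^sub>E x R) (ball\<^sub>E x (R + r)) \<phi> \<and>
        (\<forall>y\<in>ball\<^sub>E x (R + r / 2). \<phi> y = 1) \<and>
        (\<forall>y\<in>- ball\<^sub>E x (R + 9 * r / 10). \<phi> y = 0) \<and>
        (\<forall>f. square_integrable M f \<longrightarrow>
          (let U = ball\<^sub>E x (R + r) - ball\<^sub>E x R; \<Gamma>\<^sub>U = energy_measure M (restrict_kernel U k)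
           in (\<Sum>y\<in>U. (f y)\<^sup>2 * \<Gamma>\<^sub>U \<phi> \<phi> y)
                \<le> C\<^sub>1 * (\<Sum>y\<in>U. \<Gamma>\<^sub>U f f y) + C\<^sub>2 / r powr \<beta> * (\<Sum>y\<in>U. (f y)\<^sup>2 * m y)))"
    using assms unfolding CSJ_def by (elim exE conjE) (rule that, assumption+)
  have "cutoff_inequality C\<^sub>1 C\<^sub>2"
    unfolding cutoff_inequality_def
  proof (intro conjI C allI impI)
    fix x and R r :: real assume Rr: "0 < R" "0 < r"
    define U where "U = annulus x R r"
    have fU: "finite U" by (simp add: U_def finite_annulus)
    obtain \<phi> where \<phi>: "\<forall>y\<in>ball\<^sub>E x (R + r / 2). \<phi> y = 1" "\<forall>y\<in>- ball\<^sub>E x (R + 9 * r / 10). \<phi> y = 0"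
      and ineq: "\<And>f. square_integrable M f \<Longrightarrow>
          weighted_energy U k f \<phi> \<le> C\<^sub>1 * dirichlet U k f + C\<^sub>2 / r powr \<beta> * (\<Sum>y\<in>U. (f y)\<^sup>2 * m y)"
      using ex[rule_format, OF Rr, of x] unfolding Let_def annulus_def[symmetric] U_def[symmetric]
        sum_energy_measure[OF fU] by blast
    define \<psi> where "\<psi> = (\<lambda>y. max 0 (min 1 (\<phi> y)))"
    show "\<exists>\<phi>. (\<forall>y. 0 \<le> \<phi> y \<and> \<phi> y \<le> 1) \<and>
        (\<forall>y\<in>ball\<^sub>E x (R + r / 2). \<phi> y = 1) \<and> (\<forall>y\<in>- ball\<^sub>E x (R + 9 * r / 10). \<phi> y = 0) \<and>
        (\<forall>f. weighted_energy (annulus x R r) k f \<phi> \<le> C\<^sub>1 * dirichlet (annulus x R r) k f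
               + C\<^sub>2 * r powr (- \<beta>) * (\<Sum>y\<in>annulus x R r. (f y)\<^sup>2 * m y))"
    proof (intro exI[of _ \<psi>] conjI allI)
      show "0 \<le> \<psi> y" "\<psi> y \<le> 1" for y by (auto simp: \<psi>_def)
      show "\<forall>y\<in>ball\<^sub>E x (R + r / 2). \<psi> y = 1" "\<forall>y\<in>- ball\<^sub>E x (R + 9 * r / 10). \<psi> y = 0"
        using \<phi> by (auto simp: \<psi>_def)
      fix f :: "'a \<Rightarrow> real"
      define f' where "f' = (\<lambda>y. if y \<in> U then f y else 0)"
      have "weighted_energy U k f \<psi> \<le> weighted_energy U k f' \<phi>"
        unfolding weighted_energy_def \<psi>_def f'_def
        by (intro mult_left_mono sum_mono mult_mono clamp_diff_le mult_nonneg_nonneg)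
           (auto simp: k_nonneg m_nonneg)
      also have "\<dots> \<le> C\<^sub>1 * dirichlet U k f' + C\<^sub>2 / r powr \<beta> * (\<Sum>y\<in>U. (f' y)\<^sup>2 * m y)"
        by (intro ineq square_integrable_finite_support[OF fU]) (simp add: f'_def)
      also have "dirichlet U k f' = dirichlet U k f" by (simp add: dirichlet_def f'_def)
      also have "(\<Sum>y\<in>U. (f' y)\<^sup>2 * m y) = (\<Sum>y\<in>U. (f y)\<^sup>2 * m y)" by (simp add: f'_def)
      finally show "weighted_energy (annulus x R r) k f \<psi> \<le> C\<^sub>1 * dirichlet (annulus x R r) k f
               + C\<^sub>2 * r powr (- \<beta>) * (\<Sum>y\<in>annulus x R r. (f y)\<^sup>2 * m y)"
        by (simp add: U_def powr_minus_divide)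
    qed
  qed
  then show ?thesis by (rule that)
qed

lemma cutoff_inequality_imp_CSJ:
  assumes "cutoff_inequality C\<^sub>1 C\<^sub>2"
  shows "CSJ E M \<beta> k"
  unfolding CSJ_def
proof (rule exI[of _ C\<^sub>1], rule conjI[OF _ exI[of _ C\<^sub>2], rotated], intro conjI allI impI)
  show "C\<^sub>1 > 0" "C\<^sub>2 > 0" using assms by (auto simp: cutoff_inequality_def)
  fix x and R r :: real assume Rr: "0 < R" "0 < r"
  have fU: "finite (ball\<^sub>E x (R + r) - ball\<^sub>E x R)" by (simp add: finite_ball)
  obtain \<phi> where \<phi>: "\<forall>y\<in>ball\<^sub>E x (R + r / 2). \<phi> y = 1" "\<forall>y\<in>- ball\<^sub>E x (R + 9 * r / 10). \<phi> y = 0"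
    and ineq: "\<And>f. weighted_energy (annulus x R r) k f \<phi> \<le> C\<^sub>1 * dirichlet (annulus x R r) k f
               + C\<^sub>2 * r powr (- \<beta>) * (\<Sum>y\<in>annulus x R r. (f y)\<^sup>2 * m y)"
    using assms Rr unfolding cutoff_inequality_def by blast
  have "cutoff_function (ball\<^sub>E x R) (ball\<^sub>E x (R + r)) \<phi>"
    unfolding cutoff_function_def
    using \<phi> Rr ball_mono[of R "R + r / 2" x] ball_mono[of "R + 9 * r / 10" "R + r" x]
      ball_mono[of R "R + r" x] finite_ball by (auto simp: subset_iff)
  then show "\<exists>\<phi>. cutoff_function (ball\<^sub>E x R) (ball\<^sub>E x (R + r)) \<phi> \<and>
        (\<forall>y\<in>ball\<^sub>E x (R + r / 2). \<phi> y = 1) \<and>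
        (\<forall>y\<in>- ball\<^sub>E x (R + 9 * r / 10). \<phi> y = 0) \<and>
        (\<forall>f. square_integrable M f \<longrightarrow>
          (let U = ball\<^sub>E x (R + r) - ball\<^sub>E x R; \<Gamma>\<^sub>U = energy_measure M (restrict_kernel U k)
           in (\<Sum>y\<in>U. (f y)\<^sup>2 * \<Gamma>\<^sub>U \<phi> \<phi> y)
                \<le> C\<^sub>1 * (\<Sum>y\<in>U. \<Gamma>\<^sub>U f f y) + C\<^sub>2 / r powr \<beta> * (\<Sum>y\<in>U. (f y)\<^sup>2 * m y)))"
    using \<phi> ineq unfolding Let_def sum_energy_measure[OF fU]
    by (intro exI[of _ \<phi>]) (simp add: annulus_def powr_minus_divide)
qed

subsection \<open>Exit estimates imply the cutoff inequality\<close>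

lemma sum_symmetrize:
  fixes F :: "'a \<Rightarrow> 'a \<Rightarrow> real"
  shows "(\<Sum>y\<in>U. \<Sum>z\<in>U. F y z) = 1 / 2 * (\<Sum>y\<in>U. \<Sum>z\<in>U. F y z + F z y)"
  using sum.swap[of F U U] by (simp add: sum.distrib)

text \<open>Summation by parts on \<open>U\<close>. The only loss is in the row sums over
  \<open>U\<close>, which are at most 1 rather than equal to 1, and the sign of
  \<open>v y * g y\<close> gives it the right direction.\<close>

lemma dirichlet_form_le:
  assumes q: "substochastic M q" "\<And>y z. q y z = q z y" and U: "finite U"
    and vg: "\<And>y. 0 \<le> v y * g y"
  shows "1 / 2 * (\<Sum>y\<in>U. \<Sum>z\<in>U. (v y - v z) * (g y - g z) * (q y z * m z * m y))
    \<le> (\<Sum>y\<in>U. g y * (v y - (\<Sum>z\<in>U. q y z * v z * m z)) * m y)"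
proof -
  have "1 / 2 * (\<Sum>y\<in>U. \<Sum>z\<in>U. (v y - v z) * (g y - g z) * (q y z * m z * m y))
      = (\<Sum>y\<in>U. \<Sum>z\<in>U. g y * (v y - v z) * (q y z * m z * m y))"
    unfolding sum_symmetrize[of "\<lambda>y z. g y * (v y - v z) * (q y z * m z * m y)"]
    by (intro arg_cong2[of _ _ _ _ "(*)"] sum.cong refl) (simp add: q(2) algebra_simps)
  also have "\<dots> = (\<Sum>y\<in>U. v y * g y * m y * (\<Sum>z\<in>U. q y z * m z) - g y * m y * (\<Sum>z\<in>U. q y z * v z * m z))"
    by (simp add: sum_distrib_left sum_subtractf[symmetric] algebra_simps)
  also have "\<dots> \<le> (\<Sum>y\<in>U. v y * g y * m y * 1 - g y * m y * (\<Sum>z\<in>U. q y z * v z * m z))"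
    by (intro sum_mono diff_right_mono mult_left_mono substochastic_sum_le q U mult_nonneg_nonneg vg m_nonneg)
  finally show ?thesis by (simp add: algebra_simps)
qed

lemma product_rule_lower:
  fixes a b s t :: real
  assumes "0 \<le> a" "a \<le> 1" "0 \<le> b" "b \<le> 1"
  shows "1 / 4 * (s\<^sup>2 + t\<^sup>2) * (a - b)\<^sup>2 - 2 * (s - t)\<^sup>2 \<le> (a - b) * (s\<^sup>2 * a - t\<^sup>2 * b)"
proof -
  define p where "p = (s - t) * (a + b)"
  define w where "w = (s + t) * (a - b)"
  have "(a + b)\<^sup>2 \<le> 2\<^sup>2" using assms by (intro power_mono) auto
  then have p: "p\<^sup>2 \<le> (s - t)\<^sup>2 * 4" unfolding p_def power_mult_distrib by (intro mult_left_mono) auto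
  have "(s + t)\<^sup>2 \<le> 2 * (s\<^sup>2 + t\<^sup>2)" using sum_squares_bound[of s t] by (simp add: power2_sum)
  then have w: "w\<^sup>2 \<le> 2 * (s\<^sup>2 + t\<^sup>2) * (a - b)\<^sup>2" unfolding w_def power_mult_distrib by (intro mult_right_mono) auto
  have "(a - b) * (s\<^sup>2 * a - t\<^sup>2 * b) = 1 / 2 * (s\<^sup>2 + t\<^sup>2) * (a - b)\<^sup>2 + 1 / 2 * p * w"
    by (simp add: p_def w_def power2_eq_square field_simps)
  moreover have "1 / 2 * p * w = 1 / 2 * (p + w / 2)\<^sup>2 - 1 / 2 * p\<^sup>2 - w\<^sup>2 / 8"
    by (simp add: power2_eq_square field_simps)
  moreover have "0 \<le> 1 / 2 * (p + w / 2)\<^sup>2" by simp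
  ultimately show ?thesis using p w by linarith
qed

text \<open>Testing with f^2 g needs the bound on \<open>g - K g\<close> only where \<open>g\<close>
  does not vanish. Summed over pairs, the product rule turns the tested form into a multiple of the
  weighted energy minus a multiple of the energy of \<open>f\<close>.\<close>

lemma potential_energy_le:
  assumes U: "finite U" "D \<subseteq> U" and g: "\<And>y. 0 \<le> g y" "\<And>y. g y \<le> 1" "\<And>y. y \<notin> D \<Longrightarrow> g y = 0"
    and \<epsilon>: "0 \<le> \<epsilon>" "\<And>y. y \<in> D \<Longrightarrow> g y - K g y \<le> \<epsilon>"
  shows "weighted_energy U k f g \<le> 4 * dirichlet U k f + 2 * \<epsilon> * (\<Sum>y\<in>U. (f y)\<^sup>2 * m y)"
proof -
  define w where "w = (\<lambda>y z. k y z * m z * m y)"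
  have w: "0 \<le> w y z" "w y z = w z y" for y z
    by (auto simp: w_def k_nonneg m_nonneg k_sym[of y z])
  have Kg: "K g y = (\<Sum>z\<in>U. k y z * g z * m z)" for y
    by (rule kernel_op_finite[OF U(1)]) (use U(2) g(3) in auto)
  have "1 / 2 * (\<Sum>y\<in>U. \<Sum>z\<in>U. (g y - g z) * ((f y)\<^sup>2 * g y - (f z)\<^sup>2 * g z) * w y z)
      \<le> (\<Sum>y\<in>U. (f y)\<^sup>2 * g y * (g y - K g y) * m y)"
    unfolding w_def Kg by (intro dirichlet_form_le k_substochastic k_sym U) (use g in auto)
  also have "\<dots> \<le> (\<Sum>y\<in>U. \<epsilon> * ((f y)\<^sup>2 * m y))"
  proof (rule sum_mono)
    fix y
    have "g y * (g y - K g y) \<le> \<epsilon>"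
    proof (cases "y \<in> D")
      case True
      have "g y * (g y - K g y) \<le> g y * \<epsilon>" using \<epsilon>(2)[OF True] g by (intro mult_left_mono) auto
      also have "\<dots> \<le> 1 * \<epsilon>" using g \<epsilon> by (intro mult_right_mono) auto
      finally show ?thesis by simp
    qed (use g(3) \<epsilon> in auto)
    then have "((f y)\<^sup>2 * m y) * (g y * (g y - K g y)) \<le> ((f y)\<^sup>2 * m y) * \<epsilon>"
      by (intro mult_left_mono) (auto simp: m_nonneg)
    then show "(f y)\<^sup>2 * g y * (g y - K g y) * m y \<le> \<epsilon> * ((f y)\<^sup>2 * m y)"
      by (simp add: mult_ac)
  qed
  finally have upper: "1 / 2 * (\<Sum>y\<in>U. \<Sum>z\<in>U. (g y - g z) * ((f y)\<^sup>2 * g y - (f z)\<^sup>2 * g z) * w y z)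
      \<le> \<epsilon> * (\<Sum>y\<in>U. (f y)\<^sup>2 * m y)" by (simp add: sum_distrib_left)
  have "(\<Sum>y\<in>U. \<Sum>z\<in>U. 1 / 4 * ((f y)\<^sup>2 * (g y - g z)\<^sup>2 * w y z + (f z)\<^sup>2 * (g z - g y)\<^sup>2 * w z y)
        - 2 * ((f y - f z)\<^sup>2 * w y z))
      \<le> (\<Sum>y\<in>U. \<Sum>z\<in>U. (g y - g z) * ((f y)\<^sup>2 * g y - (f z)\<^sup>2 * g z) * w y z)"
  proof (intro sum_mono)
    fix y z
    have "(1 / 4 * ((f y)\<^sup>2 + (f z)\<^sup>2) * (g y - g z)\<^sup>2 - 2 * (f y - f z)\<^sup>2) * w y z
        \<le> (g y - g z) * ((f y)\<^sup>2 * g y - (f z)\<^sup>2 * g z) * w y z"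
      by (intro mult_right_mono product_rule_lower g w)
    then show "1 / 4 * ((f y)\<^sup>2 * (g y - g z)\<^sup>2 * w y z + (f z)\<^sup>2 * (g z - g y)\<^sup>2 * w z y)
        - 2 * ((f y - f z)\<^sup>2 * w y z) \<le> (g y - g z) * ((f y)\<^sup>2 * g y - (f z)\<^sup>2 * g z) * w y z"
      by (simp add: w(2)[of z y] power2_commute[of "g z" "g y"] algebra_simps)
  qed
  also have "(\<Sum>y\<in>U. \<Sum>z\<in>U. 1 / 4 * ((f y)\<^sup>2 * (g y - g z)\<^sup>2 * w y z + (f z)\<^sup>2 * (g z - g y)\<^sup>2 * w z y)
        - 2 * ((f y - f z)\<^sup>2 * w y z))
      = 1 / 4 * (\<Sum>y\<in>U. \<Sum>z\<in>U. (f y)\<^sup>2 * (g y - g z)\<^sup>2 * w y z + (f z)\<^sup>2 * (g z - g y)\<^sup>2 * w z y)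
        - 2 * (\<Sum>y\<in>U. \<Sum>z\<in>U. (f y - f z)\<^sup>2 * w y z)"
    by (simp only: sum_subtractf sum_distrib_left)
  also have "\<dots> = weighted_energy U k f g - 4 * dirichlet U k f"
    using sum_symmetrize[of "\<lambda>y z. (f y)\<^sup>2 * (g y - g z)\<^sup>2 * w y z" U]
    by (simp add: weighted_energy_def dirichlet_def w_def)
  finally show ?thesis using upper by linarith
qed

text \<open>Since K 1 = 1, passing from the averaged exit probability v to 1 - v only changes the
  sign of v - K v. Where a ball of radius \<rho> fits into \<open>D\<close>, v is at most its last
  member, which the condition on \<open>N\<close> bounds by 1/2.\<close>

lemma exit_bounded_imp_potential:
  assumes C: "exit_bounded C" and N: "1 \<le> N" "2 * C * real N * \<rho> powr (- \<beta>) \<le> 1" and \<rho>: "0 < \<rho>"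
  obtains g where "\<And>y. 0 \<le> g y" "\<And>y. g y \<le> 1" "\<And>y. y \<notin> D \<Longrightarrow> g y = 0"
    "\<And>y. y \<in> D \<Longrightarrow> g y - K g y \<le> 1 / real N" "\<And>y. ball\<^sub>E y \<rho> \<subseteq> D \<Longrightarrow> 1 / 2 \<le> g y"
proof -
  define v where "v = (\<lambda>y. (\<Sum>l<N. exit_prob M k D l y) / real N)"
  have N0: "0 < real N" using N by simp
  have v_le: "v y \<le> exit_prob M k D N y" for y
  proof -
    have "(\<Sum>l<N. exit_prob M k D l y) \<le> real (card {..<N}) * exit_prob M k D N y"
      by (intro sum_bounded_above exit_prob_mono k_substochastic) auto
    then show ?thesis using N0 by (simp add: v_def field_simps)
  qed
  have v0: "0 \<le> v y" for y
    unfolding v_def by (intro divide_nonneg_nonneg sum_nonneg exit_prob_nonneg k_substochastic) auto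
  have v1: "v y \<le> 1" for y
    using v_le[of y] exit_prob_le_1[OF k_substochastic, of D N y] by linarith
  show ?thesis
  proof (rule that[of "\<lambda>y. 1 + -1 * v y"])
    fix y
    show "0 \<le> 1 + -1 * v y" "1 + -1 * v y \<le> 1" using v0 v1 by auto
    show "1 + -1 * v y = 0" if "y \<notin> D" using that N0 by (simp add: v_def)
    show "1 / 2 \<le> 1 + -1 * v y" if "ball\<^sub>E y \<rho> \<subseteq> D"
    proof -
      have "v y \<le> exit_prob M k (ball\<^sub>E y \<rho>) N y"
        using v_le exit_prob_antimono[OF k_substochastic that] order_trans by blast
      also have "\<dots> \<le> C * real N * \<rho> powr (- \<beta>)" using C \<rho> by (auto simp: exit_bounded_def)
      finally show ?thesis using N(2) by linarith
    qed
    show "1 + -1 * v y - K (\<lambda>y. 1 + -1 * v y) y \<le> 1 / real N" if "y \<in> D"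
    proof -
      have vb: "bounded (range v)" by (rule bounded_rangeI[of _ 1]) (use v0 v1 in auto)
      have "K (\<lambda>y. 1 + -1 * v y) y = 1 - K v y"
        using kernel_op_add[OF k_substochastic _ bounded_range_cmult[OF vb], of "\<lambda>_. 1" "-1" y]
          kernel_op_cmult[of M k "-1" v y] by (simp add: kernel_op_const[OF k])
      moreover have "v y - K v y = - exit_prob M k D N y / real N"
        unfolding v_def by (rule exit_prob_average[OF k_substochastic N(1) that])
      moreover have "exit_prob M k D N y / real N \<le> 1 / real N"
        using exit_prob_le_1[OF k_substochastic] by (intro divide_right_mono) auto
      ultimately show ?thesis by simp
    qed
  qed
qed

text \<open>For each \<open>y\<close> the inner sum is part of the jump tail at \<open>y\<close>.
  This is how pairs of distant points are paid for, by r^(-\<beta>) times a squared norm.\<close>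

lemma sum_tail_le:
  assumes "\<And>x r. 0 < r \<Longrightarrow> K (indicator (- ball\<^sub>E x r)) x \<le> C\<^sub>T * r powr (- \<beta>)" "0 < r" "finite U"
  shows "(\<Sum>y\<in>S. \<Sum>z\<in>U. (f y)\<^sup>2 * indicator (- ball\<^sub>E y r) z * (k y z * m z * m y))
    \<le> C\<^sub>T * r powr (- \<beta>) * (\<Sum>y\<in>S. (f y)\<^sup>2 * m y)"
proof -
  have "(\<Sum>z\<in>U. (f y)\<^sup>2 * indicator (- ball\<^sub>E y r) z * (k y z * m z * m y))
      \<le> C\<^sub>T * r powr (- \<beta>) * ((f y)\<^sup>2 * m y)" for y
  proof -
    have "(\<Sum>z\<in>U. k y z * indicator (- ball\<^sub>E y r) z * m z) \<le> K (indicator (- ball\<^sub>E y r)) y"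
      by (intro sum_le_kernel_op k_substochastic assms bounded_range_indicator) auto
    also have "\<dots> \<le> C\<^sub>T * r powr (- \<beta>)" by (intro assms)
    finally have "((f y)\<^sup>2 * m y) * (\<Sum>z\<in>U. k y z * indicator (- ball\<^sub>E y r) z * m z)
        \<le> ((f y)\<^sup>2 * m y) * (C\<^sub>T * r powr (- \<beta>))"
      by (intro mult_left_mono) (auto simp: m_nonneg)
    then show ?thesis by (simp add: sum_distrib_left mult_ac)
  qed
  then show ?thesis unfolding sum_distrib_left by (intro sum_mono)
qed

lemma exit_bounded_imp_cutoff_inequality:
  assumes C: "exit_bounded C"
  obtains C\<^sub>1 C\<^sub>2 where "cutoff_inequality C\<^sub>1 C\<^sub>2"
proof -
  have C0: "0 < C" using C by (simp add: exit_bounded_def)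
  obtain C\<^sub>T where CT: "C\<^sub>T \<ge> 1" and tail: "\<And>x r. 0 < r \<Longrightarrow> K (indicator (- ball\<^sub>E x r)) x \<le> C\<^sub>T * r powr (- \<beta>)"
    using tail_bound by blast
  \<comment> \<open>Makes any N \<le> \<delta> r^\<beta> satisfy 2 C N (r/10)^(-\<beta>) \<le> 1;
    r/10 is the margin on both sides of the zone where the potential has to be at least 1/2.\<close>
  define \<delta> where "\<delta> = 1 / (2 * C * 10 powr \<beta>)"
  have \<delta>: "0 < \<delta>" using C0 by (simp add: \<delta>_def)
  \<comment> \<open>One summand per source: small r, the potential through 8/N \<le> (16/\<delta>)
    r^(-\<beta>), and jumps longer than r/5.\<close>
  define C\<^sub>2 where "C\<^sub>2 = 1 / \<delta> + 16 / \<delta> + C\<^sub>T * 5 powr \<beta>"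
  have C2: "0 < C\<^sub>2" using \<delta> CT by (simp add: C\<^sub>2_def add_pos_pos)
  have "cutoff_inequality 16 C\<^sub>2"
    unfolding cutoff_inequality_def
  proof (intro conjI allI impI C2)
    fix x and R r :: real assume Rr: "0 < R" "0 < r"
    define U where "U = annulus x R r"
    have fU: "finite U" by (simp add: U_def finite_annulus)
    have V0: "0 \<le> (\<Sum>y\<in>U. (f y)\<^sup>2 * m y)" for f by (intro sum_nonneg) (simp add: m_nonneg)
    have D0: "0 \<le> dirichlet U k f" for f
      unfolding dirichlet_def by (intro mult_nonneg_nonneg sum_nonneg) (auto simp: k_nonneg m_nonneg)
    show "\<exists>\<phi>. (\<forall>y. 0 \<le> \<phi> y \<and> \<phi> y \<le> 1) \<and>
        (\<forall>y\<in>ball\<^sub>E x (R + r / 2). \<phi> y = 1) \<and> (\<forall>y\<in>- ball\<^sub>E x (R + 9 * r / 10). \<phi> y = 0) \<and>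
        (\<forall>f. weighted_energy (annulus x R r) k f \<phi> \<le> 16 * dirichlet (annulus x R r) k f
               + C\<^sub>2 * r powr (- \<beta>) * (\<Sum>y\<in>annulus x R r. (f y)\<^sup>2 * m y))"
    proof (cases "\<delta> * r powr \<beta> \<ge> 1")
      case True
      define N where "N = nat \<lfloor>\<delta> * r powr \<beta>\<rfloor>"
      have N: "1 \<le> N" "real N \<le> \<delta> * r powr \<beta>" "\<delta> * r powr \<beta> \<le> 2 * real N"
      proof -
        have "1 \<le> \<lfloor>\<delta> * r powr \<beta>\<rfloor>" using True by simp
        then have "1 \<le> real_of_int \<lfloor>\<delta> * r powr \<beta>\<rfloor>" "real N = real_of_int \<lfloor>\<delta> * r powr \<beta>\<rfloor>"
          by (simp_all add: N_def)
        moreover have "real_of_int \<lfloor>\<delta> * r powr \<beta>\<rfloor> \<le> \<delta> * r powr \<beta>"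
          "\<delta> * r powr \<beta> < real_of_int \<lfloor>\<delta> * r powr \<beta>\<rfloor> + 1"
          by linarith+
        ultimately show "1 \<le> N" "real N \<le> \<delta> * r powr \<beta>" "\<delta> * r powr \<beta> \<le> 2 * real N"
          by linarith+
      qed
      have r10: "(r / 10) powr (- \<beta>) = 10 powr \<beta> * r powr (- \<beta>)"
        by (simp add: powr_divide powr_minus_divide)
      have rr: "r powr \<beta> * r powr (- \<beta>) = 1" using Rr by (simp add: powr_add[symmetric])
      have "2 * C * real N * (r / 10) powr (- \<beta>) \<le> 2 * C * (\<delta> * r powr \<beta>) * (r / 10) powr (- \<beta>)"
        using C0 N by (intro mult_right_mono mult_left_mono) auto
      also have "\<dots> = (2 * C * 10 powr \<beta> * \<delta>) * (r powr \<beta> * r powr (- \<beta>))"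
        unfolding r10 by (simp add: mult_ac)
      also have "\<dots> = 1" unfolding rr using C0 by (simp add: \<delta>_def)
      finally have N': "2 * C * real N * (r / 10) powr (- \<beta>) \<le> 1" .
      define D where "D = ball\<^sub>E x (R + 9 * r / 10) - ball\<^sub>E x (R + r / 2)"
      have DU: "D \<subseteq> U" using Rr by (auto simp: D_def U_def annulus_def mem_ball)
      obtain g where g: "\<And>y. 0 \<le> g y" "\<And>y. g y \<le> 1" "\<And>y. y \<notin> D \<Longrightarrow> g y = 0"
        "\<And>y. y \<in> D \<Longrightarrow> g y - K g y \<le> 1 / real N"
        and g_mid: "\<And>y. ball\<^sub>E y (r / 10) \<subseteq> D \<Longrightarrow> 1 / 2 \<le> g y"
        using exit_bounded_imp_potential[OF C N(1) N', of D] Rr by auto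
      \<comment> \<open>Between R + 6r/10 and R + 8r/10 both formulas give 1. The change of formula
        at R + 7r/10 is thus noticed only by pairs that straddle this whole zone, at distance more
        than r/5; other pairs have equal values or fall under the contraction
        \<open>min_one_diff_le\<close>.\<close>
      define \<phi> where "\<phi> = (\<lambda>y. if dist\<^sub>E x y \<le> R + 7 * r / 10 then 1 else min 1 (2 * g y))"
      have mid: "1 \<le> 2 * g y" if "R + 6 * r / 10 < dist\<^sub>E x y" "dist\<^sub>E x y \<le> R + 8 * r / 10" for y
      proof -
        have "ball\<^sub>E y (r / 10) \<subseteq> D"
        proof
          fix z assume "z \<in> ball\<^sub>E y (r / 10)"
          then show "z \<in> D" using that dist_triangle_real[of x z y] dist_triangle_real[of x y z]
              dist_commute[of y z] by (auto simp: D_def mem_ball)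
        qed
        then show ?thesis using g_mid by fastforce
      qed
      have half: "(\<phi> y - \<phi> z)\<^sup>2 \<le> 4 * (g y - g z)\<^sup>2 + indicator (- ball\<^sub>E y (r / 5)) z"
        if yz: "dist\<^sub>E x y \<le> dist\<^sub>E x z" for y z
      proof -
        consider "dist\<^sub>E x z \<le> R + 7 * r / 10" | "R + 7 * r / 10 < dist\<^sub>E x y"
          | "dist\<^sub>E x y \<le> R + 7 * r / 10" "R + 7 * r / 10 < dist\<^sub>E x z" "dist\<^sub>E x z \<le> R + 8 * r / 10"
          | "dist\<^sub>E x y \<le> R + 6 * r / 10" "R + 8 * r / 10 < dist\<^sub>E x z"
          | "R + 6 * r / 10 < dist\<^sub>E x y" "dist\<^sub>E x y \<le> R + 7 * r / 10" "R + 8 * r / 10 < dist\<^sub>E x z"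
          by linarith
        then show ?thesis
        proof cases
          case 1
          then show ?thesis using yz by (simp add: \<phi>_def)
        next
          case 2
          then have "\<phi> y = min 1 (2 * g y)" "\<phi> z = min 1 (2 * g z)"
            using yz by (auto simp: \<phi>_def)
          then have "(\<phi> y - \<phi> z)\<^sup>2 \<le> (2 * g y - 2 * g z)\<^sup>2" by (simp only: min_one_diff_le)
          also have "\<dots> = 4 * (g y - g z)\<^sup>2" by (simp add: power2_eq_square algebra_simps)
          finally show ?thesis by (rule order_trans) simp
        next
          case 3
          then have "\<phi> y = 1" "\<phi> z = 1" using mid[of z] Rr by (auto simp: \<phi>_def)
          then show ?thesis by simp
        next
          case 4
          then have "z \<in> - ball\<^sub>E y (r / 5)"
            using dist_triangle_real[of x z y] Rr by (auto simp: mem_ball)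
          moreover have "\<phi> y = 1" "0 \<le> \<phi> z" "\<phi> z \<le> 1"
            using 4 Rr g(1)[of z] by (auto simp: \<phi>_def)
          then have "(\<phi> y - \<phi> z)\<^sup>2 \<le> 1" by (simp add: power_le_one)
          ultimately show ?thesis by (simp add: add_increasing)
        next
          case 5
          have "1 \<le> 2 * g y" using 5 Rr by (intro mid) auto
          then have "\<phi> y = min 1 (2 * g y)" "\<phi> z = min 1 (2 * g z)"
            using 5 Rr by (auto simp: \<phi>_def)
          then have "(\<phi> y - \<phi> z)\<^sup>2 \<le> (2 * g y - 2 * g z)\<^sup>2" by (simp only: min_one_diff_le)
          also have "\<dots> = 4 * (g y - g z)\<^sup>2" by (simp add: power2_eq_square algebra_simps)
          finally show ?thesis by (rule order_trans) simp
        qed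
      qed
      have diff: "(\<phi> y - \<phi> z)\<^sup>2 \<le> 4 * (g y - g z)\<^sup>2 + indicator (- ball\<^sub>E y (r / 5)) z" for y z
      proof (cases "dist\<^sub>E x y \<le> dist\<^sub>E x z")
        case False
        then show ?thesis using half[of z y]
          by (simp add: power2_commute[of "\<phi> z"] power2_commute[of "g z"] dist_commute[of z y] indicator_def mem_ball)
      qed (rule half)
      have ineq: "weighted_energy U k f \<phi> \<le> 16 * dirichlet U k f + C\<^sub>2 * r powr (- \<beta>) * (\<Sum>y\<in>U. (f y)\<^sup>2 * m y)" for f
      proof -
        let ?T = "\<Sum>y\<in>U. \<Sum>z\<in>U. (f y)\<^sup>2 * indicator (- ball\<^sub>E y (r / 5)) z * (k y z * m z * m y)"
        let ?V = "\<Sum>y\<in>U. (f y)\<^sup>2 * m y"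
        have "weighted_energy U k f \<phi> \<le> 1 / 2 * (\<Sum>y\<in>U. \<Sum>z\<in>U. (f y)\<^sup>2 *
            (4 * (g y - g z)\<^sup>2 + indicator (- ball\<^sub>E y (r / 5)) z) * (k y z * m z * m y))"
          unfolding weighted_energy_def
          by (intro mult_left_mono sum_mono mult_right_mono diff mult_nonneg_nonneg k_nonneg m_nonneg) auto
        also have "\<dots> = 4 * weighted_energy U k f g + 1 / 2 * ?T"
          by (simp add: weighted_energy_def distrib_left distrib_right sum.distrib sum_distrib_left mult_ac)
        also have "\<dots> \<le> 4 * (4 * dirichlet U k f + 2 * (1 / real N) * ?V) + 1 / 2 * (C\<^sub>T * (r / 5) powr (- \<beta>) * ?V)"
          using Rr by (intro add_mono mult_left_mono potential_energy_le[OF fU DU g(1-3) _ g(4)] sum_tail_le tail fU) auto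
        also have "\<dots> = 16 * dirichlet U k f + (8 * (1 / real N) + 1 / 2 * C\<^sub>T * (r / 5) powr (- \<beta>)) * ?V"
          by (simp add: algebra_simps)
        also have "\<dots> \<le> 16 * dirichlet U k f + (C\<^sub>2 * r powr (- \<beta>)) * ?V"
        proof (intro add_left_mono mult_right_mono V0)
          have "1 / real N \<le> 2 / (\<delta> * r powr \<beta>)"
            using N True by (simp add: field_simps)
          also have "\<dots> = 2 / \<delta> * r powr (- \<beta>)" by (simp add: powr_minus_divide)
          finally have "8 * (1 / real N) \<le> 16 / \<delta> * r powr (- \<beta>)" by simp
          moreover have "1 / 2 * C\<^sub>T * (r / 5) powr (- \<beta>) \<le> C\<^sub>T * 5 powr \<beta> * r powr (- \<beta>)"
          proof -
            have "(r / 5) powr (- \<beta>) = 5 powr \<beta> * r powr (- \<beta>)"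
              by (simp add: powr_divide powr_minus_divide)
            moreover have "0 \<le> C\<^sub>T * (r / 5) powr (- \<beta>)" using CT by simp
            ultimately show ?thesis by (simp add: mult_ac)
          qed
          moreover have "0 \<le> 1 / \<delta> * r powr (- \<beta>)" using \<delta> by simp
          ultimately show "8 * (1 / real N) + 1 / 2 * C\<^sub>T * (r / 5) powr (- \<beta>) \<le> C\<^sub>2 * r powr (- \<beta>)"
            unfolding C\<^sub>2_def distrib_right by linarith
        qed
        finally show ?thesis .
      qed
      show ?thesis
      proof (intro exI[of _ \<phi>] conjI allI)
        show "0 \<le> \<phi> y" "\<phi> y \<le> 1" for y using g(1)[of y] by (auto simp: \<phi>_def)
        show "\<forall>y\<in>ball\<^sub>E x (R + r / 2). \<phi> y = 1" using Rr by (auto simp: \<phi>_def mem_ball)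
        show "\<forall>y\<in>- ball\<^sub>E x (R + 9 * r / 10). \<phi> y = 0"
          using Rr g(3) by (auto simp: \<phi>_def mem_ball D_def)
      qed (use ineq in \<open>simp add: U_def\<close>)
    next
      case False
      \<comment> \<open>Here 1 < (1/\<delta>) r^(-\<beta>), so the trivial bound 1 on the squared
        differences is good enough.\<close>
      define \<phi> where "\<phi> = (indicator (ball\<^sub>E x (R + r / 2)) :: 'a \<Rightarrow> real)"
      have ineq: "weighted_energy U k f \<phi> \<le> 16 * dirichlet U k f + C\<^sub>2 * r powr (- \<beta>) * (\<Sum>y\<in>U. (f y)\<^sup>2 * m y)" for f
      proof -
        let ?V = "\<Sum>y\<in>U. (f y)\<^sup>2 * m y"
        have sq: "(\<phi> y - \<phi> z)\<^sup>2 \<le> 1" for y z by (simp add: \<phi>_def indicator_def)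
        have "weighted_energy U k f \<phi> \<le> 1 / 2 * (\<Sum>y\<in>U. \<Sum>z\<in>U. (f y)\<^sup>2 * 1 * (k y z * m z * m y))"
          unfolding weighted_energy_def
          by (intro mult_left_mono sum_mono mult_right_mono sq mult_nonneg_nonneg k_nonneg m_nonneg) auto
        also have "\<dots> = 1 / 2 * (\<Sum>y\<in>U. (f y)\<^sup>2 * m y * (\<Sum>z\<in>U. k y z * m z))"
          by (simp add: sum_distrib_left mult_ac)
        also have "\<dots> \<le> 1 / 2 * (\<Sum>y\<in>U. (f y)\<^sup>2 * m y * 1)"
          by (intro mult_left_mono sum_mono substochastic_sum_le k_substochastic fU) (auto simp: m_nonneg)
        also have "\<dots> \<le> C\<^sub>2 * r powr (- \<beta>) * ?V"
        proof -
          have "1 \<le> 1 / \<delta> * r powr (- \<beta>)"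
            using False \<delta> Rr by (simp add: powr_minus_divide field_simps)
          also have "\<dots> \<le> C\<^sub>2 * r powr (- \<beta>)"
          proof (rule mult_right_mono)
            have "0 \<le> 16 / \<delta>" "0 \<le> C\<^sub>T * 5 powr \<beta>" using \<delta> CT by auto
            then show "1 / \<delta> \<le> C\<^sub>2" unfolding C\<^sub>2_def by linarith
          qed simp
          finally have "1 * ?V \<le> C\<^sub>2 * r powr (- \<beta>) * ?V" using V0 by (rule mult_right_mono)
          then show ?thesis using V0[of f] by simp
        qed
        finally show ?thesis using D0[of f] by simp
      qed
      show ?thesis
      proof (intro exI[of _ \<phi>] conjI allI)
        show "\<forall>y\<in>- ball\<^sub>E x (R + 9 * r / 10). \<phi> y = 0"
          using Rr by (auto simp: \<phi>_def mem_ball indicator_def)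
      qed (use ineq in \<open>auto simp: U_def \<phi>_def indicator_def\<close>)
    qed
  qed simp
  then show ?thesis by (rule that)
qed

end

subsection \<open>The cutoff inequality implies exit estimates\<close>

text \<open>The weight h^\<beta> on \<open>f\<close> at distance h from the outer radius makes the
  error term scale-free. Going from h to \<sigma>h multiplies the weighted supremum by \<theta>
  \<sigma>^(-\<beta>), and \<sigma>^\<beta> = (1+\<theta>)/2 keeps this below 1, so the supremum can
  be absorbed. \<open>Z\<close> only ensures that the supremum is finite; \<open>C\<close> does not
  depend on it.\<close>

lemma hole_filling:
  fixes \<theta> \<beta> :: real
  assumes \<theta>: "0 < \<theta>" "\<theta> < 1" and \<beta>: "0 < \<beta>"
  obtains C where "0 < C" "\<And>f R H A Z. 0 < H \<Longrightarrow> 0 \<le> A \<Longrightarrow> (\<And>t. 0 \<le> f t \<and> f t \<le> Z) \<Longrightarrow>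
    (\<And>t h. R \<le> t \<Longrightarrow> 0 < h \<Longrightarrow> t + h \<le> R + H \<Longrightarrow> f t \<le> \<theta> * f (t + h) + A * h powr (- \<beta>)) \<Longrightarrow>
    f R \<le> C * A * H powr (- \<beta>)"
proof -
  define \<sigma> where "\<sigma> = ((1 + \<theta>) / 2) powr (1 / \<beta>)"
  define \<theta>' where "\<theta>' = \<theta> * \<sigma> powr (- \<beta>)"
  have \<sigma>: "0 < \<sigma>" "\<sigma> < 1"
    using \<theta> \<beta> powr_less_mono2[of "1 / \<beta>" "(1 + \<theta>) / 2" 1] by (auto simp: \<sigma>_def)
  have "\<sigma> powr (- \<beta>) = 2 / (1 + \<theta>)"
    using \<theta> \<beta> by (simp add: \<sigma>_def powr_powr powr_minus)
  then have eq: "\<theta>' = 2 * \<theta> / (1 + \<theta>)" by (simp add: \<theta>'_def)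
  have \<theta>': "0 < \<theta>'" "\<theta>' < 1" unfolding eq using \<theta> by (auto simp: divide_less_eq)
  define C where "C = (1 - \<sigma>) powr (- \<beta>) / (1 - \<theta>')"
  have C: "0 < C" using \<sigma> \<theta>' by (simp add: C_def)
  show ?thesis
  proof (rule that[OF C])
    fix f :: "real \<Rightarrow> real" and R H A Z :: real
    assume H: "0 < H" and A: "0 \<le> A" and f: "\<And>t. 0 \<le> f t \<and> f t \<le> Z"
      and step: "\<And>t h. R \<le> t \<Longrightarrow> 0 < h \<Longrightarrow> t + h \<le> R + H \<Longrightarrow> f t \<le> \<theta> * f (t + h) + A * h powr (- \<beta>)"
    define F where "F = (\<lambda>h. h powr \<beta> * f (R + H - h))"
    have F_le: "F h \<le> H powr \<beta> * Z" if "0 < h" "h \<le> H" for h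
      unfolding F_def using that f \<beta> by (intro mult_mono powr_mono2) auto
    define S where "S = (SUP h\<in>{0<..H}. F h)"
    have bdd: "bdd_above (F ` {0<..H})" by (rule bdd_aboveI2[of _ _ "H powr \<beta> * Z"]) (use F_le in auto)
    have le_S: "F h \<le> S" if "0 < h" "h \<le> H" for h
      unfolding S_def by (rule cSUP_upper[OF _ bdd]) (use that in auto)
    have "S \<le> \<theta>' * S + A * (1 - \<sigma>) powr (- \<beta>)"
      unfolding S_def
    proof (rule cSUP_least, unfold S_def[symmetric])
      fix h assume "h \<in> {0<..H}"
      then have h: "0 < h" "h \<le> H" by auto
      have "\<sigma> * h \<le> h" using \<sigma> h by simp
      then have \<sigma>h: "0 < \<sigma> * h" "\<sigma> * h \<le> H"
        using \<sigma> h by (simp, linarith)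
      have "f (R + H - h) \<le> \<theta> * f (R + H - h + (1 - \<sigma>) * h) + A * ((1 - \<sigma>) * h) powr (- \<beta>)"
        using \<sigma> h \<sigma>h by (intro step) (auto simp: algebra_simps)
      then have "F h \<le> h powr \<beta> * (\<theta> * f (R + H - \<sigma> * h) + A * ((1 - \<sigma>) * h) powr (- \<beta>))"
        unfolding F_def by (intro mult_left_mono) (auto simp: algebra_simps)
      also have "\<dots> = \<theta> * (h powr \<beta> * f (R + H - \<sigma> * h)) + A * (1 - \<sigma>) powr (- \<beta>) * (h powr \<beta> * h powr (- \<beta>))"
        by (simp only: powr_mult) (simp add: algebra_simps)
      also have "h powr \<beta> * h powr (- \<beta>) = 1" using h by (simp add: powr_add[symmetric])
      also have "h powr \<beta> * f (R + H - \<sigma> * h) = \<sigma> powr (- \<beta>) * F (\<sigma> * h)"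
        using \<sigma> h by (simp add: F_def powr_mult powr_minus_divide)
      also have "\<theta> * (\<sigma> powr (- \<beta>) * F (\<sigma> * h)) \<le> \<theta>' * S"
        unfolding \<theta>'_def mult.assoc[symmetric] using \<theta> by (intro mult_left_mono le_S \<sigma>h) auto
      finally show "F h \<le> \<theta>' * S + A * (1 - \<sigma>) powr (- \<beta>)" by simp
    qed (use H in auto)
    then have "S \<le> C * A" using \<theta>' by (simp add: C_def field_simps)
    then have "F H \<le> C * A" using le_S[of H] H by simp
    then have "H powr \<beta> * f R * H powr (- \<beta>) \<le> C * A * H powr (- \<beta>)"
      unfolding F_def by (intro mult_right_mono) auto
    moreover have "H powr \<beta> * H powr (- \<beta>) = 1" using H by (simp add: powr_add[symmetric])
    ultimately show "f R \<le> C * A * H powr (- \<beta>)" by (simp add: mult.commute mult.left_commute)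
  qed
qed

section \<open>Energy decay for the truncated walk\<close>

context jump_walk
begin

text \<open>The mass of the long jumps is discarded and not put back on the diagonal, so a walk that
  attempts a jump longer than \<rho> dies.\<close>

definition trunc :: "real \<Rightarrow> 'a \<Rightarrow> 'a \<Rightarrow> real" where
  "trunc \<rho> y z = k y z * indicator (ball\<^sub>E y \<rho>) z"

lemma trunc_nonneg: "0 \<le> trunc \<rho> y z"
  and trunc_le: "trunc \<rho> y z \<le> k y z"
  and trunc_sym: "trunc \<rho> y z = trunc \<rho> z y"
  using k_nonneg[of y z] k_sym[of y z] dist_commute[of y z]
  by (auto simp: trunc_def indicator_def mem_ball)

lemma trunc_substochastic: "substochastic M (trunc \<rho>)"
  by (rule substochastic_mono[OF k_substochastic trunc_nonneg trunc_le])

lemma dirichlet_nonneg: "(\<And>y z. 0 \<le> q y z) \<Longrightarrow> 0 \<le> dirichlet U q f"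
  unfolding dirichlet_def by (intro mult_nonneg_nonneg sum_nonneg) (auto simp: m_nonneg)

text \<open>Interactions between \<open>A\<close> and \<open>B\<close> are nonnegative and are
  dropped. For a ball and the annulus around it this bounds the annulus energy by a difference of
  ball energies, the form that hole filling needs.\<close>

lemma dirichlet_Un:
  assumes q: "\<And>y z. 0 \<le> q y z" and fin: "finite A" "finite B" "A \<inter> B = {}"
  shows "dirichlet A q f + dirichlet B q f \<le> dirichlet (A \<union> B) q f"
proof -
  let ?w = "\<lambda>y z. (f y - f z)\<^sup>2 * (q y z * m z * m y)"
  have w: "0 \<le> ?w y z" for y z using q m_nonneg by simp
  have "(\<Sum>y\<in>A \<union> B. \<Sum>z\<in>A \<union> B. ?w y z)
      = (\<Sum>y\<in>A. \<Sum>z\<in>A \<union> B. ?w y z) + (\<Sum>y\<in>B. \<Sum>z\<in>A \<union> B. ?w y z)"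
    by (rule sum.union_disjoint[OF fin])
  also have "\<dots> \<ge> (\<Sum>y\<in>A. \<Sum>z\<in>A. ?w y z) + (\<Sum>y\<in>B. \<Sum>z\<in>B. ?w y z)"
    by (intro add_mono sum_mono sum_mono2) (use fin w in auto)
  finally show ?thesis by (simp add: dirichlet_def)
qed

lemma dirichlet_mono:
  assumes q: "\<And>y z. 0 \<le> q y z" and fin: "finite B" "A \<subseteq> B"
  shows "dirichlet A q f \<le> dirichlet B q f"
  using dirichlet_Un[of q A "B - A" f, OF q] dirichlet_nonneg[of q "B - A" f, OF q] fin
    finite_subset[of A B] by (auto simp: Un_absorb1)

text \<open>Testing the inequality for \<open>v\<close> with \<open>\<phi>\<^sup>2 v\<close>.\<close>

lemma caccioppoli:
  assumes q: "substochastic M q" "\<And>y z. q y z = q z y" and W: "finite W"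
    and v: "\<And>y. 0 \<le> v y"
    and sub: "\<And>y. y \<in> W \<Longrightarrow> \<phi> y \<noteq> 0 \<Longrightarrow> v y - (\<Sum>z\<in>W. q y z * v z * m z) \<le> - \<epsilon> * v y"
  shows "dirichlet W q (\<lambda>y. \<phi> y * v y) + \<epsilon> * (\<Sum>y\<in>W. (\<phi> y * v y)\<^sup>2 * m y) \<le> weighted_energy W q v \<phi>"
proof -
  define w where "w = (\<lambda>y z. q y z * m z * m y)"
  have w: "0 \<le> w y z" "w y z = w z y" for y z
    using substochasticD(1)[OF q(1)] by (auto simp: w_def m_nonneg q(2)[of y z])
  have "1 / 2 * (\<Sum>y\<in>W. \<Sum>z\<in>W. (v y - v z) * ((\<phi> y)\<^sup>2 * v y - (\<phi> z)\<^sup>2 * v z) * w y z)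
      \<le> (\<Sum>y\<in>W. (\<phi> y)\<^sup>2 * v y * (v y - (\<Sum>z\<in>W. q y z * v z * m z)) * m y)"
    unfolding w_def by (intro dirichlet_form_le q W) (use v in auto)
  also have "\<dots> \<le> (\<Sum>y\<in>W. - \<epsilon> * ((\<phi> y * v y)\<^sup>2 * m y))"
  proof (rule sum_mono)
    fix y assume y: "y \<in> W"
    have "((\<phi> y)\<^sup>2 * v y * m y) * (v y - (\<Sum>z\<in>W. q y z * v z * m z)) \<le> ((\<phi> y)\<^sup>2 * v y * m y) * (- \<epsilon> * v y)"
    proof (cases "\<phi> y = 0")
      case False
      then show ?thesis using v m_nonneg by (intro mult_left_mono sub y) auto
    qed simp
    then show "(\<phi> y)\<^sup>2 * v y * (v y - (\<Sum>z\<in>W. q y z * v z * m z)) * m y \<le> - \<epsilon> * ((\<phi> y * v y)\<^sup>2 * m y)"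
      by (simp add: power2_eq_square mult_ac)
  qed
  finally have upper: "1 / 2 * (\<Sum>y\<in>W. \<Sum>z\<in>W. (v y - v z) * ((\<phi> y)\<^sup>2 * v y - (\<phi> z)\<^sup>2 * v z) * w y z)
      \<le> - \<epsilon> * (\<Sum>y\<in>W. (\<phi> y * v y)\<^sup>2 * m y)" by (simp add: sum_distrib_left)
  have "(\<Sum>y\<in>W. \<Sum>z\<in>W. (\<phi> y * v y - \<phi> z * v z)\<^sup>2 * w y z)
        - 1 / 2 * (\<Sum>y\<in>W. \<Sum>z\<in>W. (v y)\<^sup>2 * (\<phi> y - \<phi> z)\<^sup>2 * w y z + (v z)\<^sup>2 * (\<phi> z - \<phi> y)\<^sup>2 * w z y)
      = (\<Sum>y\<in>W. \<Sum>z\<in>W. (\<phi> y * v y - \<phi> z * v z)\<^sup>2 * w y z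
          - 1 / 2 * ((v y)\<^sup>2 * (\<phi> y - \<phi> z)\<^sup>2 * w y z + (v z)\<^sup>2 * (\<phi> z - \<phi> y)\<^sup>2 * w z y))"
    by (simp only: sum_subtractf sum_distrib_left)
  also have "\<dots> \<le> (\<Sum>y\<in>W. \<Sum>z\<in>W. (v y - v z) * ((\<phi> y)\<^sup>2 * v y - (\<phi> z)\<^sup>2 * v z) * w y z)"
  proof (intro sum_mono)
    fix y z
    \<comment> \<open>The remainder in this identity is a perfect square, so the energy of \<phi>v
      comes out with constant 1 and nothing has to be absorbed.\<close>
    have "(v y - v z) * ((\<phi> y)\<^sup>2 * v y - (\<phi> z)\<^sup>2 * v z)
        - ((\<phi> y * v y - \<phi> z * v z)\<^sup>2 - 1 / 2 * ((v y)\<^sup>2 + (v z)\<^sup>2) * (\<phi> y - \<phi> z)\<^sup>2)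
      = 1 / 2 * (v y - v z)\<^sup>2 * (\<phi> y - \<phi> z)\<^sup>2"
      by (simp add: power2_eq_square field_simps)
    also have "\<dots> \<ge> 0" by simp
    finally have "((\<phi> y * v y - \<phi> z * v z)\<^sup>2 - 1 / 2 * ((v y)\<^sup>2 + (v z)\<^sup>2) * (\<phi> y - \<phi> z)\<^sup>2) * w y z
        \<le> (v y - v z) * ((\<phi> y)\<^sup>2 * v y - (\<phi> z)\<^sup>2 * v z) * w y z"
      by (intro mult_right_mono w) simp
    then show "(\<phi> y * v y - \<phi> z * v z)\<^sup>2 * w y z
          - 1 / 2 * ((v y)\<^sup>2 * (\<phi> y - \<phi> z)\<^sup>2 * w y z + (v z)\<^sup>2 * (\<phi> z - \<phi> y)\<^sup>2 * w z y)
        \<le> (v y - v z) * ((\<phi> y)\<^sup>2 * v y - (\<phi> z)\<^sup>2 * v z) * w y z"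
      by (simp add: w(2)[of z y] power2_commute[of "\<phi> z" "\<phi> y"] algebra_simps)
  qed
  finally have "2 * dirichlet W q (\<lambda>y. \<phi> y * v y) - 2 * weighted_energy W q v \<phi>
      \<le> (\<Sum>y\<in>W. \<Sum>z\<in>W. (v y - v z) * ((\<phi> y)\<^sup>2 * v y - (\<phi> z)\<^sup>2 * v z) * w y z)"
    using sum_symmetrize[of "\<lambda>y z. (v y)\<^sup>2 * (\<phi> y - \<phi> z)\<^sup>2 * w y z" W]
    by (simp add: dirichlet_def weighted_energy_def w_def)
  with upper show ?thesis by simp
qed

text \<open>The Caccioppoli inequality with the cutoff for the annulus of width h. Pairs inside the
  annulus are handled by the cutoff inequality, stated for the full kernel, and returning to the
  truncated kernel costs the tail beyond \<rho>; pairs that leave the annulus while \<phi> changes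
  are more than h/10 apart. By h \<le> \<rho> all errors are of order h^(-\<beta>).\<close>

lemma energy_decay:
  assumes cut: "cutoff_inequality C\<^sub>1 C\<^sub>2"
  obtains C\<^sub>3 where "0 < C\<^sub>3" "\<And>x r v \<rho> \<epsilon> R h. 0 < \<rho> \<Longrightarrow> 0 < R \<Longrightarrow> 0 < h \<Longrightarrow> h \<le> \<rho> \<Longrightarrow> R + h \<le> r \<Longrightarrow>
     (\<And>y. 0 \<le> v y) \<Longrightarrow>
     (\<And>y. y \<in> ball\<^sub>E x r \<Longrightarrow> v y - kernel_op M (trunc \<rho>) v y \<le> - \<epsilon> * v y) \<Longrightarrow> 0 \<le> \<epsilon> \<Longrightarrow>
     dirichlet (ball\<^sub>E x R) (trunc \<rho>) v + \<epsilon> * (\<Sum>y\<in>ball\<^sub>E x R. (v y)\<^sup>2 * m y)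
       \<le> C\<^sub>1 * (dirichlet (ball\<^sub>E x (R + h)) (trunc \<rho>) v - dirichlet (ball\<^sub>E x R) (trunc \<rho>) v)
         + C\<^sub>3 * h powr (- \<beta>) * (\<Sum>y\<in>ball\<^sub>E x (R + h + \<rho>). (v y)\<^sup>2 * m y)"
proof -
  have C12: "0 < C\<^sub>1" "0 < C\<^sub>2" using cut by (auto simp: cutoff_inequality_def)
  obtain C\<^sub>T where CT: "C\<^sub>T \<ge> 1" and tail: "\<And>x r. 0 < r \<Longrightarrow> K (indicator (- ball\<^sub>E x r)) x \<le> C\<^sub>T * r powr (- \<beta>)"
    using tail_bound by blast
  define C\<^sub>3 where "C\<^sub>3 = C\<^sub>2 + C\<^sub>T * 10 powr \<beta> + C\<^sub>1 * C\<^sub>T"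
  have C3: "0 < C\<^sub>3" using C12 CT by (simp add: C\<^sub>3_def add_pos_pos)
  show ?thesis
  proof (rule that[OF C3])
    fix x v and r \<rho> \<epsilon> R h :: real
    assume pos: "0 < \<rho>" "0 < R" "0 < h" and h: "h \<le> \<rho>" "R + h \<le> r" and v: "\<And>y. 0 \<le> v y" and \<epsilon>: "0 \<le> \<epsilon>"
      and sub: "\<And>y. y \<in> ball\<^sub>E x r \<Longrightarrow> v y - kernel_op M (trunc \<rho>) v y \<le> - \<epsilon> * v y"
    define q where "q = trunc \<rho>"
    have q: "0 \<le> q y z" "q y z \<le> k y z" for y z by (auto simp: q_def trunc_nonneg trunc_le)
    \<comment> \<open>Truncated jumps from the support of \<phi> stay in \<open>W\<close>, so the
      operator at these points is a finite sum over \<open>W\<close>.\<close>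
    define W where "W = ball\<^sub>E x (R + h + \<rho>)"
    define U where "U = annulus x R h"
    define B where "B = ball\<^sub>E x R"
    have fin: "finite W" "finite U" "finite B" by (auto simp: W_def U_def B_def finite_ball finite_annulus)
    have BU: "B \<union> U = ball\<^sub>E x (R + h)" "B \<inter> U = {}" "U \<subseteq> W" "B \<subseteq> W"
      using pos ball_mono[of R "R + h" x] ball_mono[of "R + h" "R + h + \<rho>" x]
        ball_mono[of R "R + h + \<rho>" x]
      by (auto simp: B_def U_def W_def annulus_def)
    obtain \<phi> where \<phi>': "\<forall>y. 0 \<le> \<phi> y \<and> \<phi> y \<le> 1" "\<forall>y\<in>ball\<^sub>E x (R + h / 2). \<phi> y = 1"
      "\<forall>y\<in>- ball\<^sub>E x (R + 9 * h / 10). \<phi> y = 0"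
      and cs: "weighted_energy U k v \<phi> \<le> C\<^sub>1 * dirichlet U k v + C\<^sub>2 * h powr (- \<beta>) * (\<Sum>y\<in>U. (v y)\<^sup>2 * m y)"
      using cut pos unfolding cutoff_inequality_def U_def by blast
    have \<phi>: "\<And>y. 0 \<le> \<phi> y \<and> \<phi> y \<le> 1" "\<And>y. y \<in> ball\<^sub>E x (R + h / 2) \<Longrightarrow> \<phi> y = 1"
      "\<And>y. y \<notin> ball\<^sub>E x (R + 9 * h / 10) \<Longrightarrow> \<phi> y = 0"
      using \<phi>' by auto
    define V where "V = (\<lambda>S. \<Sum>y\<in>S. (v y)\<^sup>2 * m y)"
    have V_mono: "V S \<le> V S'" if "S \<subseteq> S'" "finite S'" for S S'
      unfolding V_def using that by (intro sum_mono2) (auto simp: m_nonneg)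
    have V0: "0 \<le> V S" for S unfolding V_def by (intro sum_nonneg) (simp add: m_nonneg)
    have \<phi>B: "\<phi> y = 1" if "y \<in> B" for y
      using that pos ball_mono[of R "R + h / 2" x] by (intro \<phi>) (auto simp: B_def)

    have 1: "dirichlet W q (\<lambda>y. \<phi> y * v y) + \<epsilon> * (\<Sum>y\<in>W. (\<phi> y * v y)\<^sup>2 * m y) \<le> weighted_energy W q v \<phi>"
    proof (rule caccioppoli[OF _ _ fin(1) v])
      show "substochastic M q" "\<And>y z. q y z = q z y" unfolding q_def by (rule trunc_substochastic trunc_sym)+
      fix y assume "\<phi> y \<noteq> 0"
      then have y: "y \<in> ball\<^sub>E x (R + 9 * h / 10)" using \<phi>(3) by blast
      have "kernel_op M q v y = (\<Sum>z\<in>W. q y z * v z * m z)"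
      proof (rule kernel_op_finite[OF fin(1)])
        fix z assume "z \<notin> W"
        then have "z \<notin> ball\<^sub>E y \<rho>"
          using y pos dist_triangle_real[of x z y] by (auto simp: W_def mem_ball)
        then show "q y z * v z = 0" by (simp add: q_def trunc_def)
      qed
      moreover have "y \<in> ball\<^sub>E x r"
        using y pos h ball_mono[of "R + 9 * h / 10" r x] by auto
      ultimately show "v y - (\<Sum>z\<in>W. q y z * v z * m z) \<le> - \<epsilon> * v y" using sub[of y] by (simp add: q_def)
    qed
    have 2: "dirichlet B q v \<le> dirichlet W q (\<lambda>y. \<phi> y * v y)"
    proof -
      have "dirichlet B q v = dirichlet B q (\<lambda>y. \<phi> y * v y)" by (simp add: dirichlet_def \<phi>B)
      then show ?thesis using dirichlet_mono[OF q(1) fin(1) BU(4)] by simp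
    qed
    have 3: "V B \<le> (\<Sum>y\<in>W. (\<phi> y * v y)\<^sup>2 * m y)"
    proof -
      have "V B = (\<Sum>y\<in>B. (\<phi> y * v y)\<^sup>2 * m y)" by (simp add: V_def \<phi>B)
      also have "\<dots> \<le> (\<Sum>y\<in>W. (\<phi> y * v y)\<^sup>2 * m y)"
        using fin BU by (intro sum_mono2) (auto simp: m_nonneg)
      finally show ?thesis .
    qed
    have 4: "weighted_energy W q v \<phi> \<le> weighted_energy U k v \<phi> + 1 / 2 * (C\<^sub>T * (h / 10) powr (- \<beta>) * V W)"
    proof -
      have pt: "(v y)\<^sup>2 * (\<phi> y - \<phi> z)\<^sup>2 * (q y z * m z * m y)
          \<le> indicator U y * (indicator U z * ((v y)\<^sup>2 * (\<phi> y - \<phi> z)\<^sup>2 * (k y z * m z * m y)))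
            + (v y)\<^sup>2 * indicator (- ball\<^sub>E y (h / 10)) z * (k y z * m z * m y)" for y z
      proof -
        have le: "(v y)\<^sup>2 * (\<phi> y - \<phi> z)\<^sup>2 * (q y z * m z * m y) \<le> (v y)\<^sup>2 * (\<phi> y - \<phi> z)\<^sup>2 * (k y z * m z * m y)"
          by (intro mult_left_mono mult_right_mono q m_nonneg) auto
        have nn: "0 \<le> (v y)\<^sup>2 * (k y z * m z * m y)" "0 \<le> (v y)\<^sup>2 * (\<phi> y - \<phi> z)\<^sup>2 * (k y z * m z * m y)"
          using k_nonneg m_nonneg by auto
        show ?thesis
        proof (cases "y \<in> U \<and> z \<in> U")
          case True
          then show ?thesis using le nn by (simp add: indicator_def)
        next
          case False
          show ?thesis
          proof (cases "\<phi> y = \<phi> z")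
            case True
            then show ?thesis using nn by (simp add: indicator_def)
          next
            case False': False
            \<comment> \<open>The flat parts of \<phi> overlap the annulus by h/2 inside and h/10
              outside; the smaller margin gives the h/10.\<close>
            have far: "h / 10 < dist\<^sub>E a b" if "a \<notin> U" "\<phi> a \<noteq> \<phi> b" for a b
            proof (cases "dist\<^sub>E x a \<le> R")
              case True
              then have "\<phi> a = 1" by (intro \<phi>B) (simp add: B_def mem_ball)
              then have "b \<notin> ball\<^sub>E x (R + h / 2)" using that \<phi>(2) by force
              then show ?thesis using True pos dist_triangle_real[of x b a] by (auto simp: mem_ball)
            next
              case False
              then have a: "R + h < dist\<^sub>E x a" using that by (auto simp: U_def annulus_def mem_ball)
              then have "\<phi> a = 0" using pos by (intro \<phi>) (auto simp: mem_ball)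
              then have "b \<in> ball\<^sub>E x (R + 9 * h / 10)" using that \<phi>(3) by force
              then show ?thesis using a dist_triangle_real[of x a b] dist_commute[of a b] by (auto simp: mem_ball)
            qed
            have "h / 10 < dist\<^sub>E y z"
              using far[of y z] far[of z y] False False' dist_commute[of y z] by auto
            then have ind: "indicator (- ball\<^sub>E y (h / 10)) z = (1::real)" by (simp add: mem_ball)
            have "(\<phi> y - \<phi> z)\<^sup>2 \<le> 1"
              using \<phi>(1)[of y] \<phi>(1)[of z] by (simp add: abs_square_le_1 abs_le_iff)
            then have "(\<phi> y - \<phi> z)\<^sup>2 * ((v y)\<^sup>2 * (k y z * m z * m y)) \<le> 1 * ((v y)\<^sup>2 * (k y z * m z * m y))"
              using nn(1) by (rule mult_right_mono)
            then have "(v y)\<^sup>2 * (\<phi> y - \<phi> z)\<^sup>2 * (q y z * m z * m y) \<le> (v y)\<^sup>2 * (k y z * m z * m y)"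
              using le by (simp add: mult_ac)
            then show ?thesis using False ind by (auto simp: indicator_def)
          qed
        qed
      qed
      have U_sum: "(\<Sum>y\<in>W. \<Sum>z\<in>W. indicator U y * (indicator U z * F y z)) = (\<Sum>y\<in>U. \<Sum>z\<in>U. F y z)"
        for F :: "'a \<Rightarrow> 'a \<Rightarrow> real"
      proof -
        have "(\<Sum>y\<in>W. \<Sum>z\<in>W. indicator U y * (indicator U z * F y z))
            = (\<Sum>y\<in>W. indicator U y * (\<Sum>z\<in>W. indicator U z * F y z))"
          by (simp add: sum_distrib_left)
        also have "\<dots> = (\<Sum>y\<in>W \<inter> U. \<Sum>z\<in>W \<inter> U. F y z)"
          using fin by (simp add: sum.inter_restrict indicator_def if_distrib[of "\<lambda>c. c * _"] cong: if_cong)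
        also have "W \<inter> U = U" using BU by auto
        finally show ?thesis .
      qed
      have "weighted_energy W q v \<phi> \<le> 1 / 2 * (\<Sum>y\<in>W. \<Sum>z\<in>W.
          indicator U y * (indicator U z * ((v y)\<^sup>2 * (\<phi> y - \<phi> z)\<^sup>2 * (k y z * m z * m y)))
            + (v y)\<^sup>2 * indicator (- ball\<^sub>E y (h / 10)) z * (k y z * m z * m y))"
        unfolding weighted_energy_def by (intro mult_left_mono sum_mono pt) auto
      also have "\<dots> = weighted_energy U k v \<phi>
          + 1 / 2 * (\<Sum>y\<in>W. \<Sum>z\<in>W. (v y)\<^sup>2 * indicator (- ball\<^sub>E y (h / 10)) z * (k y z * m z * m y))"
        by (simp add: sum.distrib U_sum weighted_energy_def distrib_left)
      also have "\<dots> \<le> weighted_energy U k v \<phi> + 1 / 2 * (C\<^sub>T * (h / 10) powr (- \<beta>) * V W)"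
        unfolding V_def using pos by (intro add_left_mono mult_left_mono sum_tail_le tail fin) auto
      finally show ?thesis .
    qed
    have 5: "dirichlet U k v \<le> dirichlet U q v + C\<^sub>T * \<rho> powr (- \<beta>) * V U"
    proof -
      let ?w = "\<lambda>y z. k y z * m z * m y"
      let ?T = "\<lambda>y z. (v y)\<^sup>2 * indicator (- ball\<^sub>E y \<rho>) z * ?w y z"
      have pt: "(v y - v z)\<^sup>2 * ?w y z \<le> (v y - v z)\<^sup>2 * (q y z * m z * m y) + (?T y z + ?T z y)" for y z
      proof (cases "z \<in> ball\<^sub>E y \<rho>")
        case True
        then show ?thesis using k_nonneg m_nonneg by (simp add: q_def trunc_def indicator_def)
      next
        case False
        then have "y \<notin> ball\<^sub>E z \<rho>" by (simp add: mem_ball dist_commute[of z y])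
        \<comment> \<open>No factor 2 is needed, because v is nonnegative.\<close>
        moreover have "(v y - v z)\<^sup>2 \<le> (v y)\<^sup>2 + (v z)\<^sup>2"
          using v[of y] v[of z] by (simp add: power2_diff)
        then have "(v y - v z)\<^sup>2 * ?w y z \<le> ((v y)\<^sup>2 + (v z)\<^sup>2) * ?w y z"
          using k_nonneg m_nonneg by (intro mult_right_mono) auto
        ultimately show ?thesis using False
          by (simp add: q_def trunc_def k_sym[of z y] algebra_simps)
      qed
      have "dirichlet U k v \<le> 1 / 2 * (\<Sum>y\<in>U. \<Sum>z\<in>U. (v y - v z)\<^sup>2 * (q y z * m z * m y) + (?T y z + ?T z y))"
        unfolding dirichlet_def by (intro mult_left_mono sum_mono pt) auto
      also have "\<dots> = dirichlet U q v + (\<Sum>y\<in>U. \<Sum>z\<in>U. ?T y z)"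
        unfolding sum_symmetrize[of ?T] by (simp add: sum.distrib dirichlet_def distrib_left)
      also have "\<dots> \<le> dirichlet U q v + C\<^sub>T * \<rho> powr (- \<beta>) * V U"
        unfolding V_def by (intro add_left_mono sum_tail_le tail pos fin)
      finally show ?thesis .
    qed
    have 6: "dirichlet B q v + dirichlet U q v \<le> dirichlet (ball\<^sub>E x (R + h)) q v"
      using dirichlet_Un[OF q(1) fin(3,2) BU(2)] by (simp add: BU(1))
    have VU: "V U \<le> V W" using BU fin by (intro V_mono)
    have \<rho>h: "\<rho> powr (- \<beta>) \<le> h powr (- \<beta>)" using pos h \<beta> by (intro powr_mono2') auto
    have "dirichlet B q v + \<epsilon> * V B \<le> weighted_energy W q v \<phi>"
      using 1 2 mult_left_mono[OF 3 \<epsilon>] by linarith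
    also have "\<dots> \<le> C\<^sub>1 * dirichlet U k v + C\<^sub>2 * h powr (- \<beta>) * V U + 1 / 2 * (C\<^sub>T * (h / 10) powr (- \<beta>) * V W)"
      using 4 cs by (simp add: V_def)
    also have "\<dots> \<le> C\<^sub>1 * ((dirichlet (ball\<^sub>E x (R + h)) q v - dirichlet B q v) + C\<^sub>T * h powr (- \<beta>) * V W)
        + C\<^sub>2 * h powr (- \<beta>) * V W + C\<^sub>T * 10 powr \<beta> * h powr (- \<beta>) * V W"
    proof (intro add_mono mult_left_mono)
      have "C\<^sub>T * \<rho> powr (- \<beta>) * V U \<le> C\<^sub>T * h powr (- \<beta>) * V W"
        using CT VU V0 \<rho>h by (intro mult_mono) auto
      then show "dirichlet U k v \<le> (dirichlet (ball\<^sub>E x (R + h)) q v - dirichlet B q v) + C\<^sub>T * h powr (- \<beta>) * V W"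
        using 5 6 by linarith
      have "(h / 10) powr (- \<beta>) = 10 powr \<beta> * h powr (- \<beta>)"
        by (simp add: powr_divide powr_minus_divide)
      moreover have "0 \<le> C\<^sub>T * (10 powr \<beta> * h powr (- \<beta>)) * V W" using CT V0 by simp
      ultimately show "1 / 2 * (C\<^sub>T * (h / 10) powr (- \<beta>) * V W) \<le> C\<^sub>T * 10 powr \<beta> * h powr (- \<beta>) * V W"
        by (simp add: mult_ac)
    qed (use C12 VU in auto)
    also have "\<dots> = C\<^sub>1 * (dirichlet (ball\<^sub>E x (R + h)) q v - dirichlet B q v) + C\<^sub>3 * h powr (- \<beta>) * V W"
      by (simp add: C\<^sub>3_def algebra_simps)
    finally show "dirichlet (ball\<^sub>E x R) (trunc \<rho>) v + \<epsilon> * (\<Sum>y\<in>ball\<^sub>E x R. (v y)\<^sup>2 * m y)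
       \<le> C\<^sub>1 * (dirichlet (ball\<^sub>E x (R + h)) (trunc \<rho>) v - dirichlet (ball\<^sub>E x R) (trunc \<rho>) v)
         + C\<^sub>3 * h powr (- \<beta>) * (\<Sum>y\<in>ball\<^sub>E x (R + h + \<rho>). (v y)\<^sup>2 * m y)"
      by (simp add: B_def q_def V_def W_def)
  qed
qed


text \<open>Hole filling bounds the energy on radius R + \<rho> by the squared norm alone, with the
  norm frozen at radius R + 3\<rho>; there the term with \<epsilon> is thrown away. One more use of
  the energy inequality, with h = \<rho>, then keeps that term and inserts the energy bound.\<close>

lemma L2_decay_step:
  assumes cut: "cutoff_inequality C\<^sub>1 C\<^sub>2"
  obtains C where "0 < C" "\<And>x r v \<rho> \<epsilon> R. 0 < \<rho> \<Longrightarrow> 0 < R \<Longrightarrow> R + 2 * \<rho> \<le> r \<Longrightarrow>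
     (\<And>y. 0 \<le> v y) \<Longrightarrow>
     (\<And>y. y \<in> ball\<^sub>E x r \<Longrightarrow> v y - kernel_op M (trunc \<rho>) v y \<le> - \<epsilon> * v y) \<Longrightarrow> 0 \<le> \<epsilon> \<Longrightarrow>
     \<epsilon> * (\<Sum>y\<in>ball\<^sub>E x R. (v y)\<^sup>2 * m y) \<le> C * \<rho> powr (- \<beta>) * (\<Sum>y\<in>ball\<^sub>E x (R + 3 * \<rho>). (v y)\<^sup>2 * m y)"
proof -
  have C1: "0 < C\<^sub>1" using cut by (auto simp: cutoff_inequality_def)
  obtain C\<^sub>3 where C3: "0 < C\<^sub>3" and decay: "\<And>x r v \<rho> \<epsilon> R h. 0 < \<rho> \<Longrightarrow> 0 < R \<Longrightarrow> 0 < h \<Longrightarrow> h \<le> \<rho> \<Longrightarrow> R + h \<le> r \<Longrightarrow>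
     (\<And>y. 0 \<le> v y) \<Longrightarrow>
     (\<And>y. y \<in> ball\<^sub>E x r \<Longrightarrow> v y - kernel_op M (trunc \<rho>) v y \<le> - \<epsilon> * v y) \<Longrightarrow> 0 \<le> \<epsilon> \<Longrightarrow>
     dirichlet (ball\<^sub>E x R) (trunc \<rho>) v + \<epsilon> * (\<Sum>y\<in>ball\<^sub>E x R. (v y)\<^sup>2 * m y)
       \<le> C\<^sub>1 * (dirichlet (ball\<^sub>E x (R + h)) (trunc \<rho>) v - dirichlet (ball\<^sub>E x R) (trunc \<rho>) v)
         + C\<^sub>3 * h powr (- \<beta>) * (\<Sum>y\<in>ball\<^sub>E x (R + h + \<rho>). (v y)\<^sup>2 * m y)"
    using energy_decay[OF cut] by blast
  \<comment> \<open>Moving the subtracted ball energy to the left makes its factor 1 +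
    \<open>C\<^sub>1\<close>, and \<theta> < 1 is the quotient left on the larger ball.\<close>
  define \<theta> where "\<theta> = C\<^sub>1 / (1 + C\<^sub>1)"
  have \<theta>: "0 < \<theta>" "\<theta> < 1" using C1 by (auto simp: \<theta>_def)
  obtain C\<^sub>4 where C4: "0 < C\<^sub>4" and fill: "\<And>f R H A Z. 0 < H \<Longrightarrow> 0 \<le> A \<Longrightarrow> (\<And>t. 0 \<le> f t \<and> f t \<le> Z) \<Longrightarrow>
    (\<And>t h. R \<le> t \<Longrightarrow> 0 < h \<Longrightarrow> t + h \<le> R + H \<Longrightarrow> f t \<le> \<theta> * f (t + h) + A * h powr (- \<beta>)) \<Longrightarrow>
    f R \<le> C\<^sub>4 * A * H powr (- \<beta>)"
    using hole_filling[OF \<theta> \<beta>] by blast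
  define C where "C = C\<^sub>1 * C\<^sub>4 * C\<^sub>3 + C\<^sub>3"
  have C: "0 < C" using C1 C3 C4 by (simp add: C_def add_pos_pos)
  show ?thesis
  proof (rule that[OF C])
    fix x v and r \<rho> \<epsilon> R :: real
    assume pos: "0 < \<rho>" "0 < R" and r: "R + 2 * \<rho> \<le> r" and v: "\<And>y. 0 \<le> v y" and \<epsilon>: "0 \<le> \<epsilon>"
      and sub: "\<And>y. y \<in> ball\<^sub>E x r \<Longrightarrow> v y - kernel_op M (trunc \<rho>) v y \<le> - \<epsilon> * v y"
    define V where "V = (\<lambda>t. \<Sum>y\<in>ball\<^sub>E x t. (v y)\<^sup>2 * m y)"
    define D where "D = (\<lambda>t. dirichlet (ball\<^sub>E x t) (trunc \<rho>) v)"
    have V_mono: "V s \<le> V t" if "s \<le> t" for s t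
      unfolding V_def using that by (intro sum_mono2 finite_ball ball_mono) (auto simp: m_nonneg)
    have V0: "0 \<le> V t" for t unfolding V_def by (intro sum_nonneg) (simp add: m_nonneg)
    have D0: "0 \<le> D t" for t unfolding D_def by (intro dirichlet_nonneg trunc_nonneg)
    have D_mono: "D s \<le> D t" if "s \<le> t" for s t
      unfolding D_def using that by (intro dirichlet_mono trunc_nonneg finite_ball ball_mono)
    have step: "D t + \<epsilon> * V t \<le> C\<^sub>1 * (D (t + h) - D t) + C\<^sub>3 * h powr (- \<beta>) * V (t + h + \<rho>)"
      if "0 < t" "0 < h" "h \<le> \<rho>" "t + h \<le> r" for t h
      unfolding D_def V_def by (rule decay[OF pos(1) that v sub \<epsilon>])
    define A where "A = C\<^sub>3 * V (R + 3 * \<rho>)"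
    define R' where "R' = R + \<rho>"
    have "D (min R' (R' + \<rho>)) \<le> C\<^sub>4 * A * \<rho> powr (- \<beta>)"
    \<comment> \<open>The \<open>min\<close> stops the energy at the outer radius, since
      \<open>hole_filling\<close> asks for a bound at every argument.\<close>
    proof (rule fill[where f = "\<lambda>t. D (min t (R' + \<rho>))" and Z = "D (R' + \<rho>)", OF pos(1)])
      show "0 \<le> A" using C3 V0 by (simp add: A_def)
      show "0 \<le> D (min t (R' + \<rho>)) \<and> D (min t (R' + \<rho>)) \<le> D (R' + \<rho>)" for t
        using D0 by (auto intro: D_mono)
      fix t h assume t: "R' \<le> t" "0 < h" "t + h \<le> R' + \<rho>"
      have "D t + \<epsilon> * V t \<le> C\<^sub>1 * (D (t + h) - D t) + C\<^sub>3 * h powr (- \<beta>) * V (t + h + \<rho>)"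
        using t pos r by (intro step) (auto simp: R'_def)
      moreover have "0 \<le> \<epsilon> * V t" using \<epsilon> V0 by simp
      moreover have "C\<^sub>3 * h powr (- \<beta>) * V (t + h + \<rho>) \<le> C\<^sub>3 * h powr (- \<beta>) * V (R + 3 * \<rho>)"
        using C3 t by (intro mult_left_mono V_mono) (auto simp: R'_def)
      ultimately have "(1 + C\<^sub>1) * D t \<le> C\<^sub>1 * D (t + h) + A * h powr (- \<beta>)"
        by (simp add: A_def algebra_simps)
      then have "D t \<le> (C\<^sub>1 * D (t + h) + A * h powr (- \<beta>)) / (1 + C\<^sub>1)"
        using C1 by (simp add: field_simps)
      also have "\<dots> = \<theta> * D (t + h) + (A * h powr (- \<beta>)) / (1 + C\<^sub>1)"
        by (simp add: \<theta>_def add_divide_distrib)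
      also have "(A * h powr (- \<beta>)) / (1 + C\<^sub>1) \<le> A * h powr (- \<beta>)"
        using C1 C3 V0[of "R + 3 * \<rho>"] divide_left_mono[of 1 "1 + C\<^sub>1" "A * h powr (- \<beta>)"]
        by (simp add: A_def)
      finally show "D (min t (R' + \<rho>)) \<le> \<theta> * D (min (t + h) (R' + \<rho>)) + A * h powr (- \<beta>)"
        using t by (simp add: min_def)
    qed
    then have "D R' \<le> C\<^sub>4 * A * \<rho> powr (- \<beta>)" using pos by (simp add: min_def)
    then have 1: "C\<^sub>1 * D R' \<le> C\<^sub>1 * (C\<^sub>4 * A * \<rho> powr (- \<beta>))" using C1 by (intro mult_left_mono) auto
    have "D R + \<epsilon> * V R \<le> C\<^sub>1 * (D (R + \<rho>) - D R) + C\<^sub>3 * \<rho> powr (- \<beta>) * V (R + \<rho> + \<rho>)"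
      using pos r by (intro step) auto
    moreover have "0 \<le> C\<^sub>1 * D R" using C1 D0 by simp
    moreover have "C\<^sub>3 * \<rho> powr (- \<beta>) * V (R + \<rho> + \<rho>) \<le> C\<^sub>3 * \<rho> powr (- \<beta>) * V (R + 3 * \<rho>)"
      using C3 pos by (intro mult_left_mono V_mono) auto
    ultimately have "\<epsilon> * V R \<le> C\<^sub>1 * (C\<^sub>4 * A * \<rho> powr (- \<beta>)) + C\<^sub>3 * \<rho> powr (- \<beta>) * V (R + 3 * \<rho>)"
      using 1 D0[of R] unfolding R'_def right_diff_distrib by linarith
    also have "\<dots> = C * \<rho> powr (- \<beta>) * V (R + 3 * \<rho>)"
      by (simp add: C_def A_def algebra_simps)
    finally show "\<epsilon> * (\<Sum>y\<in>ball\<^sub>E x R. (v y)\<^sup>2 * m y)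
        \<le> C * \<rho> powr (- \<beta>) * (\<Sum>y\<in>ball\<^sub>E x (R + 3 * \<rho>). (v y)\<^sup>2 * m y)"
      by (simp add: V_def)
  qed
qed

text \<open>Each of the i applications of \<open>L2_decay_step\<close> shrinks the radius by 3\<rho>
  and gains a factor of order n r^(-\<beta>); \<rho> = r/(6i) lets them use up exactly the layer
  between r/2 and r. At radius r the average is at most 1, and the volume bounds its norm.\<close>

lemma exit_L2_decay:
  assumes cut: "cutoff_inequality C\<^sub>1 C\<^sub>2" and i: "1 \<le> (i::nat)"
  obtains D where "0 < D" "\<And>x r n. 1 \<le> r \<Longrightarrow> 1 \<le> n \<Longrightarrow>
    (\<Sum>y\<in>ball\<^sub>E x (r / 2). (exit_prob M (trunc (r / (6 * real i))) (ball\<^sub>E x r) n y)\<^sup>2 * m y)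
      \<le> D * (real n * r powr (- \<beta>)) ^ i * r powr \<alpha>"
proof -
  obtain C where C: "0 < C" and decay: "\<And>x r v \<rho> \<epsilon> R. 0 < \<rho> \<Longrightarrow> 0 < R \<Longrightarrow> R + 2 * \<rho> \<le> r \<Longrightarrow>
     (\<And>y. 0 \<le> v y) \<Longrightarrow>
     (\<And>y. y \<in> ball\<^sub>E x r \<Longrightarrow> v y - kernel_op M (trunc \<rho>) v y \<le> - \<epsilon> * v y) \<Longrightarrow> 0 \<le> \<epsilon> \<Longrightarrow>
     \<epsilon> * (\<Sum>y\<in>ball\<^sub>E x R. (v y)\<^sup>2 * m y) \<le> C * \<rho> powr (- \<beta>) * (\<Sum>y\<in>ball\<^sub>E x (R + 3 * \<rho>). (v y)\<^sup>2 * m y)"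
    using L2_decay_step[OF cut] by blast
  define D where "D = 4 * (2 * C * (6 * real i) powr \<beta>) ^ i * C\<^sub>V"
  have D: "0 < D" using C C\<^sub>V i by (simp add: D_def)
  show ?thesis
  proof (rule that[OF D])
    fix x n and r :: real assume r: "1 \<le> r" and n: "1 \<le> (n::nat)"
    define \<rho> where "\<rho> = r / (6 * real i)"
    have \<rho>: "0 < \<rho>" "r / 2 + 3 * real i * \<rho> = r" using r i by (auto simp: \<rho>_def)
    define p where "p = exit_prob M (trunc \<rho>) (ball\<^sub>E x r)"
    \<comment> \<open>Averaging up to time 2n leaves n terms with index at least n, each at least
      \<open>p n\<close>, whence \<open>p n\<close> \<le> 2v.\<close>
    define N where "N = 2 * n"
    have N: "1 \<le> N" "0 < real N" using n by (auto simp: N_def)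
    define v where "v = (\<lambda>y. (\<Sum>l<N. p l y) / real N)"
    have p: "0 \<le> p l y" "p l y \<le> 1" "l \<le> l' \<Longrightarrow> p l y \<le> p l' y" for l l' y
      unfolding p_def by (auto intro: exit_prob_nonneg exit_prob_le_1 exit_prob_mono trunc_substochastic)
    have v0: "0 \<le> v y" for y unfolding v_def by (intro divide_nonneg_nonneg sum_nonneg p) auto
    have sum_le: "(\<Sum>l<N. p l y) \<le> real N * c" if "\<And>l. l < N \<Longrightarrow> p l y \<le> c" for y c
      using sum_bounded_above[of "{..<N}" "\<lambda>l. p l y" c] that by simp
    have v_le: "v y \<le> p N y" "v y \<le> 1" for y
      using sum_le[of y "p N y"] sum_le[of y 1] p N by (auto simp: v_def field_simps)
    have v_ge: "p n y \<le> 2 * v y" for y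
    proof -
      have "real n * p n y = (\<Sum>l\<in>{n..<N}. p n y)" by (simp add: N_def)
      also have "\<dots> \<le> (\<Sum>l\<in>{n..<N}. p l y)" by (intro sum_mono p) auto
      also have "\<dots> \<le> (\<Sum>l<N. p l y)" by (intro sum_mono2) (auto simp: p)
      finally show ?thesis using n by (simp add: v_def N_def field_simps)
    qed
    define V where "V = (\<lambda>t. \<Sum>y\<in>ball\<^sub>E x t. (v y)\<^sup>2 * m y)"
    have V0: "0 \<le> V t" for t unfolding V_def by (intro sum_nonneg) (simp add: m_nonneg)
    have step: "V R \<le> (C * \<rho> powr (- \<beta>) * real N) * V (R + 3 * \<rho>)" if "0 < R" "R + 2 * \<rho> \<le> r" for R
    proof -
      have "1 / real N * V R \<le> C * \<rho> powr (- \<beta>) * V (R + 3 * \<rho>)"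
        unfolding V_def
      proof (rule decay[OF \<rho>(1) that v0])
        fix y assume "y \<in> ball\<^sub>E x r"
        then have "v y - kernel_op M (trunc \<rho>) v y = - p N y / real N"
          unfolding v_def p_def by (rule exit_prob_average[OF trunc_substochastic N(1)])
        also have "\<dots> \<le> - (1 / real N) * v y" using v_le(1)[of y] N by (simp add: field_simps)
        finally show "v y - kernel_op M (trunc \<rho>) v y \<le> - (1 / real N) * v y" .
      qed simp
      then show ?thesis using N by (simp add: field_simps)
    qed
    have iter: "V (r / 2) \<le> (C * \<rho> powr (- \<beta>) * real N) ^ j * V (r / 2 + 3 * real j * \<rho>)" if "j \<le> i" for j
      using that
    proof (induction j)
      case (Suc j)
      have "V (r / 2 + 3 * real j * \<rho>) \<le> (C * \<rho> powr (- \<beta>) * real N) * V (r / 2 + 3 * real j * \<rho> + 3 * \<rho>)"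
      proof (rule step)
        have "(3 * real j + 3) * \<rho> \<le> 3 * real i * \<rho>" using Suc.prems \<rho> by (intro mult_right_mono) auto
        then have "r / 2 + 3 * real j * \<rho> + 3 * \<rho> \<le> r" using \<rho>(2) by (simp add: algebra_simps)
        then show "r / 2 + 3 * real j * \<rho> + 2 * \<rho> \<le> r" using \<rho>(1) by linarith
        show "0 < r / 2 + 3 * real j * \<rho>" using r \<rho>(1) by (simp add: add_pos_nonneg)
      qed
      then have le: "(C * \<rho> powr (- \<beta>) * real N) ^ j * V (r / 2 + 3 * real j * \<rho>)
          \<le> (C * \<rho> powr (- \<beta>) * real N) ^ j * ((C * \<rho> powr (- \<beta>) * real N) * V (r / 2 + 3 * real j * \<rho> + 3 * \<rho>))"
        using C by (intro mult_left_mono) auto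
      have eq: "r / 2 + 3 * real j * \<rho> + 3 * \<rho> = r / 2 + 3 * real (Suc j) * \<rho>" by (simp add: algebra_simps)
      from Suc have "V (r / 2) \<le> (C * \<rho> powr (- \<beta>) * real N) ^ j * V (r / 2 + 3 * real j * \<rho>)" by simp
      from order_trans[OF this le] show ?case
        unfolding eq by (simp only: power_Suc2 mult.assoc)
    qed simp
    have "V r \<le> sum m (ball\<^sub>E x r)"
      unfolding V_def
    proof (rule sum_mono)
      fix y
      have "(v y)\<^sup>2 \<le> 1" using v0[of y] v_le(2)[of y] by (simp add: power_le_one)
      then show "(v y)\<^sup>2 * m y \<le> m y" using m_nonneg[of y] mult_right_mono by fastforce
    qed
    also have "\<dots> \<le> C\<^sub>V * r powr \<alpha>" by (rule volume_sum[OF r])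
    finally have Vr: "V r \<le> C\<^sub>V * r powr \<alpha>" .
    have "(\<Sum>y\<in>ball\<^sub>E x (r / 2). (p n y)\<^sup>2 * m y) \<le> (\<Sum>y\<in>ball\<^sub>E x (r / 2). 4 * ((v y)\<^sup>2 * m y))"
    proof (rule sum_mono)
      fix y
      have "(p n y)\<^sup>2 \<le> (2 * v y)\<^sup>2" using v_ge p by (intro power_mono) auto
      then have "(p n y)\<^sup>2 * m y \<le> (2 * v y)\<^sup>2 * m y" using m_nonneg by (rule mult_right_mono)
      then show "(p n y)\<^sup>2 * m y \<le> 4 * ((v y)\<^sup>2 * m y)" by (simp add: power_mult_distrib)
    qed
    also have "\<dots> = 4 * V (r / 2)" by (simp add: V_def sum_distrib_left)
    also have "\<dots> \<le> 4 * ((C * \<rho> powr (- \<beta>) * real N) ^ i * (C\<^sub>V * r powr \<alpha>))"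
      using iter[of i] \<rho>(2) mult_left_mono[OF Vr, of "(C * \<rho> powr (- \<beta>) * real N) ^ i"] C by simp
    also have "C * \<rho> powr (- \<beta>) * real N = (2 * C * (6 * real i) powr \<beta>) * (real n * r powr (- \<beta>))"
      by (simp add: \<rho>_def N_def powr_divide powr_minus_divide)
    finally show "(\<Sum>y\<in>ball\<^sub>E x (r / 2). (exit_prob M (trunc (r / (6 * real i))) (ball\<^sub>E x r) n y)\<^sup>2 * m y)
      \<le> D * (real n * r powr (- \<beta>)) ^ i * r powr \<alpha>"
      by (simp add: p_def \<rho>_def D_def power_mult_distrib mult_ac)
  qed
qed

section \<open>From mean square decay to the exit estimate\<close>

text \<open>The two walks agree until the first jump longer than \<rho>, and each step makes such a
  jump with probability at most \<tau>.\<close>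

lemma exit_prob_trunc_le:
  assumes tail: "\<And>x. K (indicator (- ball\<^sub>E x \<rho>)) x \<le> \<tau>"
  shows "exit_prob M k B n x \<le> exit_prob M (trunc \<rho>) B n x + real n * \<tau>"
proof -
  have \<tau>: "0 \<le> \<tau>"
    using tail[of x] kernel_op_nonneg[OF k_substochastic, of "indicator (- ball\<^sub>E x \<rho>)" x]
    by (simp add: indicator_def)
  show ?thesis
  proof (induction n arbitrary: x)
    case (Suc n)
    show ?case
    proof (cases "x \<in> B")
      case True
      define P where "P = exit_prob M k B n"
      define Q where "Q = exit_prob M (trunc \<rho>) B n"
      have Pb: "bounded (range P)" unfolding P_def by (rule exit_prob_bounded[OF k_substochastic])
      have Qb: "bounded (range Q)" unfolding Q_def by (rule exit_prob_bounded[OF trunc_substochastic])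
      have P: "0 \<le> P y" "P y \<le> 1" for y
        unfolding P_def by (rule exit_prob_nonneg[OF k_substochastic] exit_prob_le_1[OF k_substochastic])+
      have "K P x \<le> K (\<lambda>y. indicator (ball\<^sub>E x \<rho>) y * P y + indicator (- ball\<^sub>E x \<rho>) y) x"
        by (intro kernel_op_mono k_substochastic Pb bounded_range_plus bounded_range_indicator
            bounded_range_indicator_mult) (use P in \<open>auto simp: indicator_def\<close>)
      also have "\<dots> = K (\<lambda>y. indicator (ball\<^sub>E x \<rho>) y * P y) x + K (indicator (- ball\<^sub>E x \<rho>)) x"
        by (intro kernel_op_add k_substochastic bounded_range_indicator bounded_range_indicator_mult Pb)
      also have "K (\<lambda>y. indicator (ball\<^sub>E x \<rho>) y * P y) x = kernel_op M (trunc \<rho>) P x"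
        by (simp add: kernel_op_def trunc_def mult_ac)
      also have "kernel_op M (trunc \<rho>) P x \<le> kernel_op M (trunc \<rho>) (\<lambda>y. Q y + real n * \<tau>) x"
        using Suc by (intro kernel_op_mono trunc_substochastic Pb bounded_range_plus Qb) (auto simp: P_def Q_def)
      also have "\<dots> = kernel_op M (trunc \<rho>) Q x + kernel_op M (trunc \<rho>) (\<lambda>y. real n * \<tau>) x"
        by (intro kernel_op_add trunc_substochastic Qb) simp
      also have "kernel_op M (trunc \<rho>) (\<lambda>y. real n * \<tau>) x \<le> real n * \<tau>"
        using \<tau> by (intro kernel_op_le trunc_substochastic) auto
      finally show ?thesis using True tail[of x] by (simp add: P_def Q_def algebra_simps)
    qed (use \<tau> in auto)
  qed simp
qed

text \<open>Induction on n, for all centres and radii at once. Within about \<theta>n steps the walk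
  either leaves the half ball, which the induction hypothesis bounds, or its position has density at
  most C n^(-\<alpha>/\<beta>) and it must leave the ball from there. The choice of \<theta> makes
  the first part at most half of A n r^(-\<beta>), so \<open>A\<close> does not grow along the
  induction.\<close>

lemma cutoff_inequality_imp_exit_bounded:
  assumes cut: "cutoff_inequality C\<^sub>1 C\<^sub>2"
  obtains A where "exit_bounded A"
proof -
  define e where "e = \<alpha> / \<beta>"
  have e: "0 < e" using \<alpha> \<beta> by (simp add: e_def)
  obtain C\<^sub>0 where C0: "C\<^sub>0 > 0" and on: "\<And>n x y. n \<ge> 1 \<Longrightarrow> k\<^sub>n n x y \<le> C\<^sub>0 * real n powr (- e)"
    using on_diagonal_bound unfolding e_def by blast
  obtain C\<^sub>T where CT: "C\<^sub>T \<ge> 1" and tail: "\<And>x r. 0 < r \<Longrightarrow> K (indicator (- ball\<^sub>E x r)) x \<le> C\<^sub>T * r powr (- \<beta>)"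
    using tail_bound by blast
  \<comment> \<open>With t = n r^(-\<beta>) \<le> 1 the mean square decays like t^(2j), hence the
    mean like t^j, and the on-diagonal bound costs t^(-e); j \<ge> 1 + e leaves a full factor
    t.\<close>
  obtain j :: nat where j: "1 + e \<le> real j" using real_arch_simple by blast
  define i where "i = 2 * j"
  have i: "1 \<le> i" "0 < real i" using j e by (auto simp: i_def intro: Suc_leI)
  obtain D where D: "0 < D" and L2: "\<And>x r n. 1 \<le> r \<Longrightarrow> 1 \<le> n \<Longrightarrow>
    (\<Sum>y\<in>ball\<^sub>E x (r / 2). (exit_prob M (trunc (r / (6 * real i))) (ball\<^sub>E x r) n y)\<^sup>2 * m y)
      \<le> D * (real n * r powr (- \<beta>)) ^ i * r powr \<alpha>"
    using exit_L2_decay[OF cut i(1)] by blast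
  \<comment> \<open>Passing to the half ball costs 2^\<beta> and rounding the time up costs 2; this
    \<theta> leaves 2 \<theta> 2^\<beta> = 1/2.\<close>
  define \<theta> where "\<theta> = 2 powr (- \<beta> - 2)"
  have \<theta>: "0 < \<theta>" "\<theta> < 1 / 2" "2 powr \<beta> * \<theta> = 1 / 4"
  proof -
    show "0 < \<theta>" by (simp add: \<theta>_def)
    show "2 powr \<beta> * \<theta> = 1 / 4" by (simp add: \<theta>_def powr_diff powr_minus_divide)
    have "2 powr (- \<beta> - 2) < 2 powr (- 1)" using \<beta> by (intro powr_less_mono) auto
    then show "\<theta> < 1 / 2" by (simp add: \<theta>_def powr_minus_divide)
  qed
  define G where "G = C\<^sub>T * 2 powr \<beta> + C\<^sub>T * (6 * real i) powr \<beta> + C\<^sub>0 * \<theta> powr (- e) * (1 / 2 * (D + C\<^sub>V))"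
  define A where "A = 1 + C\<^sub>T + 2 * G"
  have G: "0 < G"
  proof -
    have "0 < C\<^sub>T * 2 powr \<beta>" "0 \<le> C\<^sub>T * (6 * real i) powr \<beta>" using CT by auto
    moreover have "0 \<le> C\<^sub>0 * \<theta> powr (- e) * (1 / 2 * (D + C\<^sub>V))" using C0 D C\<^sub>V by simp
    ultimately show ?thesis unfolding G_def by linarith
  qed
  have A: "1 \<le> A" "C\<^sub>T \<le> A" "2 * G \<le> A" using CT G by (auto simp: A_def)

  have short: "exit_prob M k (ball\<^sub>E x r) 1 x \<le> C\<^sub>T * r powr (- \<beta>)" if r: "0 < r" for x r
    using tail[OF r, of x] that by (simp add: mem_ball)

  \<comment> \<open>The exit probability after time s is split into the truncated one, small in mean
    square, and the price of long jumps, proportional to n r^(-\<beta>) because \<rho> is a fixed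
    fraction of r. The condition \<theta>n \<le> s keeps the density at time s of order
    n^(-e).\<close>
  have later: "exit_prob M k (ball\<^sub>E x r) n x \<le> exit_prob M k (ball\<^sub>E x (r / 2)) s x
      + (C\<^sub>T * (6 * real i) powr \<beta> + C\<^sub>0 * \<theta> powr (- e) * (1 / 2 * (D + C\<^sub>V))) * (real n * r powr (- \<beta>))"
    if r: "1 \<le> r" and n: "1 \<le> n" and s: "1 \<le> s" "\<theta> * real n \<le> real s" and nr: "real n * r powr (- \<beta>) \<le> 1" for x r n s
  proof -
    define \<rho> where "\<rho> = r / (6 * real i)"
    have \<rho>: "0 < \<rho>" using r i by (simp add: \<rho>_def)
    define t where "t = real n * r powr (- \<beta>)"
    have t: "0 < t" "t \<le> 1" using r n nr by (auto simp: t_def)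
    define B where "B = ball\<^sub>E x (r / 2)"
    define P where "P = exit_prob M k (ball\<^sub>E x r) n"
    define Q where "Q = exit_prob M (trunc \<rho>) (ball\<^sub>E x r) n"
    define \<tau> where "\<tau> = C\<^sub>T * \<rho> powr (- \<beta>)"
    have \<tau>0: "0 \<le> \<tau>" using CT by (simp add: \<tau>_def)
    have Q0: "0 \<le> Q y" for y unfolding Q_def by (rule exit_prob_nonneg[OF trunc_substochastic])
    have PQ: "P y \<le> Q y + real n * \<tau>" for y
      unfolding P_def Q_def \<tau>_def by (rule exit_prob_trunc_le[OF tail[OF \<rho>]])
    have fB: "finite B" by (simp add: B_def finite_ball)
    \<comment> \<open>The weight t^j balances the mean square, of order t^(2j) r^\<alpha>, against
      the volume r^\<alpha>.\<close>
    have Qsum: "(\<Sum>y\<in>B. Q y * m y) \<le> 1 / 2 * (D + C\<^sub>V) * r powr \<alpha> * t ^ j"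
    proof -
      have "(\<Sum>y\<in>B. Q y * m y) \<le> (\<Sum>y\<in>B. 1 / (2 * t ^ j) * ((Q y)\<^sup>2 * m y) + t ^ j / 2 * m y)"
      proof (rule sum_mono)
        fix y
        have "Q y * t ^ j * 2 \<le> (Q y)\<^sup>2 + (t ^ j)\<^sup>2" using sum_squares_bound[of "Q y" "t ^ j"] by (simp add: mult_ac)
        then have "Q y \<le> ((Q y)\<^sup>2 + (t ^ j)\<^sup>2) / (2 * t ^ j)" using t by (simp add: pos_le_divide_eq mult_ac)
        also have "\<dots> = 1 / (2 * t ^ j) * (Q y)\<^sup>2 + t ^ j / 2"
          using t by (simp add: add_divide_distrib power2_eq_square)
        finally have "Q y * m y \<le> (1 / (2 * t ^ j) * (Q y)\<^sup>2 + t ^ j / 2) * m y"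
          using m_nonneg by (rule mult_right_mono)
        then show "Q y * m y \<le> 1 / (2 * t ^ j) * ((Q y)\<^sup>2 * m y) + t ^ j / 2 * m y"
          by (simp add: distrib_right)
      qed
      also have "\<dots> = 1 / (2 * t ^ j) * (\<Sum>y\<in>B. (Q y)\<^sup>2 * m y) + t ^ j / 2 * sum m B"
        by (simp only: sum.distrib sum_distrib_left)
      also have "\<dots> \<le> 1 / (2 * t ^ j) * (D * t ^ i * r powr \<alpha>) + t ^ j / 2 * (C\<^sub>V * r powr \<alpha>)"
      proof (intro add_mono mult_left_mono)
        show "(\<Sum>y\<in>B. (Q y)\<^sup>2 * m y) \<le> D * t ^ i * r powr \<alpha>"
          using L2[OF r n, of x] by (simp add: B_def Q_def \<rho>_def t_def)
        have "sum m B \<le> sum m (ball\<^sub>E x r)"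
          unfolding B_def using r by (intro sum_mono2 finite_ball ball_mono m_nonneg) auto
        then show "sum m B \<le> C\<^sub>V * r powr \<alpha>" using volume_sum(2)[OF r, of x] by linarith
      qed (use t in auto)
      also have "t ^ i = t ^ j * t ^ j" by (simp add: i_def power_add[symmetric] mult_2)
      also have "1 / (2 * t ^ j) * (D * (t ^ j * t ^ j) * r powr \<alpha>) + t ^ j / 2 * (C\<^sub>V * r powr \<alpha>)
          = 1 / 2 * (D + C\<^sub>V) * r powr \<alpha> * t ^ j"
        using t by (simp add: field_simps)
      finally show ?thesis .
    qed
    have "P x \<le> exit_prob M k (ball\<^sub>E x r) (s + n) x"
      unfolding P_def by (intro exit_prob_mono k_substochastic) simp
    also have "\<dots> \<le> exit_prob M k B s x + (K ^^ s) (\<lambda>y. indicator B y * P y) x"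
      unfolding P_def B_def using r by (intro exit_prob_split k_substochastic ball_mono) simp
    also have "(K ^^ s) (\<lambda>y. indicator B y * P y) x = kernel_op M (k\<^sub>n s) (\<lambda>y. indicator B y * P y) x"
      unfolding P_def
      by (intro kernel_op_pow k s bounded_range_indicator_mult exit_prob_bounded k_substochastic)
    also have "\<dots> = (\<Sum>y\<in>B. k\<^sub>n s x y * (indicator B y * P y) * m y)"
      by (rule kernel_op_finite[OF fB]) simp
    also have "\<dots> \<le> (\<Sum>y\<in>B. real n * \<tau> * (k\<^sub>n s x y * m y) + C\<^sub>0 * real s powr (- e) * (Q y * m y))"
    proof (rule sum_mono)
      fix y assume "y \<in> B"
      have k0: "0 \<le> k\<^sub>n s x y" by (rule iter_kernel_markov(1)[OF k s(1)])
      have "k\<^sub>n s x y * P y \<le> k\<^sub>n s x y * (Q y + real n * \<tau>)" by (intro mult_left_mono PQ k0)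
      also have "\<dots> \<le> real n * \<tau> * k\<^sub>n s x y + C\<^sub>0 * real s powr (- e) * Q y"
        using mult_right_mono[OF on[OF s(1), of x y] Q0[of y]] by (simp add: algebra_simps)
      finally have "k\<^sub>n s x y * P y * m y \<le> (real n * \<tau> * k\<^sub>n s x y + C\<^sub>0 * real s powr (- e) * Q y) * m y"
        using m_nonneg by (rule mult_right_mono)
      then show "k\<^sub>n s x y * (indicator B y * P y) * m y
          \<le> real n * \<tau> * (k\<^sub>n s x y * m y) + C\<^sub>0 * real s powr (- e) * (Q y * m y)"
        using \<open>y \<in> B\<close> by (simp add: algebra_simps)
    qed
    also have "\<dots> = real n * \<tau> * (\<Sum>y\<in>B. k\<^sub>n s x y * m y) + C\<^sub>0 * real s powr (- e) * (\<Sum>y\<in>B. Q y * m y)"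
      by (simp only: sum.distrib sum_distrib_left)
    also have "\<dots> \<le> real n * \<tau> * 1 + C\<^sub>0 * (\<theta> * real n) powr (- e) * (1 / 2 * (D + C\<^sub>V) * r powr \<alpha> * t ^ j)"
      using \<tau>0 C0 s \<theta> n e Q0 m_nonneg
      by (intro add_mono mult_left_mono mult_mono Qsum powr_mono2' sum_nonneg
          substochastic_sum_le iter_kernel_substochastic k fB) auto
    also have "real n * \<tau> = C\<^sub>T * (6 * real i) powr \<beta> * t"
      by (simp add: \<tau>_def \<rho>_def t_def powr_divide powr_minus_divide)
    also have "C\<^sub>0 * (\<theta> * real n) powr (- e) * (1 / 2 * (D + C\<^sub>V) * r powr \<alpha> * t ^ j)
        = C\<^sub>0 * \<theta> powr (- e) * (1 / 2 * (D + C\<^sub>V)) * ((real n powr (- e) * r powr \<alpha>) * t ^ j)"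
      using \<theta> n by (simp add: powr_mult mult_ac)
    also have "\<dots> \<le> C\<^sub>0 * \<theta> powr (- e) * (1 / 2 * (D + C\<^sub>V)) * t"
    proof (rule mult_left_mono)
      have "real n powr (- e) * r powr \<alpha> = t powr (- e)"
        using n r \<beta> by (simp add: t_def powr_mult powr_powr e_def)
      moreover have "t ^ j \<le> t powr (1 + e)"
      proof -
        have "t ^ j = t powr real j" using t by (simp add: powr_realpow)
        also have "\<dots> \<le> t powr (1 + e)" using t j by (intro powr_mono') auto
        finally show ?thesis .
      qed
      then have "t powr (- e) * t ^ j \<le> t powr (- e) * t powr (1 + e)" by (intro mult_left_mono) auto
      moreover have "t powr (- e) * t powr (1 + e) = t" using t by (simp add: powr_add[symmetric])
      ultimately show "(real n powr (- e) * r powr \<alpha>) * t ^ j \<le> t" by simp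
    qed (use C0 D C\<^sub>V in auto)
    finally show ?thesis by (simp add: P_def B_def t_def algebra_simps)
  qed

  have main: "exit_prob M k (ball\<^sub>E x r) n x \<le> A * real n * r powr (- \<beta>)" if "0 < r" for n x r
    using that
  proof (induction n arbitrary: x r rule: less_induct)
    case (less n)
    note r = less.prems
    define t where "t = real n * r powr (- \<beta>)"
    show ?case
    proof (cases "n = 0")
      case True
      then show ?thesis using r by (simp add: mem_ball)
    next
      case False
      then have n: "1 \<le> n" by simp
      show ?thesis
      proof (cases "1 \<le> r \<and> t \<le> 1")
        case False
        have "1 \<le> t"
        proof (cases "1 \<le> r")
          case True
          then show ?thesis using False by simp
        next
          case r1: False
          then have "1 \<le> r powr (- \<beta>)" using r \<beta> powr_mono2'[of "- \<beta>" r 1] by simp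
          then show ?thesis using n mult_mono[of 1 "real n" 1 "r powr (- \<beta>)"] by (simp add: t_def)
        qed
        then have "1 * 1 \<le> A * t" using A by (intro mult_mono) auto
        then show ?thesis
          using exit_prob_le_1[OF k_substochastic, of "ball\<^sub>E x r" n x] by (simp add: t_def mult.assoc)
      next
        case rt: True
        have t0: "0 < t" using r n by (simp add: t_def)
        have half: "(r / 2) powr (- \<beta>) = 2 powr \<beta> * r powr (- \<beta>)"
          by (simp add: powr_divide powr_minus_divide)
        show ?thesis
        proof (cases "n = 1")
          case True
          have "C\<^sub>T * r powr (- \<beta>) \<le> A * r powr (- \<beta>)" using A by (intro mult_right_mono) auto
          then show ?thesis using short[OF r, of x] True by simp
        next
          case False
          then have n2: "2 \<le> n" using n by simp
          define s where "s = nat \<lceil>\<theta> * real n\<rceil>"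
          have s_ge: "\<theta> * real n \<le> real s" "real s < \<theta> * real n + 1"
            unfolding s_def using \<theta> n by (auto simp: of_nat_nat) (linarith)+
          have s1: "1 \<le> s" using s_ge(1) \<theta> n by (cases s) (auto simp: mult_le_0_iff)
          have "exit_prob M k (ball\<^sub>E x (r / 2)) s x \<le> (A / 2 + C\<^sub>T * 2 powr \<beta>) * t"
          \<comment> \<open>For s \<ge> 2 rounding up at most doubles \<theta>n. For s = 1 it may do
            worse, so the bound for a single jump takes the place of the induction
            hypothesis.\<close>
          proof (cases "s = 1")
            case True
            have "exit_prob M k (ball\<^sub>E x (r / 2)) s x \<le> C\<^sub>T * 2 powr \<beta> * r powr (- \<beta>)"
              using short[of "r / 2" x] r unfolding True half by (simp add: mult_ac)
            also have "\<dots> \<le> C\<^sub>T * 2 powr \<beta> * t"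
              using CT n r by (intro mult_left_mono) (auto simp: t_def)
            also have "\<dots> \<le> (A / 2 + C\<^sub>T * 2 powr \<beta>) * t"
              using A t0 by (intro mult_right_mono) auto
            finally show ?thesis .
          next
            case False
            then have "2 \<le> real s" using s1 by simp
            then have s2: "real s \<le> 2 * (\<theta> * real n)" using s_ge by linarith
            have "2 * (\<theta> * real n) < real n" using \<theta> n by (simp add: mult.assoc[symmetric])
            then have "s < n" using s2 by linarith
            then have "exit_prob M k (ball\<^sub>E x (r / 2)) s x \<le> A * real s * (r / 2) powr (- \<beta>)"
              using r by (intro less.IH) auto
            also have "\<dots> \<le> A * (2 * (\<theta> * real n)) * (r / 2) powr (- \<beta>)"
              using A s2 by (intro mult_right_mono mult_left_mono) auto
            also have "\<dots> = A * 2 * (2 powr \<beta> * \<theta>) * t" unfolding half by (simp add: t_def mult_ac)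
            also have "\<dots> = A / 2 * t" unfolding \<theta>(3) by simp
            also have "\<dots> \<le> (A / 2 + C\<^sub>T * 2 powr \<beta>) * t"
              using CT t0 by (intro mult_right_mono) auto
            finally show ?thesis .
          qed
          moreover have "exit_prob M k (ball\<^sub>E x r) n x \<le> exit_prob M k (ball\<^sub>E x (r / 2)) s x
              + (C\<^sub>T * (6 * real i) powr \<beta> + C\<^sub>0 * \<theta> powr (- e) * (1 / 2 * (D + C\<^sub>V))) * t"
            unfolding t_def using rt n s1 s_ge by (intro later) (auto simp: t_def)
          ultimately have "exit_prob M k (ball\<^sub>E x r) n x \<le> (A / 2 + G) * t"
            by (simp add: G_def algebra_simps)
          also have "\<dots> \<le> A * t" using A t0 by (intro mult_right_mono) auto
          finally show ?thesis by (simp add: t_def mult.assoc)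
        qed
      qed
    qed
  qed
  show ?thesis by (rule that[of A]) (use A main in \<open>auto simp: exit_bounded_def\<close>)
qed

section \<open>The equivalence by way of the exit estimate\<close>

lemma UHKP_iff_CSJ: "UHKP E M \<alpha> \<beta> k \<longleftrightarrow> CSJ E M \<beta> k"
proof
  assume "UHKP E M \<alpha> \<beta> k"
  then obtain C where "exit_bounded C" by (rule UHKP_imp_exit_bounded)
  then obtain C\<^sub>1 C\<^sub>2 where "cutoff_inequality C\<^sub>1 C\<^sub>2" by (rule exit_bounded_imp_cutoff_inequality)
  then show "CSJ E M \<beta> k" by (rule cutoff_inequality_imp_CSJ)
next
  assume "CSJ E M \<beta> k"
  then obtain C\<^sub>1 C\<^sub>2 where "cutoff_inequality C\<^sub>1 C\<^sub>2" by (rule CSJ_imp_cutoff_inequality)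
  then obtain C where "exit_bounded C" by (rule cutoff_inequality_imp_exit_bounded)
  then show "UHKP E M \<alpha> \<beta> k" by (rule exit_bounded_imp_UHKP)
qed

end

theorem theorem1p5:
  fixes E :: "('a \<times> 'a) set" and M :: "'a measure"
    and k :: "'a \<Rightarrow> 'a \<Rightarrow> real" and d\<^sub>f \<beta> :: real
  assumes "vertex_weighted_graph E M"
    and "d\<^sub>f > 0" and "volume_growth E M d\<^sub>f"
    and "symmetric_markov_kernel M k"
    and "\<beta> \<ge> 2" and "jump_bounds E d\<^sub>f \<beta> k"
  shows "UHKP E M d\<^sub>f \<beta> k \<longleftrightarrow> CSJ E M \<beta> k"
proof -
  obtain C\<^sub>V where CV: "C\<^sub>V > 0" "\<And>x r. r \<ge> 1 \<Longrightarrow> ennreal (inverse C\<^sub>V * r powr d\<^sub>f) \<le> emeasure M (graph_ball E x r) \<and>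
      emeasure M (graph_ball E x r) \<le> ennreal (C\<^sub>V * r powr d\<^sub>f)"
    using assms(3) unfolding volume_growth_def by blast
  obtain C\<^sub>J where CJ: "C\<^sub>J > 0" "\<And>x y. inverse C\<^sub>J * (1 + real (graph_dist E x y)) powr (- (d\<^sub>f + \<beta>)) \<le> k x y \<and>
      k x y \<le> C\<^sub>J * (1 + real (graph_dist E x y)) powr (- (d\<^sub>f + \<beta>))"
    using assms(6) unfolding jump_bounds_def by blast
  interpret vertex_weighted_graph E M by (rule assms(1))
  interpret jump_walk E M k d\<^sub>f \<beta> C\<^sub>V C\<^sub>J
    by unfold_locales (use assms(2,4,5) CV CJ in auto)
  show ?thesis by (rule UHKP_iff_CSJ)
qed

end
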